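(* Let $C$ be a curve of degree $d$. Let $(n_1,\dots,n_k)\in\mathbb{N}^k$ be a $k$-tuple, and let $\tilde C=T_{(n_1,\dots,n_k)}(C)$. Then $\tilde C$ has $k+1$ additional singularities to those of $C$: $k$ $d$-tacnodes of order $n_i-1$ ($1\le i\le k$), and another singular point which is a blow down of a $d$-tacnode of order $n_1+\cdots+n_k-1$ (i.e., the curve has the following additional singularities: $[d_{n_1}],\dots,[d_{n_k}]$ and $[d(n_1+\cdots+n_k),\,d_{(n_1+\cdots+n_k)}]$).
   Context: Curves are complex plane projective curves and $\mathbb{N}=\{1,2,3,\dots\}$. Singularity types: if a singular point $P$ is resolved by a sequence of $s$ blow-ups, with only one singular point appearing at each blow-up, and $t_i>1$ ($1\le i\le s$) is the multiplicity of the curve at $P$ before the $i$-th blow-up, then $[t_1,\dots,t_s]$ is called the type of the singularity. A sequence of $r$ equal multiplicities $l$ is abbreviated $l_r$ (e.g. $[2,2,2]=[2_3]$). A $d$-tacnode is a singular point where $d$ smooth branches of the curve have a common tangent at the same point; a $d$-tacnode of order $k$ is a $d$-tacnode such that the higher derivatives of the branches are also equal up to order $k$ (the usual tacnode is a $2$-tacnode of order $1$). A blow down of a $d$-tacnode is the singular point obtained from a $d$-tacnode located on an exceptional curve when that curve is blown down. The Hirzebruch surface $F_n$ is the $\mathbb{P}^1$-bundle over $\mathbb{P}^1$ whose exceptional section has self-intersection $-n$. Elementary transformations: the first type ($F_n$ to $F_{n+1}$) blows up a point on the exceptional section and then blows down the proper transform of the fiber through that point. The second type ($F_n$ to $F_{n-1}$)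 blows up a point on a fiber $Q$, outside the exceptional section, and then blows down the proper transform of $Q$. In both cases the transformation is said to be performed on that fiber; the new fiber (the exceptional curve of the blow-up) replaces the old one and is called its proper transform. Construction of $T_{(n_1,\dots,n_k)}$: take $k$ different lines $Q_1,\dots,Q_k$, all meeting $C$ transversally and intersecting in a point $O$ outside $C$, in such a way that, for a disk $D$ centered at $O$, the intersection points of the lines with the boundary of $D$ are organized counterclockwise. An additional line $P$ also passes through $O$ and intersects $C$ transversally. Blow up $O$ to get $F_1$. Apply $n_i$ elementary transformations of the first type on the proper transform of $Q_i$ for all $i$, reaching $F_{(\sum n_i)+1}$. Then apply $\sum n_i$ elementary transformations of the second type on the proper transform of $P$, returning to $F_1$. Finally blow down the exceptional section to get $\mathbb{P}^2$. This defines the Cremona transformation $T_{(n_1,\dots,n_k)}$; the image of $C$ is its proper transform.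
   Formalization: The degree d is assumed at least 2 (for a line the new points are not of the stated types), and the points blown up in the second-type transformations are assumed not to lie on the curve; if the first lay on the curve, the last singularity would have multiplicity below d(n_1+...+n_k). *)

theory Defs
  imports "HOL-Analysis.Analysis" "HOL-Computational_Algebra.Computational_Algebra"
begin

section \<open>The projective plane, curves and lines\<close>

text \<open>
  A point of the plane is the set of its homogeneous coordinate vectors.
  A polynomial in three variables x, y, z is a nested polynomial with z outermost:
  the coefficient of x^i y^j z^k in F is coeff (coeff (coeff F k) j) i.  Likewise a
  complex poly poly is a polynomial in x, y with y outermost.
\<close>

definition ppoint :: "complex ^ 3 \<Rightarrow> (complex ^ 3) set" where
  "ppoint v = {c *s v |c. c \<noteq> 0}"

definition basis3 :: "complex ^ 3 \<Rightarrow> complex ^ 3 \<Rightarrow> complex ^ 3 \<Rightarrow> bool" where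
  "basis3 u v w \<longleftrightarrow> det (vector [u, v, w] :: complex ^ 3 ^ 3) \<noteq> 0"

text \<open>Evaluation at elements of a commutative algebra whose structure map is h.\<close>

definition ev2 :: "(complex \<Rightarrow> 'a) \<Rightarrow> complex poly poly \<Rightarrow> 'a \<Rightarrow> 'a \<Rightarrow> 'a::comm_ring_1" where
  "ev2 h f x y = poly (map_poly (\<lambda>p. poly (map_poly h p) x) f) y"

definition ev3 ::
  "(complex \<Rightarrow> 'a) \<Rightarrow> complex poly poly poly \<Rightarrow> 'a \<Rightarrow> 'a \<Rightarrow> 'a \<Rightarrow> 'a::comm_ring_1" where
  "ev3 h F x y z = poly (map_poly (\<lambda>f. ev2 h f x y) F) z"

definition form_at :: "complex poly poly poly \<Rightarrow> complex ^ 3 \<Rightarrow> complex" where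
  "form_at F v = ev3 (\<lambda>c. c) F (v $ 1) (v $ 2) (v $ 3)"

definition gradient :: "complex poly poly poly \<Rightarrow> complex ^ 3 \<Rightarrow> complex ^ 3" where
  "gradient F v =
     vector [form_at (map_poly (map_poly pderiv) F) v,
             form_at (map_poly pderiv F) v,
             form_at (pderiv F) v]"

definition plane_curve :: "nat \<Rightarrow> complex poly poly poly \<Rightarrow> bool" where
  "plane_curve d F \<longleftrightarrow> F \<noteq> 0 \<and>
     (\<forall>i j k. coeff (coeff (coeff F k) j) i \<noteq> 0 \<longrightarrow> i + j + k = d)"

definition curve_points :: "complex poly poly poly \<Rightarrow> (complex ^ 3) set set" where
  "curve_points F = {ppoint v |v. v \<noteq> 0 \<and> form_at F v = 0}"

definition singular_points :: "complex poly poly poly \<Rightarrow> (complex ^ 3) set set" where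
  "singular_points F = {ppoint v |v. v \<noteq> 0 \<and> form_at F v = 0 \<and> gradient F v = 0}"

definition pairing :: "complex ^ 3 \<Rightarrow> complex ^ 3 \<Rightarrow> complex" where
  "pairing m v = (\<Sum>i\<in>UNIV. m $ i * v $ i)"

definition pline :: "complex ^ 3 \<Rightarrow> (complex ^ 3) set set" where
  "pline m = {ppoint v |v. v \<noteq> 0 \<and> pairing m v = 0}"

text \<open>For a line m: every common point is a smooth point of F whose tangent is not m.\<close>

definition transversal :: "complex poly poly poly \<Rightarrow> complex ^ 3 \<Rightarrow> bool" where
  "transversal F m \<longleftrightarrow>
     (\<forall>v. v \<noteq> 0 \<and> form_at F v = 0 \<and> pairing m v = 0 \<longrightarrow> \<not> (\<exists>c. gradient F v = c *s m))"


section \<open>Germs of plane curves at the origin\<close>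

definition mult_at_0 :: "complex poly poly \<Rightarrow> nat" where
  "mult_at_0 f = (LEAST m. \<exists>i j. i + j = m \<and> coeff (coeff f j) i \<noteq> 0)"

definition singular_at_0 :: "complex poly poly \<Rightarrow> bool" where
  "singular_at_0 f \<longleftrightarrow> mult_at_0 f > 1"

text \<open>
  Blow up the origin.  The exceptional curve consists of the directions (1, c), written
  Some c, and (0, 1), written None.  The germ of the proper transform at such a point, in
  coordinates of the blow-up centred there, is f (x, x (y + c)) / x^m, respectively
  f (x y, y) / y^m, where m is the multiplicity of f.
\<close>

fun proper_germ :: "complex poly poly \<Rightarrow> complex option \<Rightarrow> complex poly poly" where
  "proper_germ f (Some c) =
     ev2 (\<lambda>a. [:[:a:]:]) f [:[:0, 1:]:] [:[:0, c:], [:0, 1:]:] div [:[:0, 1:]:] ^ mult_at_0 f"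
| "proper_germ f None =
     ev2 (\<lambda>a. [:[:a:]:]) f [:0, [:0, 1:]:] [:0, 1:] div [:0, 1:] ^ mult_at_0 f"

text \<open>The singularity type [t1, ..., ts].\<close>

fun has_type :: "complex poly poly \<Rightarrow> nat list \<Rightarrow> bool" where
  "has_type f [] \<longleftrightarrow> False"
| "has_type f [t] \<longleftrightarrow>
     f \<noteq> 0 \<and> mult_at_0 f = t \<and> t > 1 \<and> (\<forall>e. \<not> singular_at_0 (proper_germ f e))"
| "has_type f (t # t' # ts) \<longleftrightarrow>
     f \<noteq> 0 \<and> mult_at_0 f = t \<and> t > 1 \<and>
     (\<exists>e. singular_at_0 (proper_germ f e) \<and>
          (\<forall>e'. e' \<noteq> e \<longrightarrow> \<not> singular_at_0 (proper_germ f e')) \<and>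
          has_type (proper_germ f e) (t' # ts))"

text \<open>
  d-tacnode of order k.  In suitable linear coordinates the germ is, up to a unit u, the
  union of the d graphs y = \<phi> j (x).  The order is meant exactly: any two branches agree up
  to the k-th derivative and differ in the next one.  For k \<ge> 1 the branches therefore have
  a common tangent; for k = 0 the germ is an ordinary d-fold point.
\<close>

definition tacnode :: "nat \<Rightarrow> nat \<Rightarrow> complex poly poly \<Rightarrow> bool" where
  "tacnode d k f \<longleftrightarrow>
     (\<exists>(\<alpha>::complex) \<beta> \<gamma> \<delta> (\<phi> :: nat \<Rightarrow> complex fps) (u :: complex fps poly).
        \<alpha> * \<delta> - \<beta> * \<gamma> \<noteq> 0 \<and>
        fps_nth (coeff u 0) 0 \<noteq> 0 \<and>
        map_poly fps_of_poly (ev2 (\<lambda>a. [:[:a:]:]) f [:[:0, \<alpha>:], [:\<beta>:]:] [:[:0, \<gamma>:], [:\<delta>:]:])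
          = u * (\<Prod>j<d. [:- \<phi> j, 1:]) \<and>
        (\<forall>j<d. fps_nth (\<phi> j) 0 = 0) \<and>
        (\<forall>i<d. \<forall>j<d. \<forall>l\<le>k. fps_nth (\<phi> i) l = fps_nth (\<phi> j) l) \<and>
        (\<forall>i<d. \<forall>j<d. i \<noteq> j \<longrightarrow> fps_nth (\<phi> i) (k + 1) \<noteq> fps_nth (\<phi> j) (k + 1)))"

text \<open>The proper transform meets the exceptional curve in a single point, the tacnode.\<close>

definition blow_down_of_tacnode :: "nat \<Rightarrow> nat \<Rightarrow> complex poly poly \<Rightarrow> bool" where
  "blow_down_of_tacnode d k f \<longleftrightarrow>
     f \<noteq> 0 \<and>
     (\<exists>e. tacnode d k (proper_germ f e) \<and>
          (\<forall>e'. e' \<noteq> e \<longrightarrow> coeff (coeff (proper_germ f e') 0) 0 \<noteq> 0))"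

definition holomorphic2 ::
  "(complex \<times> complex \<Rightarrow> complex \<times> complex) \<Rightarrow> (complex \<times> complex) set \<Rightarrow> bool" where
  "holomorphic2 h U \<longleftrightarrow>
     (\<forall>z\<in>U. \<exists>D. (h has_derivative D) (at z) \<and>
        (\<forall>c w. D (c * fst w, c * snd w) = (c * fst (D w), c * snd (D w))))"

text \<open>Analytic equivalence of the germs of the zero sets (used for reduced curves only).\<close>

definition analytically_equivalent :: "complex poly poly \<Rightarrow> complex poly poly \<Rightarrow> bool" where
  "analytically_equivalent f g \<longleftrightarrow>
     (\<exists>U V h h'. open U \<and> open V \<and> (0, 0) \<in> U \<and> homeomorphism U V h h' \<and>
        holomorphic2 h U \<and> holomorphic2 h' V \<and> h (0, 0) = (0, 0) \<and>
        (\<forall>x y. (x, y) \<in> U \<longrightarrow>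
           (ev2 (\<lambda>c. c) f x y = 0 \<longleftrightarrow> ev2 (\<lambda>c. c) g (fst (h (x, y))) (snd (h (x, y))) = 0)))"


section \<open>Singularities of a plane curve\<close>

text \<open>f (x, y) = F (v + x a + y b) is the equation of F in an affine chart centred at p.\<close>

definition local_equation ::
  "complex poly poly poly \<Rightarrow> (complex ^ 3) set \<Rightarrow> complex poly poly \<Rightarrow> bool" where
  "local_equation F p f \<longleftrightarrow>
     (\<exists>v a b. p = ppoint v \<and> basis3 v a b \<and>
        f = ev3 (\<lambda>c. [:[:c:]:]) F
              [:[:v $ 1, a $ 1:], [:b $ 1:]:]
              [:[:v $ 2, a $ 2:], [:b $ 2:]:]
              [:[:v $ 3, a $ 3:], [:b $ 3:]:])"

definition type_at :: "complex poly poly poly \<Rightarrow> (complex ^ 3) set \<Rightarrow> nat list \<Rightarrow> bool" where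
  "type_at F p ts \<longleftrightarrow> (\<exists>f. local_equation F p f \<and> has_type f ts)"

definition tacnode_at ::
  "nat \<Rightarrow> nat \<Rightarrow> complex poly poly poly \<Rightarrow> (complex ^ 3) set \<Rightarrow> bool" where
  "tacnode_at d k F p \<longleftrightarrow> (\<exists>f. local_equation F p f \<and> tacnode d k f)"

definition blow_down_of_tacnode_at ::
  "nat \<Rightarrow> nat \<Rightarrow> complex poly poly poly \<Rightarrow> (complex ^ 3) set \<Rightarrow> bool" where
  "blow_down_of_tacnode_at d k F p \<longleftrightarrow>
     (\<exists>f. local_equation F p f \<and> blow_down_of_tacnode d k f)"

definition same_singularity ::
  "complex poly poly poly \<Rightarrow> (complex ^ 3) set \<Rightarrow>
   complex poly poly poly \<Rightarrow> (complex ^ 3) set \<Rightarrow> bool" where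
  "same_singularity F p G q \<longleftrightarrow>
     (\<exists>f g. local_equation F p f \<and> local_equation G q g \<and> analytically_equivalent f g)"


section \<open>Hirzebruch surfaces\<close>

text \<open>
  The n-th surface is the quotient of pairs of nonzero vectors (s, t), (u, v) by
  (s, t; u, v) ~ (k s, k t; m u, m v / k^n), fibred over the line by (s : t).  The section
  v = 0 is disjoint from u = 0, which is linearly equivalent to it plus n fibres; hence v = 0
  has self-intersection -n and is the exceptional section.
  A fibre is given by a linear form l = (l1, l2), namely l1 s + l2 t = 0.
\<close>

type_synonym hpoint = "(complex \<times> complex \<times> complex \<times> complex) set"

definition hpoint :: "nat \<Rightarrow> complex \<Rightarrow> complex \<Rightarrow> complex \<Rightarrow> complex \<Rightarrow> hpoint" where
  "hpoint n s t u v =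
     {(k * s, k * t, m * u, m * v / k ^ n) |k m. k \<noteq> 0 \<and> m \<noteq> 0}"

definition hirzebruch :: "nat \<Rightarrow> hpoint set" where
  "hirzebruch n = {hpoint n s t u v |s t u v. (s, t) \<noteq> (0, 0) \<and> (u, v) \<noteq> (0, 0)}"

definition lin :: "complex \<times> complex \<Rightarrow> complex \<Rightarrow> complex \<Rightarrow> complex" where
  "lin l s t = fst l * s + snd l * t"

definition exceptional_section :: "nat \<Rightarrow> hpoint set" where
  "exceptional_section n = {hpoint n s t 1 0 |s t. (s, t) \<noteq> (0, 0)}"

definition fibre :: "nat \<Rightarrow> complex \<times> complex \<Rightarrow> hpoint set" where
  "fibre n l = {hpoint n s t u v |s t u v.
     (s, t) \<noteq> (0, 0) \<and> (u, v) \<noteq> (0, 0) \<and> lin l s t = 0}"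

text \<open>
  Blow-up of the plane at the point o, where a, b, o is a basis: this is the first surface
  with the map below.  It contracts v = 0 to o and maps the fibre over (s : t) onto the line
  through o and s a + t b; near v = 0 it is (t, v) \<mapsto> o + v a + v t b in the chart s = u = 1.
\<close>

definition blowdown ::
  "complex ^ 3 \<Rightarrow> complex ^ 3 \<Rightarrow> complex ^ 3 \<Rightarrow> (hpoint \<times> (complex ^ 3) set) set" where
  "blowdown a b o' =
     {(hpoint 1 s t u v, ppoint ((s * v) *s a + (t * v) *s b + u *s o')) |s t u v.
        (s, t) \<noteq> (0, 0) \<and> (u, v) \<noteq> (0, 0)}"

definition line_fibre :: "complex ^ 3 \<Rightarrow> complex ^ 3 \<Rightarrow> complex ^ 3 \<Rightarrow> complex \<times> complex" where
  "line_fibre a b m = (pairing m a, pairing m b)"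


section \<open>Elementary transformations\<close>

text \<open>
  An elementary transformation is represented by the surface W that dominates both sides, as
  a subset of the product: the first projection is the blow-up of the centre, the second
  projection the contraction of the proper transform of the fibre.

  First type, on the fibre l.  Near the centre l = v = 0 put u = 1: the equation becomes
  u' v = l v', the blow-up of (l, v) with exceptional coordinate (v' : u') = (v : l).  Near the
  point l = u' = 0 of the target put v' = 1: it becomes u' v = l u, the blow-up of (l, u'), with
  exceptional curve the old fibre.
\<close>

definition elementary1 :: "nat \<Rightarrow> complex \<times> complex \<Rightarrow> (hpoint \<times> hpoint) set" where
  "elementary1 n l =
     {(hpoint n s t u v, hpoint (Suc n) s t u' v') |s t u v u' v'.
        (s, t) \<noteq> (0, 0) \<and> (u, v) \<noteq> (0, 0) \<and> (u', v') \<noteq> (0, 0) \<and>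
        u' * v = lin l s t * u * v'}"

text \<open>
  Second type, on the fibre l, with centre the point u = B v of that fibre, where B is a form of
  degree n + 1 in s, t.  Near the centre put v = 1: the equation is (u - B) v' = l u', the
  blow-up of (l, u - B).  Near the point l = v' = 0 of the target, which lies on the exceptional
  section, put u' = 1: it is (u - B v) v' = l v, the blow-up of (l, v'), with exceptional curve
  the old fibre.  Forms B with the same value on the fibre have the same centre, and the results
  differ by an automorphism of the target.
\<close>

definition binary_form :: "nat \<Rightarrow> (nat \<Rightarrow> complex) \<Rightarrow> complex \<Rightarrow> complex \<Rightarrow> complex" where
  "binary_form n \<beta> s t = (\<Sum>i\<le>n. \<beta> i * s ^ i * t ^ (n - i))"

definition elementary2 ::
  "nat \<Rightarrow> complex \<times> complex \<Rightarrow> (nat \<Rightarrow> complex) \<Rightarrow> (hpoint \<times> hpoint) set" where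
  "elementary2 n l \<beta> =
     {(hpoint (Suc n) s t u v, hpoint n s t u' v') |s t u v u' v'.
        (s, t) \<noteq> (0, 0) \<and> (u, v) \<noteq> (0, 0) \<and> (u', v') \<noteq> (0, 0) \<and>
        (u - binary_form (Suc n) \<beta> s t * v) * v' = lin l s t * v * u'}"

definition centre1 :: "nat \<Rightarrow> complex \<times> complex \<Rightarrow> hpoint" where
  "centre1 n l = hpoint n (snd l) (- fst l) 1 0"

definition centre2 :: "nat \<Rightarrow> complex \<times> complex \<Rightarrow> (nat \<Rightarrow> complex) \<Rightarrow> hpoint" where
  "centre2 n l \<beta> =
     hpoint (Suc n) (snd l) (- fst l) (binary_form (Suc n) \<beta> (snd l) (- fst l)) 1"


subsection \<open>The Cremona transformation\<close>

fun elementary1_chain :: "nat \<Rightarrow> (complex \<times> complex) list \<Rightarrow> (hpoint \<times> hpoint) set" where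
  "elementary1_chain n [] = Id"
| "elementary1_chain n (l # ls) = elementary1 n l O elementary1_chain (Suc n) ls"

text \<open>
  r transformations of the second type on the same fibre.  X is the set of points of the
  curve on the current surface; the centres are chosen off the curve, so that the image of X
  is again the proper transform.
\<close>

inductive elementary2_chain ::
  "complex \<times> complex \<Rightarrow> nat \<Rightarrow> hpoint set \<Rightarrow> nat \<Rightarrow> (hpoint \<times> hpoint) set \<Rightarrow> bool"
  for l :: "complex \<times> complex" where
  "elementary2_chain l n X 0 Id"
| "centre2 n l \<beta> \<notin> X \<Longrightarrow>
   elementary2_chain l n (elementary2 n l \<beta> `` X) r Z \<Longrightarrow>
   elementary2_chain l (Suc n) X (Suc r) (elementary2 n l \<beta> O Z)"

text \<open>
  O is the point with coordinate vector o', the lines are the zero sets of P and of the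
  members of Qs.
\<close>

definition line_configuration ::
  "complex poly poly poly \<Rightarrow> complex ^ 3 \<Rightarrow> (complex ^ 3) list \<Rightarrow> complex ^ 3 \<Rightarrow> bool" where
  "line_configuration F o' Qs P \<longleftrightarrow>
     o' \<noteq> 0 \<and> form_at F o' \<noteq> 0 \<and>
     distinct (map pline (P # Qs)) \<and>
     (\<forall>m\<in>set (P # Qs). m \<noteq> 0 \<and> pairing m o' = 0 \<and> transversal F m)"

text \<open>
  T is a transformation obtained by the construction for the tuple ns.  The auxiliary
  choices are the coordinates of both planes, the automorphisms of the intermediate surfaces
  and the centres of the transformations of the second type.
\<close>

definition is_cremona_T ::
  "complex poly poly poly \<Rightarrow> complex ^ 3 \<Rightarrow> (complex ^ 3) list \<Rightarrow> complex ^ 3 \<Rightarrow> nat list \<Rightarrow>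
   ((complex ^ 3) set \<times> (complex ^ 3) set) set \<Rightarrow> bool" where
  "is_cremona_T F o' Qs P ns T \<longleftrightarrow>
     (\<exists>a b a1 b1 o1 U Z.
        basis3 a b o' \<and> basis3 a1 b1 o1 \<and>
        U = (blowdown a b o')\<inverse> O
            elementary1_chain 1 (concat (map2 replicate ns (map (line_fibre a b) Qs))) \<and>
        elementary2_chain (line_fibre a b P) (sum_list ns + 1) (U `` curve_points F)
          (sum_list ns) Z \<and>
        T = U O Z O blowdown a1 b1 o1)"

text \<open>
  G is the reduced equation of the Zariski closure of the T-image of the points of F off the
  lines (where T is an isomorphism), i.e. a generator of its homogeneous ideal.
\<close>

definition proper_transform ::
  "((complex ^ 3) set \<times> (complex ^ 3) set) set \<Rightarrow> (complex ^ 3) list \<Rightarrow>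
   complex poly poly poly \<Rightarrow> complex poly poly poly \<Rightarrow> bool" where
  "proper_transform T ms F G \<longleftrightarrow>
     (\<exists>e. plane_curve e G) \<and>
     (let S = T `` (curve_points F - \<Union> (pline ` set ms)) in
        S \<subseteq> curve_points G \<and>
        (\<forall>e H. plane_curve e H \<and> S \<subseteq> curve_points H \<longrightarrow> G dvd H))"


subsection \<open>The elementary transformations blow up a point and contract the fibre\<close>

lemma hpoint_eqD:
  assumes "hpoint n s t u v = hpoint n s' t' u' v'"
  obtains k0 m0 where "k0 \<noteq> 0" "m0 \<noteq> 0" "s' = k0 * s" "t' = k0 * t" "u' = m0 * u" "v' = m0 * v / k0 ^ n"
proof -
  have "(s', t', u', v') \<in> hpoint n s' t' u' v'"
    unfolding hpoint_def by (rule CollectI, rule exI[of _ 1], rule exI[of _ 1]) auto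
  then have "(s', t', u', v') \<in> hpoint n s t u v"
    by (simp only: assms)
  then have "\<exists>k0 m0. (s', t', u', v') = (k0 * s, k0 * t, m0 * u, m0 * v / k0 ^ n) \<and>
      k0 \<noteq> 0 \<and> m0 \<noteq> 0"
    by (simp only: hpoint_def mem_Collect_eq)
  then show ?thesis
    using that by (elim exE conjE) (simp only: prod.inject)
qed

lemma hpoint_scale:
  assumes "k0 \<noteq> 0" "m0 \<noteq> 0"
  shows "hpoint n (k0 * s) (k0 * t) (m0 * u) (m0 * v / k0 ^ n) = hpoint n s t u v"
proof (intro equalityI subsetI)
  fix x assume "x \<in> hpoint n (k0 * s) (k0 * t) (m0 * u) (m0 * v / k0 ^ n)"
  then obtain k m where km: "k \<noteq> 0" "m \<noteq> 0"
    "x = (k * (k0 * s), k * (k0 * t), m * (m0 * u), m * (m0 * v / k0 ^ n) / k ^ n)"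
    unfolding hpoint_def by blast
  show "x \<in> hpoint n s t u v"
    unfolding hpoint_def
    by (rule CollectI, rule exI[of _ "k * k0"], rule exI[of _ "m * m0"])
       (use km assms in \<open>auto simp: power_mult_distrib field_simps\<close>)
next
  fix x assume "x \<in> hpoint n s t u v"
  then obtain k m where km: "k \<noteq> 0" "m \<noteq> 0" "x = (k * s, k * t, m * u, m * v / k ^ n)"
    unfolding hpoint_def by blast
  show "x \<in> hpoint n (k0 * s) (k0 * t) (m0 * u) (m0 * v / k0 ^ n)"
    unfolding hpoint_def
    by (rule CollectI, rule exI[of _ "k / k0"], rule exI[of _ "m / m0"])
       (use km assms in \<open>auto simp: power_divide field_simps\<close>)
qed

lemma elementary1_iff:
  assumes "(s, t) \<noteq> (0, 0)" "(u, v) \<noteq> (0, 0)" "(u', v') \<noteq> (0, 0)"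
  shows "(hpoint n s t u v, hpoint (Suc n) s t u' v') \<in> elementary1 n l \<longleftrightarrow>
         u' * v = lin l s t * u * v'"
proof
  assume "(hpoint n s t u v, hpoint (Suc n) s t u' v') \<in> elementary1 n l"
  then obtain s1 t1 u1 v1 u1' v1' where
    1: "hpoint n s1 t1 u1 v1 = hpoint n s t u v"
       "hpoint (Suc n) s1 t1 u1' v1' = hpoint (Suc n) s t u' v'"
    and 2: "u1' * v1 = lin l s1 t1 * u1 * v1'"
    unfolding elementary1_def by auto
  from 1(1) obtain k0 m0 where a: "k0 \<noteq> 0" "m0 \<noteq> 0" "s = k0 * s1" "t = k0 * t1" "u = m0 * u1"
    "v = m0 * v1 / k0 ^ n" by (rule hpoint_eqD)
  from 1(2) obtain k0' m0' where b: "k0' \<noteq> 0" "m0' \<noteq> 0" "s = k0' * s1" "t = k0' * t1"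
    "u' = m0' * u1'" "v' = m0' * v1' / k0' ^ Suc n" by (rule hpoint_eqD)
  have "k0' = k0" using a b assms(1) by auto
  moreover have "lin l s t = k0 * lin l s1 t1"
    unfolding a lin_def by (simp add: algebra_simps)
  moreover have "u' * v = m0 * m0' / k0 ^ n * (u1' * v1)"
    unfolding a b by simp
  ultimately show "u' * v = lin l s t * u * v'"
    unfolding 2 using a(1) a(5) b(6) by simp
next
  assume "u' * v = lin l s t * u * v'"
  then show "(hpoint n s t u v, hpoint (Suc n) s t u' v') \<in> elementary1 n l"
    unfolding elementary1_def using assms by blast
qed

lemma binary_form_scale: "binary_form n \<beta> (k0 * s) (k0 * t) = k0 ^ n * binary_form n \<beta> s t"
  unfolding binary_form_def sum_distrib_left
proof (rule sum.cong)
  fix i assume "i \<in> {..n}"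
  then have "k0 ^ n = k0 ^ i * k0 ^ (n - i)" by (simp flip: power_add)
  then show "\<beta> i * (k0 * s) ^ i * (k0 * t) ^ (n - i) = k0 ^ n * (\<beta> i * s ^ i * t ^ (n - i))"
    by (simp add: power_mult_distrib)
qed simp

lemma elementary2_iff:
  assumes "(s, t) \<noteq> (0, 0)" "(u, v) \<noteq> (0, 0)" "(u', v') \<noteq> (0, 0)"
  shows "(hpoint (Suc n) s t u v, hpoint n s t u' v') \<in> elementary2 n l \<beta> \<longleftrightarrow>
         (u - binary_form (Suc n) \<beta> s t * v) * v' = lin l s t * v * u'"
proof
  assume "(hpoint (Suc n) s t u v, hpoint n s t u' v') \<in> elementary2 n l \<beta>"
  then obtain s1 t1 u1 v1 u1' v1' where
    1: "hpoint (Suc n) s1 t1 u1 v1 = hpoint (Suc n) s t u v"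
       "hpoint n s1 t1 u1' v1' = hpoint n s t u' v'"
    and 2: "(u1 - binary_form (Suc n) \<beta> s1 t1 * v1) * v1' = lin l s1 t1 * v1 * u1'"
    unfolding elementary2_def by auto
  from 1(1) obtain k0 m0 where a: "k0 \<noteq> 0" "m0 \<noteq> 0" "s = k0 * s1" "t = k0 * t1" "u = m0 * u1"
    "v = m0 * v1 / k0 ^ Suc n" by (rule hpoint_eqD)
  from 1(2) obtain k0' m0' where b: "k0' \<noteq> 0" "m0' \<noteq> 0" "s = k0' * s1" "t = k0' * t1"
    "u' = m0' * u1'" "v' = m0' * v1' / k0' ^ n" by (rule hpoint_eqD)
  have eq: "k0' = k0" using a b assms(1) by auto
  have "u - binary_form (Suc n) \<beta> s t * v = m0 * (u1 - binary_form (Suc n) \<beta> s1 t1 * v1)"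
    using a(1) unfolding a(3-6) binary_form_scale by (simp add: field_simps)
  then have "(u - binary_form (Suc n) \<beta> s t * v) * v' =
      m0 * m0' / k0 ^ n * ((u1 - binary_form (Suc n) \<beta> s1 t1 * v1) * v1')"
    using b eq by simp
  also have "\<dots> = k0 * lin l s1 t1 * v * u'"
    unfolding 2 using a(1) a(6) b(5) by simp
  also have "k0 * lin l s1 t1 = lin l s t"
    unfolding a lin_def by (simp add: algebra_simps)
  finally show "(u - binary_form (Suc n) \<beta> s t * v) * v' = lin l s t * v * u'" .
next
  assume "(u - binary_form (Suc n) \<beta> s t * v) * v' = lin l s t * v * u'"
  then show "(hpoint (Suc n) s t u v, hpoint n s t u' v') \<in> elementary2 n l \<beta>"
    unfolding elementary2_def using assms by blast
qed


lemma elementary1_imageE: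
  assumes "(hpoint n s t u v, y) \<in> elementary1 n l" "(s, t) \<noteq> (0, 0)"
  obtains u' v' where "(u', v') \<noteq> (0, 0)" "y = hpoint (Suc n) s t u' v'"
proof -
  from assms(1) obtain s1 t1 u1 v1 u' v' where
    1: "hpoint n s1 t1 u1 v1 = hpoint n s t u v" "y = hpoint (Suc n) s1 t1 u' v'"
       "(u', v') \<noteq> (0, 0)"
    unfolding elementary1_def by auto
  from 1(1) obtain k0 where a: "k0 \<noteq> 0" "s = k0 * s1" "t = k0 * t1"
    by (elim hpoint_eqD) blast
  have "y = hpoint (Suc n) s t u' (v' / k0 ^ Suc n)"
    using hpoint_scale[of k0 1 "Suc n" s1 t1 u' v'] a 1 by simp
  moreover have "(u', v' / k0 ^ Suc n) \<noteq> (0, 0)" using 1(3) a by auto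
  ultimately show ?thesis using that by blast
qed

lemma elementary1_preimageE:
  assumes "(x, hpoint (Suc n) s t u' v') \<in> elementary1 n l" "(s, t) \<noteq> (0, 0)"
  obtains u v where "(u, v) \<noteq> (0, 0)" "x = hpoint n s t u v"
proof -
  from assms(1) obtain s1 t1 u1 v1 u v where
    1: "hpoint (Suc n) s1 t1 u1 v1 = hpoint (Suc n) s t u' v'" "x = hpoint n s1 t1 u v"
       "(u, v) \<noteq> (0, 0)"
    unfolding elementary1_def by auto
  from 1(1) obtain k0 where a: "k0 \<noteq> 0" "s = k0 * s1" "t = k0 * t1"
    by (elim hpoint_eqD) blast
  have "x = hpoint n s t u (v / k0 ^ n)"
    using hpoint_scale[of k0 1 n s1 t1 u v] a 1 by simp
  moreover have "(u, v / k0 ^ n) \<noteq> (0, 0)" using 1(3) a by auto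
  ultimately show ?thesis using that by blast
qed

lemma lin_zero_iff:
  assumes "l \<noteq> (0, 0)" "(s, t) \<noteq> (0, 0)"
  shows "lin l s t = 0 \<longleftrightarrow> (\<exists>c. c \<noteq> 0 \<and> s = c * snd l \<and> t = c * (- fst l))"
proof
  assume 0: "lin l s t = 0"
  show "\<exists>c. c \<noteq> 0 \<and> s = c * snd l \<and> t = c * (- fst l)"
  proof (cases "snd l = 0")
    case True
    then have "fst l \<noteq> 0" using assms(1) by (auto simp: prod_eq_iff)
    then show ?thesis using 0 assms(2) True
      by (intro exI[of _ "- t / fst l"]) (auto simp: lin_def)
  next
    case False
    have "snd l * t = - (fst l * s)"
      using 0 by (simp add: lin_def eq_neg_iff_add_eq_0 add.commute)
    then have "t = - fst l * s / snd l"
      using False by (simp add: field_simps)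
    then show ?thesis using False assms(2)
      by (intro exI[of _ "s / snd l"]) auto
  qed
qed (auto simp: lin_def)

lemma hpoint_on_fibre:
  assumes "l \<noteq> (0, 0)" "x \<in> fibre n l"
  obtains u v where "(u, v) \<noteq> (0, 0)" "x = hpoint n (snd l) (- fst l) u v"
proof -
  from assms(2) obtain s t u v where x: "x = hpoint n s t u v" "(s, t) \<noteq> (0, 0)"
    "(u, v) \<noteq> (0, 0)" "lin l s t = 0" unfolding fibre_def by blast
  then obtain c where c: "c \<noteq> 0" "s = c * snd l" "t = c * (- fst l)"
    using lin_zero_iff[OF assms(1) x(2)] by blast
  have "x = hpoint n (snd l) (- fst l) u (v * c ^ n)"
    using hpoint_scale[of c 1 n "snd l" "- fst l" u "v * c ^ n"] x c by simp
  then show ?thesis using that[of u "v * c ^ n"] x(3) c by auto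
qed

lemma fibreI:
  assumes "l \<noteq> (0, 0)" "(u, v) \<noteq> (0, 0)"
  shows "hpoint n (snd l) (- fst l) u v \<in> fibre n l"
proof -
  have "(snd l, - fst l) \<noteq> (0, 0)" using assms(1) by (auto simp: prod_eq_iff)
  moreover have "lin l (snd l) (- fst l) = 0" by (simp add: lin_def)
  ultimately show ?thesis using assms(2) unfolding fibre_def by blast
qed

text \<open>The exceptional curve of the blow-up is the new fibre; the old fibre is contracted.\<close>

lemma elementary1_centre:
  assumes "l \<noteq> (0, 0)"
  shows "elementary1 n l `` {centre1 n l} = fibre (Suc n) l"
proof -
  have nz: "(snd l, - fst l) \<noteq> (0, 0)" using assms by (auto simp: prod_eq_iff)
  have z: "lin l (snd l) (- fst l) = 0" by (simp add: lin_def)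
  show ?thesis
  proof (intro equalityI subsetI)
    fix y assume "y \<in> elementary1 n l `` {centre1 n l}"
    then have "(hpoint n (snd l) (- fst l) 1 0, y) \<in> elementary1 n l" by (simp add: centre1_def)
    then show "y \<in> fibre (Suc n) l"
      using nz assms fibreI by (elim elementary1_imageE) auto
  next
    fix y assume "y \<in> fibre (Suc n) l"
    then obtain u v where y: "(u, v) \<noteq> (0, 0)" "y = hpoint (Suc n) (snd l) (- fst l) u v"
      using hpoint_on_fibre[OF assms] by blast
    then show "y \<in> elementary1 n l `` {centre1 n l}"
      using elementary1_iff[OF nz _ y(1), of 1 0 n l] z by (simp add: centre1_def)
  qed
qed

lemma elementary1_contracts:
  assumes "l \<noteq> (0, 0)"
  shows "(elementary1 n l)\<inverse> `` {hpoint (Suc n) (snd l) (- fst l) 0 1} = fibre n l"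
proof -
  have nz: "(snd l, - fst l) \<noteq> (0, 0)" using assms by (auto simp: prod_eq_iff)
  have z: "lin l (snd l) (- fst l) = 0" by (simp add: lin_def)
  show ?thesis
  proof (intro equalityI subsetI)
    fix y assume "y \<in> (elementary1 n l)\<inverse> `` {hpoint (Suc n) (snd l) (- fst l) 0 1}"
    then have "(y, hpoint (Suc n) (snd l) (- fst l) 0 1) \<in> elementary1 n l" by simp
    then show "y \<in> fibre n l"
      using nz assms fibreI by (elim elementary1_preimageE) auto
  next
    fix y assume "y \<in> fibre n l"
    then obtain u v where y: "(u, v) \<noteq> (0, 0)" "y = hpoint n (snd l) (- fst l) u v"
      using hpoint_on_fibre[OF assms] by blast
    then show "y \<in> (elementary1 n l)\<inverse> `` {hpoint (Suc n) (snd l) (- fst l) 0 1}"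
      using elementary1_iff[OF nz y(1), of 0 1 n l] z by simp
  qed
qed

lemma elementary2_imageE:
  assumes "(hpoint (Suc n) s t u v, y) \<in> elementary2 n l \<beta>" "(s, t) \<noteq> (0, 0)"
  obtains u' v' where "(u', v') \<noteq> (0, 0)" "y = hpoint n s t u' v'"
proof -
  from assms(1) obtain s1 t1 u1 v1 u' v' where
    1: "hpoint (Suc n) s1 t1 u1 v1 = hpoint (Suc n) s t u v" "y = hpoint n s1 t1 u' v'"
       "(u', v') \<noteq> (0, 0)"
    unfolding elementary2_def by auto
  from 1(1) obtain k0 where a: "k0 \<noteq> 0" "s = k0 * s1" "t = k0 * t1"
    by (elim hpoint_eqD) blast
  have "y = hpoint n s t u' (v' / k0 ^ n)"
    using hpoint_scale[of k0 1 n s1 t1 u' v'] a 1 by simp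
  moreover have "(u', v' / k0 ^ n) \<noteq> (0, 0)" using 1(3) a by auto
  ultimately show ?thesis using that by blast
qed

lemma elementary2_preimageE:
  assumes "(x, hpoint n s t u' v') \<in> elementary2 n l \<beta>" "(s, t) \<noteq> (0, 0)"
  obtains u v where "(u, v) \<noteq> (0, 0)" "x = hpoint (Suc n) s t u v"
proof -
  from assms(1) obtain s1 t1 u1 v1 u v where
    1: "hpoint n s1 t1 u1 v1 = hpoint n s t u' v'" "x = hpoint (Suc n) s1 t1 u v"
       "(u, v) \<noteq> (0, 0)"
    unfolding elementary2_def by auto
  from 1(1) obtain k0 where a: "k0 \<noteq> 0" "s = k0 * s1" "t = k0 * t1"
    by (elim hpoint_eqD) blast
  have "x = hpoint (Suc n) s t u (v / k0 ^ Suc n)"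
    using hpoint_scale[of k0 1 "Suc n" s1 t1 u v] a 1 by simp
  moreover have "(u, v / k0 ^ Suc n) \<noteq> (0, 0)" using 1(3) a by auto
  ultimately show ?thesis using that by blast
qed

lemma elementary2_centre:
  assumes "l \<noteq> (0, 0)"
  shows "elementary2 n l \<beta> `` {centre2 n l \<beta>} = fibre n l"
proof -
  have nz: "(snd l, - fst l) \<noteq> (0, 0)" using assms by (auto simp: prod_eq_iff)
  have z: "lin l (snd l) (- fst l) = 0" by (simp add: lin_def)
  show ?thesis
  proof (intro equalityI subsetI)
    fix y assume "y \<in> elementary2 n l \<beta> `` {centre2 n l \<beta>}"
    then have "(hpoint (Suc n) (snd l) (- fst l)
        (binary_form (Suc n) \<beta> (snd l) (- fst l)) 1, y) \<in> elementary2 n l \<beta>"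
      by (simp add: centre2_def)
    then show "y \<in> fibre n l"
      using nz assms fibreI by (elim elementary2_imageE) auto
  next
    fix y assume "y \<in> fibre n l"
    then obtain u v where y: "(u, v) \<noteq> (0, 0)" "y = hpoint n (snd l) (- fst l) u v"
      using hpoint_on_fibre[OF assms] by blast
    then show "y \<in> elementary2 n l \<beta> `` {centre2 n l \<beta>}"
      using elementary2_iff[OF nz _ y(1),
          of "binary_form (Suc n) \<beta> (snd l) (- fst l)" 1 n l \<beta>] z
      by (simp add: centre2_def)
  qed
qed

lemma elementary2_contracts:
  assumes "l \<noteq> (0, 0)"
  shows "(elementary2 n l \<beta>)\<inverse> `` {centre1 n l} = fibre (Suc n) l"
proof -
  have nz: "(snd l, - fst l) \<noteq> (0, 0)" using assms by (auto simp: prod_eq_iff)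
  have z: "lin l (snd l) (- fst l) = 0" by (simp add: lin_def)
  show ?thesis
  proof (intro equalityI subsetI)
    fix y assume "y \<in> (elementary2 n l \<beta>)\<inverse> `` {centre1 n l}"
    then have "(y, hpoint n (snd l) (- fst l) 1 0) \<in> elementary2 n l \<beta>"
      by (simp add: centre1_def)
    then show "y \<in> fibre (Suc n) l"
      using nz assms fibreI by (elim elementary2_preimageE) auto
  next
    fix y assume "y \<in> fibre (Suc n) l"
    then obtain u v where y: "(u, v) \<noteq> (0, 0)" "y = hpoint (Suc n) (snd l) (- fst l) u v"
      using hpoint_on_fibre[OF assms] by blast
    then show "y \<in> (elementary2 n l \<beta>)\<inverse> `` {centre1 n l}"
      using elementary2_iff[OF nz y(1), of 1 0 n l \<beta>] z by (simp add: centre1_def)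
  qed
qed

lemma centre1_on_exceptional_section:
  assumes "l \<noteq> (0, 0)"
  shows "centre1 n l \<in> exceptional_section n \<inter> fibre n l"
proof
  have "(snd l, - fst l) \<noteq> (0, 0)" using assms by (auto simp: prod_eq_iff)
  then show "centre1 n l \<in> exceptional_section n"
    unfolding centre1_def exceptional_section_def by blast
  show "centre1 n l \<in> fibre n l"
    using fibreI[OF assms, of 1 0 n] by (simp add: centre1_def)
qed

lemma centre2_off_exceptional_section:
  "centre2 n l \<beta> \<notin> exceptional_section (Suc n)"
proof
  assume "centre2 n l \<beta> \<in> exceptional_section (Suc n)"
  then obtain s t where "centre2 n l \<beta> = hpoint (Suc n) s t 1 0"
    unfolding exceptional_section_def by blast
  then show False unfolding centre2_def by (elim hpoint_eqD) simp
qed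

lemma proportional_pairs:
  fixes x y x' y' :: complex
  assumes "(x, y) \<noteq> (0, 0)" "(x', y') \<noteq> (0, 0)" "x' * y = x * y'"
  shows "\<exists>c. c \<noteq> 0 \<and> x' = c * x \<and> y' = c * y"
proof (cases "x = 0")
  case True
  then show ?thesis using assms by (intro exI[of _ "y' / y"]) auto
next
  case False
  then have "x' \<noteq> 0" using assms by auto
  then show ?thesis using assms False
    by (intro exI[of _ "x' / x"]) (auto simp: field_simps)
qed

text \<open>Away from the centre the transformation is a map.\<close>

lemma elementary1_single_valued:
  assumes "l \<noteq> (0, 0)" "x \<in> hirzebruch n" "x \<noteq> centre1 n l"
  shows "\<exists>!y. (x, y) \<in> elementary1 n l"
proof -
  from assms(2) obtain s t u v where x: "x = hpoint n s t u v" "(s, t) \<noteq> (0, 0)"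
    "(u, v) \<noteq> (0, 0)" unfolding hirzebruch_def by blast
  have nz: "(lin l s t * u, v) \<noteq> (0, 0)"
  proof
    assume "(lin l s t * u, v) = (0, 0)"
    then have z: "lin l s t = 0" "v = 0" "u \<noteq> 0" using x(3) by auto
    then obtain c where "c \<noteq> 0" "s = c * snd l" "t = c * (- fst l)"
      using lin_zero_iff[OF assms(1) x(2)] by blast
    then have "x = centre1 n l"
      using hpoint_scale[of c u n "snd l" "- fst l" 1 0] z x(1) by (simp add: centre1_def)
    then show False using assms(3) by simp
  qed
  show ?thesis
  proof (rule ex1I)
    show "(x, hpoint (Suc n) s t (lin l s t * u) v) \<in> elementary1 n l"
      unfolding x(1) elementary1_iff[OF x(2,3) nz] by simp
  next
    fix y assume y: "(x, y) \<in> elementary1 n l"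
    then obtain u' v' where y': "(u', v') \<noteq> (0, 0)" "y = hpoint (Suc n) s t u' v'"
      unfolding x(1) using x(2) by (elim elementary1_imageE) blast
    have "u' * v = lin l s t * u * v'"
      using y unfolding x(1) y'(2) elementary1_iff[OF x(2,3) y'(1)] .
    then obtain c where "c \<noteq> 0" "u' = c * (lin l s t * u)" "v' = c * v"
      using proportional_pairs[OF nz y'(1)] by blast
    then show "y = hpoint (Suc n) s t (lin l s t * u) v"
      using hpoint_scale[of 1 c "Suc n" s t "lin l s t * u" v] y'(2) by simp
  qed
qed

lemma elementary2_single_valued:
  assumes "l \<noteq> (0, 0)" "x \<in> hirzebruch (Suc n)" "x \<noteq> centre2 n l \<beta>"
  shows "\<exists>!y. (x, y) \<in> elementary2 n l \<beta>"
proof -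
  from assms(2) obtain s t u v where x: "x = hpoint (Suc n) s t u v" "(s, t) \<noteq> (0, 0)"
    "(u, v) \<noteq> (0, 0)" unfolding hirzebruch_def by blast
  define w where "w = u - binary_form (Suc n) \<beta> s t * v"
  have nz: "(w, lin l s t * v) \<noteq> (0, 0)"
  proof
    assume "(w, lin l s t * v) = (0, 0)"
    then have z: "lin l s t = 0" "u = binary_form (Suc n) \<beta> s t * v" "v \<noteq> 0"
      using x(3) by (auto simp: w_def)
    then obtain c where c: "c \<noteq> 0" "s = c * snd l" "t = c * (- fst l)"
      using lin_zero_iff[OF assms(1) x(2)] by blast
    have "u = v * c ^ Suc n * binary_form (Suc n) \<beta> (snd l) (- fst l)"
      unfolding z(2) c binary_form_scale by simp
    then have "x = centre2 n l \<beta>"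
      using hpoint_scale[of c "v * c ^ Suc n" "Suc n" "snd l" "- fst l"
          "binary_form (Suc n) \<beta> (snd l) (- fst l)" 1] z(3) c x(1)
      by (simp add: centre2_def)
    then show False using assms(3) by simp
  qed
  show ?thesis
  proof (rule ex1I)
    show "(x, hpoint n s t w (lin l s t * v)) \<in> elementary2 n l \<beta>"
      unfolding x(1) elementary2_iff[OF x(2,3) nz] by (simp add: w_def)
  next
    fix y assume y: "(x, y) \<in> elementary2 n l \<beta>"
    then obtain u' v' where y': "(u', v') \<noteq> (0, 0)" "y = hpoint n s t u' v'"
      unfolding x(1) using x(2) by (elim elementary2_imageE) blast
    have "w * v' = lin l s t * v * u'"
      using y unfolding x(1) y'(2) elementary2_iff[OF x(2,3) y'(1)] w_def .
    then have "u' * (lin l s t * v) = w * v'" by simp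
    then obtain c where "c \<noteq> 0" "u' = c * w" "v' = c * (lin l s t * v)"
      using proportional_pairs[OF nz y'(1)] by blast
    then show "y = hpoint n s t w (lin l s t * v)"
      using hpoint_scale[of 1 c n s t w "lin l s t * v"] y'(2) by simp
  qed
qed

end

theory Submission
  imports Defs
begin

text \<open>
  Choose coordinates X, Y, Z with O = (0, 0, 1) in which P is the line X = 0.  Composing the
  elementary transformations, T becomes the de Jonquieres map
  (X, Y, Z) \<mapsto> (X^(N+1), X^N Y, L (X, Y) Z - B (X, Y)) with N = n1 + ... + nk, L the product of the
  n_i-th powers of the forms of the Q_i, and B an arbitrary form of degree N + 1.  Hence the proper
  transform of F is G = F (L X, L Y, X^N Z + B): the leading coefficient in Z is a power of X,
  X does not divide G because the first centre lies off the curve, and over a general (X : Y) there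
  are d distinct roots, so pseudo-division in Z shows that G generates the ideal.

  Near the line Q_i, where L vanishes to order n_i, transversality and Hensel's lemma split F
  into c \<Prod> (Z - \<rho>_j) over the power series, and G becomes c \<Prod> (Z + B - L \<rho>_j) for X = 1,
  which is a tacnode of order n_i - 1.  At (0, 0, 1) the multiplicity is d N, the tangent cone is
  X^(d N), and the blow-up there is c \<Prod> (x^N + y (B - L \<rho>_j)), a tacnode of order N - 1.
  G has no further points on the lines, and off them T is biholomorphic.
\<close>

text \<open>Everything is drawn from one consequence of transversality: a line of the pencil through
  O meets F in points at which the derivative in the direction of O is nonzero. Since O is off the
  curve, F restricted along that direction has degree d in Z with a constant leading coefficient, so
  there are d such points and they account for the whole polynomial. Lifting these roots formally
  gives the branches. The lifted series carry no convergence, so the d distinct roots over a general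
  (X : Y) come separately, from continuity of the roots near one transversal line.

  The value of B at the point (0 : 1) of the pencil, that is on P, is fixed by the first centre of
  the second type: every later form enters multiplied by the form of P. That this centre is off the
  curve means that F does not vanish at (0, L(0, 1), B(0, 1)). Besides keeping X from dividing G,
  this makes the coefficients B - L \<rho>_j of y in the blow-up at (0, 0, 1) units, so that its
  factors are graphs over x.\<close>

no_notation fps_nth (infixl "$" 75)

subsection \<open>Polynomial functions and forms\<close>

abbreviation eval2 :: "complex poly poly \<Rightarrow> complex \<Rightarrow> complex \<Rightarrow> complex" where
  "eval2 f x y \<equiv> poly (poly f [:y:]) x"

abbreviation eval3 :: "complex poly poly poly \<Rightarrow> complex \<Rightarrow> complex \<Rightarrow> complex \<Rightarrow> complex" where
  "eval3 F x y z \<equiv> eval2 (poly F [:[:z:]:]) x y"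

lemma ev2_0 [simp]: "ev2 h 0 x y = 0"
  by (simp add: ev2_def)

lemma ev2_pCons:
  assumes "h 0 = 0"
  shows "ev2 h (pCons p f) x y = poly (map_poly h p) x + y * ev2 h f x y"
  using assms by (simp add: ev2_def map_poly_pCons)

lemma ev3_0 [simp]: "ev3 h 0 x y z = 0"
  by (simp add: ev3_def)

lemma ev3_pCons:
  assumes "h 0 = 0"
  shows "ev3 h (pCons f F) x y z = ev2 h f x y + z * ev3 h F x y z"
  using assms by (simp add: ev3_def map_poly_pCons)

lemma ev2_eq_eval2: "ev2 (\<lambda>c. c) f x y = eval2 f x y"
  by (induction f) (simp_all add: ev2_pCons)

lemma form_at_eq_eval3: "form_at F v = eval3 F (v $ 1) (v $ 2) (v $ 3)"
  unfolding form_at_def by (induction F) (simp_all add: ev3_pCons ev2_eq_eval2)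

lemma eval2_ev2:
  "eval2 (ev2 (\<lambda>c. [:[:c:]:]) f A B) x y = eval2 f (eval2 A x y) (eval2 B x y)"
proof (induction f)
  case (pCons p f)
  have "eval2 (poly (map_poly (\<lambda>c. [:[:c:]:]) p) A) x y = poly p (eval2 A x y)"
    by (induction p) (simp_all add: map_poly_pCons)
  then show ?case using pCons by (simp add: ev2_pCons)
qed simp

lemma eval2_ev3:
  "eval2 (ev3 (\<lambda>c. [:[:c:]:]) F A B C) x y = eval3 F (eval2 A x y) (eval2 B x y) (eval2 C x y)"
  by (induction F) (simp_all add: ev3_pCons eval2_ev2)

text \<open>Substituting x for itself leaves the coefficients alone, so the two-variable
  substitution is a univariate composition in y.\<close>

lemma ev2_X_eq_pcompose: "ev2 (\<lambda>a. [:[:a:]:]) f [:[:0, 1:]:] Y = pcompose f Y"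
proof (induction f)
  case (pCons p f)
  have "poly (map_poly (\<lambda>c. [:[:c:]:]) p) [:[:0, 1:]:] = [:p:]"
    by (induction p) (simp_all add: map_poly_pCons)
  then show ?case using pCons by (simp add: ev2_pCons pcompose_pCons)
qed simp

lemma poly_eq_on_infinite:
  fixes p q :: "'a::idom poly"
  assumes "infinite A" "\<And>x. x \<in> A \<Longrightarrow> poly p x = poly q x"
  shows "p = q"
proof (rule ccontr)
  assume "p \<noteq> q"
  then have "finite {x. poly (p - q) x = 0}" by (intro poly_roots_finite) simp
  moreover have "A \<subseteq> {x. poly (p - q) x = 0}" using assms(2) by auto
  ultimately show False using assms(1) finite_subset by blast
qed

lemma infinite_consts: "infinite (range (\<lambda>y::complex. [:y:]))" "infinite (range (\<lambda>y::complex. [:[:y:]:]))"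
  by (subst finite_image_iff; auto simp: inj_on_def infinite_UNIV_char_0)+

text \<open>The constants \<open>[:y:]\<close> are infinitely many arguments of the outer
  polynomial, which leaves univariate identities in x. Restricting x to A permits exceptional values
  such as x = 0.\<close>

lemma eval2_eqI:
  assumes "infinite A" "\<And>x y. x \<in> A \<Longrightarrow> eval2 f x y = eval2 g x y"
  shows "f = g"
proof (rule poly_eq_on_infinite[OF infinite_consts(1)])
  fix c :: "complex poly" assume "c \<in> range (\<lambda>y. [:y:])"
  then show "poly f c = poly g c"
    using assms by (auto intro: poly_eq_on_infinite[of A])
qed

lemma eval3_eqI:
  assumes "infinite A" "\<And>x y z. x \<in> A \<Longrightarrow> eval3 F x y z = eval3 G x y z"
  shows "F = G"
proof (rule poly_eq_on_infinite[OF infinite_consts(2)])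
  fix c :: "complex poly poly" assume "c \<in> range (\<lambda>y. [:[:y:]:])"
  then show "poly F c = poly G c"
    using assms by (auto intro: eval2_eqI[of A])
qed

text \<open>Working with polynomial functions and their closure properties yields the equation of a
  pull-back, or of a curve in other coordinates, without computing its coefficients.\<close>

definition polynomial3 :: "(complex ^ 3 \<Rightarrow> complex) \<Rightarrow> bool" where
  "polynomial3 f \<longleftrightarrow> (\<exists>F. \<forall>v. f v = form_at F v)"

lemma polynomial3_const: "polynomial3 (\<lambda>v. c)"
  unfolding polynomial3_def form_at_eq_eval3 by (rule exI[of _ "[:[:[:c:]:]:]"]) simp

lemma polynomial3_coord: "polynomial3 (\<lambda>v. v $ i)"
proof -
  have "i = 1 \<or> i = 2 \<or> i = 3" by (rule exhaust_3)
  then show ?thesis unfolding polynomial3_def form_at_eq_eval3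
    by (elim disjE; simp) (rule exI[of _ "[:[:[:0, 1:]:]:]"] exI[of _ "[:[:0, [:1:]:]:]"] exI[of _ "[:0, [:[:1:]:]:]"], simp; fail)+
qed

lemma polynomial3_add: "polynomial3 f \<Longrightarrow> polynomial3 g \<Longrightarrow> polynomial3 (\<lambda>v. f v + g v)"
  unfolding polynomial3_def form_at_eq_eval3
  by (elim exE, rule_tac x = "F + Fa" in exI) simp

lemma polynomial3_mult: "polynomial3 f \<Longrightarrow> polynomial3 g \<Longrightarrow> polynomial3 (\<lambda>v. f v * g v)"
  unfolding polynomial3_def form_at_eq_eval3
  by (elim exE, rule_tac x = "F * Fa" in exI) simp

lemma polynomial3_power: "polynomial3 f \<Longrightarrow> polynomial3 (\<lambda>v. f v ^ n)"
  by (induction n) (simp_all add: polynomial3_const polynomial3_mult)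

lemma polynomial3_poly: "polynomial3 f \<Longrightarrow> polynomial3 (\<lambda>v. poly p (f v))"
  by (induction p) (simp_all add: polynomial3_const polynomial3_mult polynomial3_add)

lemma polynomial3_eval2:
  "polynomial3 f \<Longrightarrow> polynomial3 g \<Longrightarrow> polynomial3 (\<lambda>v. eval2 q (f v) (g v))"
  by (induction q) (simp_all add: polynomial3_const polynomial3_mult polynomial3_add polynomial3_poly)

lemma polynomial3_eval3:
  "polynomial3 f \<Longrightarrow> polynomial3 g \<Longrightarrow> polynomial3 h \<Longrightarrow> polynomial3 (\<lambda>v. eval3 F (f v) (g v) (h v))"
  by (induction F) (simp_all add: polynomial3_const polynomial3_mult polynomial3_add polynomial3_eval2)

lemma polynomial3_pairing: "polynomial3 (\<lambda>v. pairing e v)"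
  unfolding pairing_def sum_3
  by (intro polynomial3_add polynomial3_mult polynomial3_const polynomial3_coord)

lemma poly_sum_bound:
  fixes p :: "'a::comm_ring_1 poly"
  assumes "degree p \<le> n" shows "poly p x = (\<Sum>i\<le>n. coeff p i * x ^ i)"
  unfolding poly_altdef
  by (rule sum.mono_neutral_left) (use assms in \<open>auto simp: coeff_eq_0\<close>)

text \<open>One bound serves all three exponents, so that evaluation becomes a triple sum over a
  cube whose range does not depend on the inner indices.\<close>

definition deg_bound :: "complex poly poly poly \<Rightarrow> nat \<Rightarrow> bool" where
  "deg_bound F n \<longleftrightarrow> (\<forall>i j k. coeff (coeff (coeff F k) j) i \<noteq> 0 \<longrightarrow> i \<le> n \<and> j \<le> n \<and> k \<le> n)"

lemma ex_deg_bound: "\<exists>n. deg_bound F n"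
proof -
  define m where "m = Max (insert 0 ((\<lambda>k. degree (coeff F k)) ` {..degree F}))"
  define l where "l = Max (insert 0 ((\<lambda>(k, j). degree (coeff (coeff F k) j)) ` ({..degree F} \<times> {..m})))"
  have k: "k \<le> degree F" if "coeff (coeff (coeff F k) j) i \<noteq> 0" for i j k
    using that by (metis coeff_0 le_degree)
  have j: "j \<le> m" if "coeff (coeff (coeff F k) j) i \<noteq> 0" for i j k
  proof -
    have "j \<le> degree (coeff F k)" using that by (metis coeff_0 le_degree)
    also have "\<dots> \<le> m" unfolding m_def using k[OF that] by (intro Max_ge) auto
    finally show ?thesis .
  qed
  have i: "i \<le> l" if "coeff (coeff (coeff F k) j) i \<noteq> 0" for i j k
  proof -
    have "i \<le> degree (coeff (coeff F k) j)" using that by (metis le_degree)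
    also have "\<dots> \<le> l" unfolding l_def using k[OF that] j[OF that] by (intro Max_ge) force+
    finally show ?thesis .
  qed
  show ?thesis unfolding deg_bound_def using i j k
    by (intro exI[of _ "max (degree F) (max m l)"]) (auto simp: le_max_iff_disj)
qed

lemma eval3_sum:
  assumes "deg_bound F n"
  shows "eval3 F x y z = (\<Sum>k\<le>n. (\<Sum>j\<le>n. (\<Sum>i\<le>n. coeff (coeff (coeff F k) j) i * x ^ i) * y ^ j) * z ^ k)"
proof -
  have i: "degree (coeff (coeff F k) j) \<le> n" for k j
    using assms unfolding deg_bound_def by (intro degree_le) (metis not_le)
  have j: "degree (coeff F k) \<le> n" for k
    using assms unfolding deg_bound_def by (intro degree_le allI impI poly_eqI) (metis coeff_0 not_le)
  have k: "degree F \<le> n"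
    using assms unfolding deg_bound_def by (intro degree_le allI impI poly_eqI) (metis coeff_0 not_le)
  show ?thesis
    by (simp add: poly_sum_bound[OF k] poly_sum_bound[OF j] poly_sum_bound[OF i] poly_sum poly_power)
qed

lemma form_at_scale:
  assumes "plane_curve d F"
  shows "form_at F (c *s v) = c ^ d * form_at F v"
proof -
  obtain n where n: "deg_bound F n" using ex_deg_bound by blast
  have *: "coeff (coeff (coeff F k) j) i * (c * x) ^ i * (c * y) ^ j * (c * z) ^ k
      = c ^ d * (coeff (coeff (coeff F k) j) i * x ^ i * y ^ j * z ^ k)" for i j k x y z
  proof (cases "coeff (coeff (coeff F k) j) i = 0")
    case False
    then have "d = i + j + k" using assms unfolding plane_curve_def by metis
    then show ?thesis by (simp add: power_add power_mult_distrib)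
  qed simp
  then show ?thesis unfolding form_at_eq_eval3 eval3_sum[OF n] vector_smult_component
    by (auto intro!: sum.cong simp only: sum_distrib_left sum_distrib_right * mult.assoc)
qed

lemma triple_sum_eq_0:
  fixes a :: "nat \<Rightarrow> nat \<Rightarrow> nat \<Rightarrow> complex"
  assumes "\<And>x y z. (\<Sum>k\<le>n. (\<Sum>j\<le>n. (\<Sum>i\<le>n. a k j i * x ^ i) * y ^ j) * z ^ k) = 0"
    and "i \<le> n" "j \<le> n" "k \<le> n"
  shows "a k j i = 0"
proof -
  have "(\<Sum>j\<le>n. (\<Sum>i\<le>n. a k j i * x ^ i) * y ^ j) = 0" for x y
    using assms(1)[of x y] polyfun_eq_0[of "\<lambda>k. \<Sum>j\<le>n. (\<Sum>i\<le>n. a k j i * x ^ i) * y ^ j" n] assms(4) by simp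
  then have "(\<Sum>i\<le>n. a k j i * x ^ i) = 0" for x
    using polyfun_eq_0[of "\<lambda>j. \<Sum>i\<le>n. a k j i * x ^ i" n] assms(3) by simp
  then show ?thesis using polyfun_eq_0[of "a k j" n] assms(2) by simp
qed

text \<open>The single scalar 2 suffices: every coefficient times 2^(i + j + k) - 2^d must vanish,
  and distinct powers of 2 differ.\<close>

lemma plane_curveI:
  assumes "F \<noteq> 0" "\<And>v. form_at F (2 *s v) = 2 ^ d * form_at F v"
  shows "plane_curve d F"
  unfolding plane_curve_def
proof (intro conjI allI impI assms(1))
  fix i j k assume nz: "coeff (coeff (coeff F k) j) i \<noteq> 0"
  obtain n where n: "deg_bound F n" using ex_deg_bound by blast
  define a where "a k j i = coeff (coeff (coeff F k) j) i * (2 ^ (i + j + k) - 2 ^ d)" for k j i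
  have "(\<Sum>k\<le>n. (\<Sum>j\<le>n. (\<Sum>i\<le>n. a k j i * x ^ i) * y ^ j) * z ^ k)
      = form_at F (2 *s vector [x, y, z]) - 2 ^ d * form_at F (vector [x, y, z])" for x y z
    unfolding form_at_eq_eval3 eval3_sum[OF n] vector_smult_component vector_3 a_def
    by (simp add: sum_distrib_left sum_distrib_right power_mult_distrib power_add
        algebra_simps flip: sum_subtractf)
  then have "a k j i = 0"
    using n nz unfolding deg_bound_def assms(2) by (intro triple_sum_eq_0[where n = n and a = a]) auto
  then have "(2::complex) ^ (i + j + k) = 2 ^ d" using nz by (simp add: a_def)
  then have "of_nat (2 ^ (i + j + k)) = (of_nat (2 ^ d) :: complex)" by simp
  then show "i + j + k = d" unfolding of_nat_eq_iff by simp
qed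

lemma eval3_has_field_derivative:
  assumes "(f has_field_derivative f') (at t)" "(g has_field_derivative g') (at t)"
    "(h has_field_derivative h') (at t)"
  shows "((\<lambda>t. eval3 F (f t) (g t) (h t)) has_field_derivative
     eval3 (map_poly (map_poly pderiv) F) (f t) (g t) (h t) * f' +
     eval3 (map_poly pderiv F) (f t) (g t) (h t) * g' +
     eval3 (pderiv F) (f t) (g t) (h t) * h') (at t)"
proof -
  have 1: "((\<lambda>t. poly p (f t)) has_field_derivative poly (pderiv p) (f t) * f') (at t)" for p
    using DERIV_chain2[OF poly_DERIV assms(1)] .
  have 2: "((\<lambda>t. eval2 q (f t) (g t)) has_field_derivative
     eval2 (map_poly pderiv q) (f t) (g t) * f' + eval2 (pderiv q) (f t) (g t) * g') (at t)" for q
  proof (induction q)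
    case (pCons p q)
    show ?case
      by (auto intro!: derivative_eq_intros pCons 1 assms simp: map_poly_pCons pderiv_pCons algebra_simps)
  qed simp
  show ?thesis
  proof (induction F)
    case (pCons p F)
    show ?case
      by (auto intro!: derivative_eq_intros pCons 2 assms simp: map_poly_pCons pderiv_pCons algebra_simps)
  qed simp
qed

lemma form_at_has_field_derivative:
  fixes v :: "complex \<Rightarrow> complex ^ 3" and w :: "complex ^ 3"
  assumes "\<And>i. ((\<lambda>t. v t $ i) has_field_derivative w $ i) (at t)"
  shows "((\<lambda>t. form_at F (v t)) has_field_derivative pairing (gradient F (v t)) w) (at t)"
  using eval3_has_field_derivative[OF assms[of 1] assms[of 2] assms[of 3], of F]
  unfolding pairing_def sum_3 gradient_def form_at_eq_eval3 vector_3 .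

subsection \<open>Germs that are unions of graphs\<close>

lemma mult_at_0_eqI:
  assumes "\<And>i j. i + j < m \<Longrightarrow> coeff (coeff f j) i = 0" "coeff (coeff f j0) i0 \<noteq> 0" "i0 + j0 = m"
  shows "mult_at_0 f = m"
  unfolding mult_at_0_def
proof (rule Least_equality)
  show "\<exists>i j. i + j = m \<and> coeff (coeff f j) i \<noteq> 0" using assms by blast
next
  fix n assume "\<exists>i j. i + j = n \<and> coeff (coeff f j) i \<noteq> 0"
  then show "m \<le> n" using assms(1) by (metis not_le)
qed

lemma mult_at_0_le: "coeff (coeff f j) i \<noteq> 0 \<Longrightarrow> mult_at_0 f \<le> i + j"
  unfolding mult_at_0_def by (rule Least_le) blast

lemma coeff_below_mult: "i + j < mult_at_0 f \<Longrightarrow> coeff (coeff f j) i = 0"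
  using mult_at_0_le not_le by blast

text \<open>Dividing f(x, x y) by x^m, with m the multiplicity, gives one polynomial g. As f(x, x (y
  + c)) arises from f(x, x y) by y -> y + c, which leaves x^m fixed, the germs in all directions
  \<open>Some c\<close> are translates of this g.\<close>

lemma proper_germ_Some:
  obtains g where "\<And>i j. coeff (coeff g j) i =
       (if j \<le> i + mult_at_0 f then coeff (coeff f j) (i + mult_at_0 f - j) else 0)"
    "\<And>c. proper_germ f (Some c) = pcompose g [:[:c:], 1:]"
    "\<And>c. pcompose f [:[:0, c:], [:0, 1:]:] = [:[:0, 1:]:] ^ mult_at_0 f * proper_germ f (Some c)"
proof -
  let ?m = "mult_at_0 f"
  define f1 where "f1 = pcompose f [:0, [:0, 1:]:]"
  define g where "g = map_poly (poly_shift ?m) f1"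
  have f1: "coeff f1 j = monom 1 j * coeff f j" for j
    unfolding f1_def coeff_pcompose_linear by (simp add: monom_altdef)
  have c1: "coeff (coeff f1 j) i = (if j \<le> i then coeff (coeff f j) (i - j) else 0)" for i j
    unfolding f1 by (simp add: coeff_monom_mult)
  have g: "coeff (coeff g j) i = (if j \<le> i + ?m then coeff (coeff f j) (i + ?m - j) else 0)" for i j
    unfolding g_def by (simp add: coeff_map_poly coeff_poly_shift c1)
  have X: "[:[:0, 1:]:] ^ n = [:monom (1::complex) n:]" for n
    by (induction n) (simp_all add: monom_Suc one_pCons)
  have "f1 = [:monom 1 ?m:] * g"
  proof (intro poly_eqI)
    fix i j
    \<comment> \<open>A term x^i y^j of f(x, x y) comes from a term of f of total degree i, so none
      occurs with i below the multiplicity.\<close>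
    show "coeff (coeff f1 j) i = coeff (coeff ([:monom 1 ?m:] * g) j) i"
      using coeff_below_mult[of "i - j" j f] by (auto simp: c1 g coeff_monom_mult)
  qed
  note f1_eq = this
  then have *: "pcompose f [:[:0, c:], [:0, 1:]:] = [:[:0, 1:]:] ^ ?m * pcompose g [:[:c:], 1:]" for c
  proof -
    have "pcompose f [:[:0, c:], [:0, 1:]:] = pcompose f1 [:[:c:], 1:]"
      unfolding f1_def pcompose_assoc[symmetric] by (simp add: pcompose_pCons)
    also have "\<dots> = [:[:0, 1:]:] ^ ?m * pcompose g [:[:c:], 1:]"
      unfolding f1_eq X pcompose_mult by simp
    finally show ?thesis .
  qed
  have pg: "proper_germ f (Some c) = pcompose g [:[:c:], 1:]" for c
    using *[of c]
    using nonzero_mult_div_cancel_left[of "[:[:0, 1:]:] ^ ?m" "pcompose g [:[:c:], 1:]"]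
    by (simp add: ev2_X_eq_pcompose)
  show ?thesis by (rule that[OF g pg]) (simp only: * pg)
qed

lemma exceptional_power_times_proper_germ:
  "[:[:0, 1:]:] ^ mult_at_0 f * proper_germ f (Some c) = pcompose f [:[:0, c:], [:0, 1:]:]"
  by (rule proper_germ_Some[of f]) simp

text \<open>The assumption makes the degree-m part of f a multiple of x^m, so the proper transform
  is constant along the exceptional line in the charts \<open>Some c\<close>. If that constant is
  nonzero, only the direction \<open>None\<close> can lie on the curve.\<close>

lemma coeff_proper_germ_Some_0:
  assumes "\<And>j. 0 < j \<Longrightarrow> j \<le> mult_at_0 f \<Longrightarrow> coeff (coeff f j) (mult_at_0 f - j) = 0"
  shows "coeff (coeff (proper_germ f (Some c)) 0) 0 = coeff (coeff f 0) (mult_at_0 f)"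
proof -
  obtain g where g: "\<And>i j. coeff (coeff g j) i =
       (if j \<le> i + mult_at_0 f then coeff (coeff f j) (i + mult_at_0 f - j) else 0)"
    "\<And>c. proper_germ f (Some c) = pcompose g [:[:c:], 1:]" by (rule proper_germ_Some[of f]) (rule that)
  obtain p q where pq: "g = pCons p q" by (cases g)
  have q: "coeff (coeff q j) 0 = 0" for j
    using g(1)[of "Suc j" 0] assms[of "Suc j"] by (simp add: pq split: if_splits)
  have "coeff (coeff (proper_germ f (Some c)) 0) 0 = poly (poly g [:c:]) 0"
    unfolding g(2) by (simp add: poly_0_coeff_0[symmetric] poly_pcompose del: poly_0_coeff_0)
  also have "poly (poly q [:c:]) 0 = 0"
    using q
  proof (induction q)
    case (pCons a q)
    have "coeff a 0 = 0" "coeff (coeff q j) 0 = 0" for j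
      using pCons.prems[of 0] pCons.prems[of "Suc j"] by simp_all
    then show ?case using pCons.IH by (simp add: poly_0_coeff_0)
  qed simp
  then have "poly (poly g [:c:]) 0 = coeff (coeff g 0) 0" by (simp add: pq poly_0_coeff_0)
  finally show ?thesis using g(1)[of 0 0] by simp
qed

text \<open>The substitution only relabels exponents: x^i y^j goes to x^i y^(i + j). It can thus be
  read backwards, recovering f from its blow-up.\<close>

lemma coeff_blow_up_None:
  "coeff (coeff (ev2 (\<lambda>a. [:[:a:]:]) f [:0, [:0, 1:]:] [:0, 1:]) k) i
     = (if i \<le> k then coeff (coeff f (k - i)) i else 0)"
proof (induction f arbitrary: k)
  case (pCons p f)
  have 1: "coeff (coeff (poly (map_poly (\<lambda>c. [:[:c:]:]) p) [:0, [:0, 1:]:]) k) i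
      = (if i = k then coeff p k else 0)" for k i
  proof (induction p arbitrary: k i)
    case (pCons a p)
    show ?case
      by (cases k; cases i) (simp_all add: map_poly_pCons pCons)
  qed simp
  show ?case
    using pCons.IH[of "k - 1"]
    by (cases k) (auto simp: ev2_pCons 1 coeff_pCons Suc_diff_le le_Suc_eq split: nat.splits)
qed simp

lemma proper_germ_None:
  assumes "ev2 (\<lambda>a. [:[:a:]:]) f [:0, [:0, 1:]:] [:0, 1:] = [:0, 1:] ^ mult_at_0 f * g"
  shows "proper_germ f None = g"
  using assms by simp

lemma coeff_proper_germ_None_0:
  "coeff (coeff (proper_germ f None) 0) 0 = coeff (coeff f (mult_at_0 f)) 0"
proof -
  let ?e = "ev2 (\<lambda>a. [:[:a:]:]) f [:0, [:0, 1:]:] [:0, 1:]"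
  have "?e = [:0, 1:] ^ mult_at_0 f * poly_shift (mult_at_0 f) ?e"
    using coeff_below_mult[of _ _ f]
    by (intro poly_eqI) (auto simp: coeff_blow_up_None coeff_monom_mult coeff_poly_shift monom_altdef[symmetric, of 1, simplified])
  then have "proper_germ f None = poly_shift (mult_at_0 f) ?e" by (rule proper_germ_None)
  then show ?thesis by (simp add: coeff_poly_shift coeff_blow_up_None)
qed

lemma not_singular_if_unit: "coeff (coeff f 0) 0 \<noteq> 0 \<Longrightarrow> \<not> singular_at_0 f"
  using mult_at_0_le[of f 0 0] by (simp add: singular_at_0_def)

lemma not_singular_if_linear: "coeff (coeff f 1) 0 \<noteq> 0 \<Longrightarrow> \<not> singular_at_0 f"
  using mult_at_0_le[of f 1 0] by (simp add: singular_at_0_def)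

section \<open>Germs that split into graphs over the power series in x\<close>

abbreviation fpsp :: "complex poly poly \<Rightarrow> complex fps poly" where
  "fpsp \<equiv> map_poly fps_of_poly"

lemma fpsp_pCons [simp]: "fpsp (pCons p f) = pCons (fps_of_poly p) (fpsp f)"
  by (simp add: map_poly_pCons)

lemma fpsp_add: "fpsp (f + g) = fpsp f + fpsp g"
  by (intro poly_eqI) (simp add: coeff_map_poly fps_of_poly_add)

lemma fpsp_smult: "fpsp (smult p f) = smult (fps_of_poly p) (fpsp f)"
  by (intro poly_eqI) (simp add: coeff_map_poly fps_of_poly_mult)

lemma fpsp_mult: "fpsp (f * g) = fpsp f * fpsp g"
  by (induction f) (simp_all add: fpsp_add fpsp_smult)

lemma fpsp_power: "fpsp (f ^ n) = fpsp f ^ n"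
  by (induction n) (simp_all add: fpsp_mult)

lemma fpsp_pcompose: "fpsp (pcompose f g) = pcompose (fpsp f) (fpsp g)"
  by (induction f) (simp_all add: pcompose_pCons fpsp_add fpsp_mult)

text \<open>Unlike the unit in \<open>tacnode\<close>, u does not involve y: f has degree exactly d
  in y. Then u is the coefficient of y^d, and a blow-up along a common slope changes only the
  branches.\<close>

definition graph_germ :: "nat \<Rightarrow> complex fps \<Rightarrow> (nat \<Rightarrow> complex fps) \<Rightarrow> complex poly poly \<Rightarrow> bool" where
  "graph_germ d u \<phi> f \<longleftrightarrow> fps_nth u 0 \<noteq> 0 \<and> fpsp f = [:u:] * (\<Prod>j<d. [:- \<phi> j, 1:])"

lemma coeff_monic_linear_prod:
  fixes \<phi> :: "nat \<Rightarrow> 'a::idom"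
  shows "degree (\<Prod>j<d. [:- \<phi> j, 1:]) = d" "coeff (\<Prod>j<d. [:- \<phi> j, 1:]) d = 1"
proof -
  show 1: "degree (\<Prod>j<d. [:- \<phi> j, 1:]) = d" by (subst degree_prod_sum_eq) simp_all
  have "lead_coeff (\<Prod>j<d. [:- \<phi> j, 1:]) = 1" by (simp add: lead_coeff_prod)
  then show "coeff (\<Prod>j<d. [:- \<phi> j, 1:]) d = 1" using 1 by simp
qed

text \<open>A branch through the origin is x times its shift, so y - \<phi> becomes x (y + c -
  \<phi> / x); the d factors x form the exceptional part.\<close>

lemma graph_germ_pcompose:
  assumes "graph_germ d u \<phi> f" "\<forall>j<d. fps_nth (\<phi> j) 0 = 0"
  shows "fpsp (pcompose f [:[:0, c:], [:0, 1:]:])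
    = [:fps_X:] ^ d * ([:u:] * (\<Prod>j<d. [:- (fps_shift 1 (\<phi> j) - fps_const c), 1:]))"
proof -
  have "fpsp (pcompose f [:[:0, c:], [:0, 1:]:])
     = [:u:] * (\<Prod>j<d. [: fps_const c * fps_X - \<phi> j, fps_X:])"
    using assms(1) unfolding graph_germ_def fpsp_pcompose
    by (simp add: pcompose_mult pcompose_prod pcompose_pCons fps_of_poly_pCons pcompose_smult)
  also have "(\<Prod>j<d. [: fps_const c * fps_X - \<phi> j, fps_X:])
     = (\<Prod>j<d. [:fps_X:] * [:- (fps_shift 1 (\<phi> j) - fps_const c), 1:])"
  proof (intro prod.cong refl)
    fix j assume "j \<in> {..<d}"
    then have "\<phi> j = fps_X * fps_shift 1 (\<phi> j)"
      using assms(2) by (intro fps_ext) (auto simp: fps_X_mult_nth)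
    then show "[: fps_const c * fps_X - \<phi> j, fps_X:] = [:fps_X:] * [:- (fps_shift 1 (\<phi> j) - fps_const c), 1:]"
      by (simp add: algebra_simps)
  qed
  finally show ?thesis unfolding prod.distrib prod_constant card_lessThan by (simp only: mult_ac)
qed

lemma graph_germ_mult:
  assumes "graph_germ d u \<phi> f" "\<forall>j<d. fps_nth (\<phi> j) 0 = 0"
  shows "mult_at_0 f = d" "f \<noteq> 0" "coeff (coeff f d) 0 \<noteq> 0"
proof -
  have "fps_of_poly (coeff f d) = u"
    using arg_cong[of _ _ "\<lambda>p. coeff p d", OF conjunct2[OF assms(1)[unfolded graph_germ_def]]]
    by (simp add: coeff_map_poly coeff_monic_linear_prod)
  then show 1: "coeff (coeff f d) 0 \<noteq> 0"
    using assms(1) unfolding graph_germ_def by (metis fps_of_poly_nth)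
  then show "f \<noteq> 0" by auto
  have X: "[:fps_X:] ^ n = [:fps_X ^ n :: complex fps:]" for n
    by (induction n) (simp_all add: one_pCons)
  show "mult_at_0 f = d"
  proof (rule mult_at_0_eqI[OF _ 1])
    fix i j assume ij: "i + j < d"
    \<comment> \<open>With c = 0, x^d divides f(x, x y), where the coefficient of x^(i + j) y^j is
      that of x^i y^j in f.\<close>
    have "fps_nth (fps_of_poly (coeff (pcompose f [:0, [:0, 1:]:]) j)) (i + j) = 0"
      using arg_cong[of _ _ "\<lambda>p. coeff p j", OF graph_germ_pcompose[OF assms, of 0]] ij
      by (simp add: coeff_map_poly X mult.assoc fps_X_power_mult_nth mult.left_commute[of u])
    then show "coeff (coeff f j) i = 0"
      unfolding coeff_pcompose_linear by (simp add: monom_altdef[symmetric, of 1, simplified] coeff_monom_mult)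
  qed simp
qed

lemma graph_germ_blow_up:
  assumes "graph_germ d u \<phi> f" "\<forall>j<d. fps_nth (\<phi> j) 0 = 0"
  shows "graph_germ d u (\<lambda>j. fps_shift 1 (\<phi> j) - fps_const c) (proper_germ f (Some c))"
proof -
  have "[:fps_X:] ^ d * fpsp (proper_germ f (Some c)) = fpsp (pcompose f [:[:0, c:], [:0, 1:]:])"
    unfolding exceptional_power_times_proper_germ[symmetric] graph_germ_mult(1)[OF assms] fpsp_mult fpsp_power
    by simp
  then have "[:fps_X:] ^ d * fpsp (proper_germ f (Some c)) =
     [:fps_X:] ^ d * ([:u:] * (\<Prod>j<d. [:- (fps_shift 1 (\<phi> j) - fps_const c), 1:]))"
    using graph_germ_pcompose[OF assms] by simp
  then have "fpsp (proper_germ f (Some c)) = [:u:] * (\<Prod>j<d. [:- (fps_shift 1 (\<phi> j) - fps_const c), 1:])"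
    by (subst (asm) mult_left_cancel) auto
  then show ?thesis using assms(1) by (simp add: graph_germ_def)
qed

text \<open>Setting x = 0 in the coefficients is a ring homomorphism \<open>r\<close>, so the
  factorization survives. Questions about the germ at the origin become questions about the constant
  terms of the branches.\<close>

lemma graph_germ_at_0:
  assumes "graph_germ d u \<phi> f"
  shows "map_poly (\<lambda>p. coeff p 0) f = smult (fps_nth u 0) (\<Prod>j<d. [:- fps_nth (\<phi> j) 0, 1:])"
proof -
  define r :: "complex fps poly \<Rightarrow> complex poly" where "r = map_poly (\<lambda>s. fps_nth s 0)"
  have add: "r (p + q) = r p + r q" for p q
    unfolding r_def by (intro poly_eqI) (simp add: coeff_map_poly)
  have smult: "r (smult a q) = smult (fps_nth a 0) (r q)" for a q
    unfolding r_def by (intro poly_eqI) (simp add: coeff_map_poly)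
  have pC: "r (pCons a p) = pCons (fps_nth a 0) (r p)" for a p
    unfolding r_def by (simp add: map_poly_pCons)
  have mult: "r (p * q) = r p * r q" for p q
    by (induction p) (simp_all add: add smult pC, simp add: r_def)
  have prod: "r (\<Prod>j<d. g j) = (\<Prod>j<d. r (g j))" for g
    by (induction d) (simp_all add: mult, simp add: r_def)
  have "map_poly (\<lambda>p. coeff p 0) f = r (fpsp f)"
    unfolding r_def by (intro poly_eqI) (simp add: coeff_map_poly)
  also have "\<dots> = smult (fps_nth u 0) (\<Prod>j<d. [:- fps_nth (\<phi> j) 0, 1:])"
    using assms unfolding graph_germ_def by (simp add: smult prod pC) (simp add: r_def)
  finally show ?thesis .
qed

lemma graph_germ_coeff_0:
  assumes "graph_germ d u \<phi> f" "\<forall>j<d. fps_nth (\<phi> j) 0 \<noteq> 0"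
  shows "coeff (coeff f 0) 0 \<noteq> 0"
proof -
  have "coeff (coeff f 0) 0 = poly (map_poly (\<lambda>p. coeff p 0) f) 0"
    by (simp add: poly_0_coeff_0 coeff_map_poly)
  then show ?thesis
    using assms unfolding graph_germ_at_0[OF assms(1)] graph_germ_def
    by (simp add: poly_prod)
qed

text \<open>At most one branch passes through the origin; if one does, the other factors are nonzero
  there and f has a linear term in y.\<close>

lemma graph_germ_not_singular:
  assumes "graph_germ d u \<phi> f" "inj_on (\<lambda>j. fps_nth (\<phi> j) 0) {..<d}"
  shows "\<not> singular_at_0 f"
proof (cases "\<exists>j<d. fps_nth (\<phi> j) 0 = 0")
  case False
  then show ?thesis using graph_germ_coeff_0[OF assms(1)] not_singular_if_unit by blast
next
  case True
  then obtain j where j: "j < d" "fps_nth (\<phi> j) 0 = 0" by blast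
  define q where "q = smult (fps_nth u 0) (\<Prod>i\<in>{..<d} - {j}. [:- fps_nth (\<phi> i) 0, 1:])"
  have "map_poly (\<lambda>p. coeff p 0) f = [:0, 1:] * q"
    unfolding graph_germ_at_0[OF assms(1)] q_def using j by (subst prod.remove[of _ j]) simp_all
  from arg_cong[OF this, of "\<lambda>p. coeff p 1"] have "coeff (coeff f 1) 0 = poly q 0"
    by (simp add: coeff_map_poly poly_0_coeff_0)
  moreover have "fps_nth (\<phi> i) 0 \<noteq> 0" if "i < d" "i \<noteq> j" for i
    using that j inj_onD[OF assms(2), of i j] by auto
  then have "poly q 0 \<noteq> 0"
    using assms(1) unfolding q_def graph_germ_def by (simp add: poly_prod)
  ultimately show ?thesis using not_singular_if_linear by metis
qed

text \<open>Blowing up in the direction of the common slope c replaces \<phi> by \<phi> / x - c and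
  lowers the order of contact by one. Every other direction misses the curve: \<open>None\<close>
  because of the y^d term, other slopes because no branch then starts at 0. At contact of order 0
  the slopes differ and one more blow-up separates the branches, hence \<open>Suc k\<close>
  multiplicities.\<close>

lemma graph_germ_has_type:
  assumes "graph_germ d u \<phi> f" "d \<ge> 2" "\<forall>j<d. fps_nth (\<phi> j) 0 = 0"
    and "\<forall>i<d. \<forall>j<d. \<forall>l\<le>k. fps_nth (\<phi> i) l = fps_nth (\<phi> j) l"
    and "inj_on (\<lambda>j. fps_nth (\<phi> j) (Suc k)) {..<d}"
  shows "has_type f (replicate (Suc k) d)"
  using assms
proof (induction k arbitrary: f \<phi>)
  case 0
  note m = graph_germ_mult[OF 0(1,3)]
  have "\<not> singular_at_0 (proper_germ f e)" for e
  proof (cases e)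
    case None
    then show ?thesis using m by (intro not_singular_if_unit) (simp add: coeff_proper_germ_None_0 del: proper_germ.simps)
  next
    case (Some c)
    show ?thesis unfolding Some
      by (rule graph_germ_not_singular[OF graph_germ_blow_up[OF 0(1,3)]])
         (use 0(5) in \<open>auto simp: inj_on_def\<close>)
  qed
  then show ?case using m 0(2) by simp
next
  case (Suc k)
  note m = graph_germ_mult[OF Suc.prems(1,3)]
  \<comment> \<open>Index 0 is one of the branches because d is at least 2.\<close>
  define c where "c = fps_nth (\<phi> 0) 1"
  define \<psi> where "\<psi> j = fps_shift 1 (\<phi> j) - fps_const c" for j
  have c: "fps_nth (\<phi> j) 1 = c" if "j < d" for j
    using Suc.prems(4)[rule_format, of j 0 1] that by (simp add: c_def)
  have gg: "graph_germ d u \<psi> (proper_germ f (Some c))"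
    unfolding \<psi>_def by (rule graph_germ_blow_up[OF Suc.prems(1,3)])
  have \<psi>0: "\<forall>j<d. fps_nth (\<psi> j) 0 = 0" using c by (simp add: \<psi>_def)
  have "has_type (proper_germ f (Some c)) (replicate (Suc k) d)"
  proof (rule Suc.IH[OF gg Suc.prems(2) \<psi>0])
    show "\<forall>i<d. \<forall>j<d. \<forall>l\<le>k. fps_nth (\<psi> i) l = fps_nth (\<psi> j) l"
    proof (intro allI impI)
      fix i j l assume "i < d" "j < d" "l \<le> k"
      then show "fps_nth (\<psi> i) l = fps_nth (\<psi> j) l"
        using Suc.prems(4)[rule_format, of i j "Suc l"] by (simp add: \<psi>_def)
    qed
    show "inj_on (\<lambda>j. fps_nth (\<psi> j) (Suc k)) {..<d}"
      using Suc.prems(5) by (simp add: \<psi>_def inj_on_def)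
  qed
  moreover have "singular_at_0 (proper_germ f (Some c))"
    using graph_germ_mult(1)[OF gg \<psi>0] Suc.prems(2) by (simp add: singular_at_0_def)
  moreover have "\<not> singular_at_0 (proper_germ f e)" if "e \<noteq> Some c" for e
  proof (cases e)
    case None
    then show ?thesis using m by (intro not_singular_if_unit) (simp add: coeff_proper_germ_None_0 del: proper_germ.simps)
  next
    case (Some b)
    show ?thesis unfolding Some
      by (rule not_singular_if_unit[OF graph_germ_coeff_0[OF graph_germ_blow_up[OF Suc.prems(1,3)]]])
         (use c that Some in auto)
  qed
  ultimately show ?case using m Suc.prems(2) by (auto simp del: proper_germ.simps)
qed

lemma graph_germ_tacnode:
  assumes "graph_germ d u \<phi> f" "\<forall>j<d. fps_nth (\<phi> j) 0 = 0"
    and "\<forall>i<d. \<forall>j<d. \<forall>l\<le>k. fps_nth (\<phi> i) l = fps_nth (\<phi> j) l"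
    and "inj_on (\<lambda>j. fps_nth (\<phi> j) (Suc k)) {..<d}"
  shows "tacnode d k f"
  unfolding tacnode_def
proof (intro exI conjI)
  show "(1::complex) * 1 - 0 * 0 \<noteq> 0" by simp
  show "fps_nth (coeff [:u:] 0) 0 \<noteq> 0" using assms(1) by (simp add: graph_germ_def)
  have "ev2 (\<lambda>a. [:[:a:]:]) f [:[:0, 1:], [:0:]:] [:[:0, 0:], [:1:]:] = f"
    using ev2_X_eq_pcompose[of f "[:0, 1:]"] pcompose_idR[of f] by (simp flip: one_pCons)
  then show "map_poly fps_of_poly (ev2 (\<lambda>a. [:[:a:]:]) f [:[:0, 1:], [:0:]:] [:[:0, 0:], [:1:]:])
     = [:u:] * (\<Prod>j<d. [:- \<phi> j, 1:])"
    using assms(1) by (simp add: graph_germ_def)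
  show "\<forall>i<d. \<forall>j<d. i \<noteq> j \<longrightarrow> fps_nth (\<phi> i) (k + 1) \<noteq> fps_nth (\<phi> j) (k + 1)"
    using assms(4) by (auto simp: inj_on_def)
qed (fact assms)+

subsection \<open>Branches along a transversal line\<close>

lemma poly_taylor1:
  fixes K :: "'a::idom poly"
  shows "\<exists>q. poly K (a + h) = poly K a + h * poly (pderiv K) a + h ^ 2 * q"
proof (induction K)
  case (pCons c K)
  then obtain q where q: "poly K (a + h) = poly K a + h * poly (pderiv K) a + h ^ 2 * q" by blast
  show ?case
    by (rule exI[of _ "poly (pderiv K) a + a * q + h * q"])
       (simp add: q pderiv_pCons algebra_simps power2_eq_square)
qed simp

lemma fps_X_power_dvd_iff:
  fixes f :: "'a::comm_ring_1 fps"
  shows "fps_X ^ n dvd f \<longleftrightarrow> (\<forall>i<n. fps_nth f i = 0)"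
proof
  assume "fps_X ^ n dvd f"
  then show "\<forall>i<n. fps_nth f i = 0" by (auto simp: dvd_def fps_X_power_mult_nth)
next
  assume "\<forall>i<n. fps_nth f i = 0"
  then have "f = fps_X ^ n * fps_shift n f" by (intro fps_ext) (auto simp: fps_X_power_mult_nth)
  then show "fps_X ^ n dvd f" by (rule dvdI)
qed

lemma dvd_poly_diff:
  fixes K :: "'a::comm_ring_1 poly"
  assumes "m dvd a - b" shows "m dvd poly K a - poly K b"
proof (induction K)
  case (pCons c K)
  have "poly (pCons c K) a - poly (pCons c K) b = a * (poly K a - poly K b) + (a - b) * poly K b"
    by (simp add: algebra_simps)
  then show ?case using pCons assms by (metis dvd_add dvd_mult dvd_mult2)
qed simp

text \<open>Newton iteration, one coefficient per step. The derivative of K has the same nonzero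
  constant term D at every approximation, so a term of order n + 1 can cancel coefficient n + 1 of
  the error.\<close>

lemma hensel_root:
  fixes K :: "complex fps poly"
  assumes r0: "fps_nth (poly K (fps_const r)) 0 = 0"
    and r1: "fps_nth (poly (pderiv K) (fps_const r)) 0 \<noteq> 0"
  shows "\<exists>\<rho>. fps_nth \<rho> 0 = r \<and> poly K \<rho> = 0"
proof -
  define P where "P n \<rho> \<longleftrightarrow> fps_nth \<rho> 0 = r \<and> fps_X ^ Suc n dvd poly K \<rho>" for n \<rho>
  have "\<exists>f. \<forall>n. P n (f n) \<and> fps_X ^ Suc n dvd f (Suc n) - f n"
  proof (rule dependent_nat_choice)
    show "\<exists>\<rho>. P 0 \<rho>"
      unfolding P_def fps_X_power_dvd_iff using r0 by (intro exI[of _ "fps_const r"]) simp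
  next
    fix \<rho> n assume P: "P n \<rho>"
    define D where "D = fps_nth (poly (pderiv K) (fps_const r)) 0"
    have "fps_X ^ 1 dvd \<rho> - fps_const r" using P unfolding fps_X_power_dvd_iff P_def by simp
    then have "fps_X ^ 1 dvd poly (pderiv K) \<rho> - poly (pderiv K) (fps_const r)" by (rule dvd_poly_diff)
    then have D: "fps_nth (poly (pderiv K) \<rho>) 0 = D" unfolding fps_X_power_dvd_iff D_def by simp
    \<comment> \<open>The linear term of the Taylor expansion cancels coefficient n + 1 of
      \<open>poly K \<rho>\<close>; the remainder has order at least 2 n + 2 and disturbs nothing up
      to there.\<close>
    define h where "h = fps_X ^ Suc n * fps_const (- fps_nth (poly K \<rho>) (Suc n) / D)"
    obtain q where q: "poly K (\<rho> + h) = poly K \<rho> + h * poly (pderiv K) \<rho> + h ^ 2 * q"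
      using poly_taylor1 by blast
    have "fps_nth (poly K (\<rho> + h)) i = 0" if "i < Suc (Suc n)" for i
    proof -
      have "h ^ 2 * q = fps_X ^ Suc n * (fps_X ^ Suc n * ((fps_const (- fps_nth (poly K \<rho>) (Suc n) / D)) ^ 2 * q))"
        unfolding h_def power2_eq_square by (simp only: mult_ac)
      then have "fps_nth (h ^ 2 * q) i = 0" using that by (simp only: fps_X_power_mult_nth) simp
      moreover have "fps_nth (h * poly (pderiv K) \<rho>) i = (if i = Suc n then - fps_nth (poly K \<rho>) (Suc n) else 0)"
        using that r1 unfolding h_def mult.assoc by (auto simp: fps_X_power_mult_nth D D_def simp del: power_Suc)
      moreover have "fps_nth (poly K \<rho>) i = 0" if "i < Suc n"
        using P that unfolding P_def fps_X_power_dvd_iff by blast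
      ultimately show ?thesis using that by (auto simp: q less_Suc_eq)
    qed
    moreover have "fps_nth h i = 0" if "i < Suc n" for i
      using that unfolding h_def by (simp add: fps_X_power_mult_nth del: power_Suc)
    ultimately have "P (Suc n) (\<rho> + h) \<and> fps_X ^ Suc n dvd (\<rho> + h) - \<rho>"
      using P unfolding P_def fps_X_power_dvd_iff by (simp del: power_Suc)
    then show "\<exists>\<rho>'. P (Suc n) \<rho>' \<and> fps_X ^ Suc n dvd \<rho>' - \<rho>" by blast
  qed
  then obtain f where f: "\<And>n. P n (f n)" "\<And>n. fps_X ^ Suc n dvd f (Suc n) - f n" by blast
  \<comment> \<open>Coefficient n is final from the n-th approximation on, so the diagonal is the
    limit.\<close>
  define \<rho> where "\<rho> = Abs_fps (\<lambda>n. fps_nth (f n) n)"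
  have stable: "fps_nth (f (i + m)) i = fps_nth (f i) i" for i m
  proof (induction m)
    case (Suc m)
    then show ?case using f(2)[of "i + m"] unfolding fps_X_power_dvd_iff by simp
  qed simp
  have "fps_nth (poly K \<rho>) n = 0" for n
  proof -
    have "fps_X ^ Suc n dvd \<rho> - f n"
      unfolding fps_X_power_dvd_iff \<rho>_def using stable by (auto simp: less_Suc_eq_le le_iff_add)
    then have "fps_X ^ Suc n dvd poly K \<rho> - poly K (f n)" by (rule dvd_poly_diff)
    moreover have "fps_X ^ Suc n dvd poly K (f n)" using f(1) unfolding P_def by blast
    ultimately have "fps_X ^ Suc n dvd poly K \<rho>" by (simp add: dvd_diff_left_iff del: power_Suc)
    then show ?thesis unfolding fps_X_power_dvd_iff by blast
  qed
  then have "poly K \<rho> = 0" by (intro fps_ext) simp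
  moreover have "fps_nth \<rho> 0 = r" using f(1)[of 0] by (simp add: \<rho>_def P_def)
  ultimately show ?thesis by blast
qed

lemma poly_eq_prod_roots:
  fixes K :: "'a::idom poly"
  assumes "degree K = d" "inj_on \<rho> {..<d}" "\<forall>j<d. poly K (\<rho> j) = 0"
  shows "K = smult (coeff K d) (\<Prod>j<d. [:- \<rho> j, 1:])"
  using assms
proof (induction d arbitrary: K)
  case 0
  then show ?case by (simp add: degree_0_id)
next
  case (Suc d)
  have "poly K (\<rho> d) = 0" using Suc.prems by simp
  then obtain K' where K': "K = [:- \<rho> d, 1:] * K'" unfolding poly_eq_0_iff_dvd dvd_def by blast
  have nz: "K' \<noteq> 0" using Suc.prems(1) K' by auto
  have deg: "degree K' = d" using Suc.prems(1) nz unfolding K' by (subst (asm) degree_mult_eq) auto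
  have "\<forall>j<d. poly K' (\<rho> j) = 0"
  proof (intro allI impI)
    fix j assume "j < d"
    then have "\<rho> j \<noteq> \<rho> d" using inj_onD[OF Suc.prems(2), of j d] by auto
    then show "poly K' (\<rho> j) = 0" using Suc.prems(3)[rule_format, of j] \<open>j < d\<close> by (simp add: K')
  qed
  then have IH: "K' = smult (coeff K' d) (\<Prod>j<d. [:- \<rho> j, 1:])"
    using Suc.IH[OF deg] Suc.prems(2) by (auto simp: inj_on_def)
  have "coeff K (Suc d) = coeff K' d" unfolding K' using deg by (simp add: coeff_eq_0)
  then have "K = smult (coeff K (Suc d)) ([:- \<rho> d, 1:] * (\<Prod>j<d. [:- \<rho> j, 1:]))"
    by (subst K', subst IH) (simp only: mult_smult_right)
  then show ?case by (simp only: prod.lessThan_Suc mult.commute)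
qed

text \<open>The polynomial l^d K (w / l), with the denominators cleared.\<close>

definition homogenize :: "nat \<Rightarrow> 'a::comm_ring_1 poly \<Rightarrow> 'a poly \<Rightarrow> 'a poly \<Rightarrow> 'a poly" where
  "homogenize d K l w = (\<Sum>j\<le>d. smult (coeff K j) (l ^ (d - j) * w ^ j))"

lemma homogenize_mult_linear:
  fixes K :: "'a::comm_ring_1 poly"
  assumes "degree K \<le> d"
  shows "homogenize (Suc d) (K * [:- r, 1:]) l w = homogenize d K l w * (w - smult r l)"
proof -
  have c: "coeff (K * [:- r, 1:]) j = (if j = 0 then 0 else coeff K (j - 1)) - r * coeff K j" for j
    by (cases j) simp_all
  have "homogenize (Suc d) (K * [:- r, 1:]) l w =
     (\<Sum>j\<le>Suc d. smult (if j = 0 then 0 else coeff K (j - 1)) (l ^ (Suc d - j) * w ^ j))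
     - (\<Sum>j\<le>Suc d. smult (r * coeff K j) (l ^ (Suc d - j) * w ^ j))"
    unfolding homogenize_def c by (simp add: smult_diff_left sum_subtractf)
  also have "(\<Sum>j\<le>Suc d. smult (if j = 0 then 0 else coeff K (j - 1)) (l ^ (Suc d - j) * w ^ j))
     = homogenize d K l w * w"
    unfolding homogenize_def sum.atMost_Suc_shift by (simp add: sum_distrib_left mult_ac)
  \<comment> \<open>The degree bound kills the term j = \<open>Suc d\<close>, the only one from
    which no factor l can be taken out.\<close>
  also have "(\<Sum>j\<le>Suc d. smult (r * coeff K j) (l ^ (Suc d - j) * w ^ j)) = homogenize d K l w * smult r l"
    using assms unfolding homogenize_def sum.atMost_Suc sum_distrib_right
    by (simp add: coeff_eq_0 Suc_diff_le sum_distrib_left mult_ac)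
  finally show ?thesis by (simp add: algebra_simps)
qed

lemma homogenize_prod:
  fixes \<rho> :: "nat \<Rightarrow> 'a::idom"
  shows "homogenize d (smult c (\<Prod>j<d. [:- \<rho> j, 1:])) l w = smult c (\<Prod>j<d. w - smult (\<rho> j) l)"
proof (induction d)
  case (Suc d)
  have "degree (smult c (\<Prod>j<d. [:- \<rho> j, 1:])) \<le> d"
    using degree_smult_le[of c "\<Prod>j<d. [:- \<rho> j, 1:]"] coeff_monic_linear_prod(1)[of \<rho> d] by simp
  from homogenize_mult_linear[OF this, of "\<rho> d" l w] show ?case
    by (simp only: Suc prod.lessThan_Suc mult_smult_left)
qed (simp add: homogenize_def)

lemma fpsp_sum: "fpsp (\<Sum>j\<in>A. f j) = (\<Sum>j\<in>A. fpsp (f j))"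
  by (induction A rule: infinite_finite_induct) (simp_all add: fpsp_add)

lemma fpsp_homogenize: "fpsp (homogenize d K l w) = homogenize d (fpsp K) (fpsp l) (fpsp w)"
  unfolding homogenize_def fpsp_sum by (simp add: fpsp_smult fpsp_mult fpsp_power coeff_map_poly)

text \<open>This turns homogeneity into a degree bound with a leading coefficient. With n the degree
  of q, z^d times the reflection of q equals z^n r; comparing coefficients at d forces n \<le> d,
  and those at d and n give the value r(0).\<close>

lemma poly_reverse:
  fixes q r :: "complex poly"
  assumes "\<And>z. z \<noteq> 0 \<Longrightarrow> poly q z = z ^ d * poly r (1 / z)"
  shows "degree q \<le> d" "coeff q d = poly r 0"
proof -
  define n where "n = degree q"
  have inf: "infinite (- {0::complex})"
    using infinite_UNIV_char_0 finite_insert[of 0 "- {0::complex}"] by (simp add: Compl_eq_Diff_UNIV)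
  have *: "monom 1 d * reflect_poly q = monom 1 n * r"
  proof (rule poly_eq_on_infinite[OF inf])
    fix z :: complex assume "z \<in> - {0}"
    then have z: "z \<noteq> 0" by simp
    then show "poly (monom 1 d * reflect_poly q) z = poly (monom 1 n * r) z"
      using assms[of "1 / z"] by (simp add: poly_monom poly_reflect_poly_nz n_def field_simps)
  qed
  have "n \<le> d \<and> coeff q d = poly r 0"
  proof (cases "q = 0")
    case True
    then have "r = 0" using * by (simp add: n_def)
    then show ?thesis using True by (simp add: n_def)
  next
    case False
    have "coeff (monom 1 d * reflect_poly q) d = lead_coeff q" by (simp add: coeff_monom_mult)
    then have "coeff (monom 1 n * r) d = lead_coeff q" unfolding * .
    then have "n \<le> d" using False by (auto simp: coeff_monom_mult split: if_splits)
    moreover have "coeff q d = poly r 0"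
    proof (cases "n = d")
      case True
      then show ?thesis using \<open>coeff (monom 1 n * r) d = lead_coeff q\<close>
        by (simp add: coeff_monom_mult n_def poly_0_coeff_0)
    next
      case False
      then have "coeff (monom 1 d * reflect_poly q) n = 0" using \<open>n \<le> d\<close> by (simp add: coeff_monom_mult)
      then show ?thesis using False \<open>n \<le> d\<close> unfolding *
        by (simp add: coeff_monom_mult n_def poly_0_coeff_0 coeff_eq_0)
    qed
    ultimately show ?thesis by blast
  qed
  then show "degree q \<le> d" "coeff q d = poly r 0" by (auto simp: n_def)
qed

text \<open>The polynomial of \<open>local_equation\<close>, but for arbitrary vectors: with second
  vector 0 it is the restriction of F to a line, and with e, w, c it describes F on the lines
  through c near a given one.\<close>

definition chart ::
  "complex poly poly poly \<Rightarrow> complex ^ 3 \<Rightarrow> complex ^ 3 \<Rightarrow> complex ^ 3 \<Rightarrow> complex poly poly" where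
  "chart F v a b = ev3 (\<lambda>c. [:[:c:]:]) F
              [:[:v $ 1, a $ 1:], [:b $ 1:]:]
              [:[:v $ 2, a $ 2:], [:b $ 2:]:]
              [:[:v $ 3, a $ 3:], [:b $ 3:]:]"

lemma eval2_chart: "eval2 (chart F v a b) x y = form_at F (v + x *s a + y *s b)"
  unfolding chart_def eval2_ev3 form_at_eq_eval3 by (simp add: algebra_simps)

lemma local_equation_chart: "basis3 v a b \<Longrightarrow> local_equation F (ppoint v) (chart F v a b)"
  unfolding local_equation_def chart_def by blast

lemma poly_map_eval: "poly (map_poly (\<lambda>p. poly p x) f) y = eval2 f x y"
  by (induction f) (simp_all add: map_poly_pCons)

text \<open>For fixed x, F(e + x w + z c) = z^d F(c + (e + x w) / z), so \<open>poly_reverse\<close>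
  applies. The value of the reversed polynomial at 0 is F(c), which does not depend on x.\<close>

lemma chart_coeffs:
  assumes "plane_curve d F"
  shows "degree (chart F e w c) \<le> d" "coeff (chart F e w c) d = [:form_at F c:]"
proof -
  let ?K = "chart F e w c"
  have *: "degree (map_poly (\<lambda>p. poly p x) ?K) \<le> d"
    "coeff (map_poly (\<lambda>p. poly p x) ?K) d = form_at F c" for x
  proof -
    define r where "r = map_poly (\<lambda>p. poly p 0) (chart F c 0 (e + x *s w))"
    have r: "poly r s = form_at F (c + s *s (e + x *s w))" for s
      unfolding r_def poly_map_eval eval2_chart by simp
    have "poly (map_poly (\<lambda>p. poly p x) ?K) z = z ^ d * poly r (1 / z)" if "z \<noteq> 0" for z
    proof -
      have "e + x *s w + z *s c = z *s (c + (1 / z) *s (e + x *s w))"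
        using that unfolding vec_eq_iff vector_add_component vector_smult_component by (auto simp: field_simps)
      then show ?thesis by (simp only: poly_map_eval eval2_chart r form_at_scale[OF assms])
    qed
    from poly_reverse[OF this] show "degree (map_poly (\<lambda>p. poly p x) ?K) \<le> d"
      "coeff (map_poly (\<lambda>p. poly p x) ?K) d = form_at F c" using r[of 0] by auto
  qed
  show "coeff ?K d = [:form_at F c:]"
    using *(2) by (intro poly_eq_on_infinite[OF infinite_UNIV_char_0]) (simp add: coeff_map_poly)
  have "coeff ?K k = 0" if "k > d" for k
  proof (rule poly_eq_on_infinite[OF infinite_UNIV_char_0])
    fix x show "poly (coeff ?K k) x = poly 0 x"
      using coeff_eq_0[OF le_less_trans[OF *(1) that], of x] by (simp add: coeff_map_poly)
  qed
  then show "degree ?K \<le> d" by (intro degree_le) simp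
qed

text \<open>For l nonzero this is the scaling law of F. At l = 0 only the term j = d survives, and
  it is right because the coefficient of the chart at d is the constant F(c).\<close>

lemma chart_homogenize:
  assumes "plane_curve d F"
  shows "eval2 (homogenize d (chart F e w c) l m) x y =
    form_at F (eval2 l x y *s (e + x *s w) + eval2 m x y *s c)"
proof -
  let ?K = "chart F e w c" and ?l = "eval2 l x y" and ?m = "eval2 m x y"
  have K: "form_at F (e + x *s w + z *s c) = (\<Sum>j\<le>d. poly (coeff ?K j) x * z ^ j)" for z
    unfolding eval2_chart[symmetric] poly_sum_bound[OF chart_coeffs(1)[OF assms]]
    by (simp add: poly_sum poly_power)
  have "eval2 (homogenize d ?K l m) x y = (\<Sum>j\<le>d. poly (coeff ?K j) x * ?l ^ (d - j) * ?m ^ j)"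
    unfolding homogenize_def by (simp add: poly_sum poly_power mult_ac)
  also have "\<dots> = form_at F (?l *s (e + x *s w) + ?m *s c)"
  proof (cases "?l = 0")
    case True
    have "(\<Sum>j\<le>d. poly (coeff ?K j) x * ?l ^ (d - j) * ?m ^ j) = (\<Sum>j\<in>{d}. poly (coeff ?K j) x * ?l ^ (d - j) * ?m ^ j)"
      using True by (intro sum.mono_neutral_right) auto
    then show ?thesis using True by (simp add: chart_coeffs(2)[OF assms] form_at_scale[OF assms] mult.commute)
  next
    case False
    have "?l *s (e + x *s w) + ?m *s c = ?l *s (e + x *s w + (?m / ?l) *s c)"
      using False unfolding vec_eq_iff vector_add_component vector_smult_component by (auto simp: field_simps)
    then have "form_at F (?l *s (e + x *s w) + ?m *s c)
      = ?l ^ d * (\<Sum>j\<le>d. poly (coeff ?K j) x * (?m / ?l) ^ j)"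
      by (simp only: form_at_scale[OF assms] K)
    also have "\<dots> = (\<Sum>j\<le>d. poly (coeff ?K j) x * ?l ^ (d - j) * ?m ^ j)"
      unfolding sum_distrib_left using False
      by (intro sum.cong refl) (auto simp: power_divide power_diff field_simps)
    finally show ?thesis by simp
  qed
  finally show ?thesis .
qed

lemma fpsp_at_0: "fps_nth (poly (fpsp K) s) 0 = poly (map_poly (\<lambda>p. poly p 0) K) (fps_nth s 0)"
  by (induction K) (simp_all add: map_poly_pCons poly_0_coeff_0)

lemma fpsp_pderiv: "fpsp (pderiv K) = pderiv (fpsp K)"
  by (induction K) (simp_all add: pderiv_pCons fpsp_add)

lemma map_poly_pderiv_eval: "map_poly (\<lambda>p. poly p (x::complex)) (pderiv K) = pderiv (map_poly (\<lambda>p. poly p x) K)"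
  by (intro poly_eqI) (simp add: coeff_map_poly coeff_pderiv)

text \<open>The derivative in z is the pairing of the gradient with c, so all roots on the line are
  simple; a squarefree complex polynomial of degree d has d roots.\<close>

lemma transversal_roots:
  assumes "plane_curve d F" "form_at F c \<noteq> 0"
    and "\<forall>z. form_at F (e + z *s c) = 0 \<longrightarrow> pairing (gradient F (e + z *s c)) c \<noteq> 0"
  shows "card {z. form_at F (e + z *s c) = 0} = d"
    "poly (map_poly (\<lambda>p. poly p 0) (pderiv (chart F e w c))) z = pairing (gradient F (e + z *s c)) c"
proof -
  define q where "q = map_poly (\<lambda>p. poly p 0) (chart F e w c)"
  have q: "poly q z = form_at F (e + z *s c)" for z unfolding q_def poly_map_eval eval2_chart by simp
  have deg: "degree q = d"
  proof (rule antisym)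
    show "degree q \<le> d" unfolding q_def
      using map_poly_degree_leq[of "\<lambda>p. poly p 0" "chart F e w c"] chart_coeffs(1)[OF assms(1), of e w c] by simp
    show "d \<le> degree q"
      using assms(2) by (intro le_degree) (simp add: q_def coeff_map_poly chart_coeffs(2)[OF assms(1)])
  qed
  have dq: "poly (pderiv q) z = pairing (gradient F (e + z *s c)) c" for z
  proof -
    have "((\<lambda>z. form_at F (e + z *s c)) has_field_derivative pairing (gradient F (e + z *s c)) c) (at z)"
      by (rule form_at_has_field_derivative) (auto intro!: derivative_eq_intros)
    then show ?thesis unfolding q[symmetric] by (rule DERIV_unique[OF poly_DERIV])
  qed
  then show "poly (map_poly (\<lambda>p. poly p 0) (pderiv (chart F e w c))) z = pairing (gradient F (e + z *s c)) c"
    unfolding map_poly_pderiv_eval q_def .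
  have "rsquarefree q" unfolding rsquarefree_roots using assms(3) by (simp add: q dq)
  from complex_poly_decompose_rsquarefree[OF this]
  have "smult (lead_coeff q) (\<Prod>z | poly q z = 0. [:- z, 1:]) = q" .
  moreover have "lead_coeff q \<noteq> 0" using \<open>rsquarefree q\<close> by (simp add: rsquarefree_def)
  ultimately have "degree (\<Prod>z | poly q z = 0. [:- z, 1:]) = d"
    using deg by (metis degree_smult_eq)
  then show "card {z. form_at F (e + z *s c) = 0} = d"
    by (subst (asm) degree_prod_sum_eq) (simp_all add: q)
qed

text \<open>The d simple roots at x = 0 lift to d distinct series. They exhaust the equation, which
  has degree d in the last variable and leading coefficient F(c).\<close>

lemma slice_factorization:
  assumes "plane_curve d F" "form_at F c \<noteq> 0"
    and "\<forall>z. form_at F (e + z *s c) = 0 \<longrightarrow> pairing (gradient F (e + z *s c)) c \<noteq> 0"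
  obtains \<rho> where
    "fpsp (chart F e w c) = smult (fps_const (form_at F c)) (\<Prod>j<d. [:- \<rho> j, 1:])"
    "inj_on (\<lambda>j. fps_nth (\<rho> j) 0) {..<d}" "\<forall>j<d. form_at F (e + fps_nth (\<rho> j) 0 *s c) = 0"
proof -
  let ?K = "chart F e w c" and ?R = "{z. form_at F (e + z *s c) = 0}"
  have card: "card ?R = d" using transversal_roots(1)[OF assms] .
  have "finite ?R"
  proof -
    have "finite {z. poly (map_poly (\<lambda>p. poly p 0) ?K) z = 0}"
    proof (rule poly_roots_finite)
      show "map_poly (\<lambda>p. poly p 0) ?K \<noteq> 0"
      proof
        assume "map_poly (\<lambda>p. poly p 0) ?K = 0"
        from arg_cong[OF this, of "\<lambda>p. coeff p d"] show False
          using assms(2) by (simp add: coeff_map_poly chart_coeffs(2)[OF assms(1)])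
      qed
    qed
    then show ?thesis unfolding poly_map_eval eval2_chart by simp
  qed
  then obtain r where r: "bij_betw r {..<d} ?R"
    using ex_bij_betw_nat_finite[of ?R] card by (auto simp: atLeast0LessThan)
  have "\<exists>\<rho>. fps_nth \<rho> 0 = r j \<and> poly (fpsp ?K) \<rho> = 0" if "j < d" for j
  proof (rule hensel_root)
    have rj: "form_at F (e + r j *s c) = 0" using r that unfolding bij_betw_def by auto
    show "fps_nth (poly (fpsp ?K) (fps_const (r j))) 0 = 0"
      unfolding fpsp_at_0 poly_map_eval eval2_chart using rj by simp
    show "fps_nth (poly (pderiv (fpsp ?K)) (fps_const (r j))) 0 \<noteq> 0"
      unfolding fpsp_pderiv[symmetric] fpsp_at_0 transversal_roots(2)[OF assms] using assms(3) rj by simp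
  qed
  then obtain \<rho> where \<rho>: "\<forall>j<d. fps_nth (\<rho> j) 0 = r j \<and> poly (fpsp ?K) (\<rho> j) = 0" by metis
  have inj: "inj_on (\<lambda>j. fps_nth (\<rho> j) 0) {..<d}"
    using r \<rho> unfolding bij_betw_def inj_on_def by auto
  have c: "coeff (fpsp ?K) d = fps_const (form_at F c)"
    by (simp add: coeff_map_poly chart_coeffs(2)[OF assms(1)] fps_of_poly_const)
  have deg: "degree (fpsp ?K) = d"
  proof (rule antisym)
    show "degree (fpsp ?K) \<le> d"
      using map_poly_degree_leq[of fps_of_poly ?K] chart_coeffs(1)[OF assms(1), of e w c] by simp
    show "d \<le> degree (fpsp ?K)" using c assms(2) by (intro le_degree) simp
  qed
  have "inj_on \<rho> {..<d}" using inj by (auto simp: inj_on_def)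
  from poly_eq_prod_roots[OF deg this] \<rho> c
  have "fpsp ?K = smult (fps_const (form_at F c)) (\<Prod>j<d. [:- \<rho> j, 1:])" by simp
  moreover have "\<forall>j<d. form_at F (e + fps_nth (\<rho> j) 0 *s c) = 0"
    using \<rho> r unfolding bij_betw_def by auto
  ultimately show ?thesis using that inj by blast
qed

section \<open>Distinct roots on nearby lines\<close>

text \<open>If all roots were at distance at least \<epsilon> from r, the factorization of q would
  bound the modulus of q(r) from below by that of the leading coefficient times
  \<epsilon>^deg.\<close>

lemma root_near:
  fixes q :: "complex poly"
  assumes "cmod (poly q r) < cmod (lead_coeff q) * \<epsilon> ^ degree q" "\<epsilon> > 0"
  shows "\<exists>z. poly q z = 0 \<and> dist r z < \<epsilon>"
proof (rule ccontr)
  assume no: "\<not> ?thesis"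
  obtain root where root: "smult (lead_coeff q) (\<Prod>i<degree q. [:- root i, 1:]) = q"
    by (rule complex_poly_decompose')
  have val: "poly q z = lead_coeff q * (\<Prod>i<degree q. z - root i)" for z
    by (subst root[symmetric]) (simp add: poly_prod)
  have "poly q (root i) = 0" if "i < degree q" for i
    unfolding val using that by (auto intro!: prod_zero)
  then have "\<epsilon> \<le> cmod (r - root i)" if "i < degree q" for i
    using no that by (auto simp: dist_norm not_less)
  then have "(\<Prod>i<degree q. \<epsilon>) \<le> (\<Prod>i<degree q. cmod (r - root i))"
    using assms(2) by (intro prod_mono) auto
  then have "cmod (lead_coeff q) * \<epsilon> ^ degree q \<le> cmod (poly q r)"
    unfolding val[of r] by (simp add: norm_mult prod_norm mult_left_mono)
  then show False using assms(1) by simp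
qed

text \<open>The series of \<open>slice_factorization\<close> are formal only. Actual points on
  nearby lines come from continuity: q is small at each old root, so a new root lies within
  \<epsilon>, and the old roots are 2 \<epsilon> apart.\<close>

lemma distinct_roots_nearby:
  assumes "plane_curve d F" "form_at F c \<noteq> 0"
    and "\<forall>z. form_at F (e + z *s c) = 0 \<longrightarrow> pairing (gradient F (e + z *s c)) c \<noteq> 0"
  shows "\<exists>\<delta>>0. \<forall>x. cmod x < \<delta> \<longrightarrow> (\<exists>\<zeta>. inj_on \<zeta> {..<d} \<and> (\<forall>j<d. form_at F (e + x *s w + \<zeta> j *s c) = 0))"
proof -
  let ?K = "chart F e w c"
  obtain \<rho> where \<rho>: "inj_on (\<lambda>j. fps_nth (\<rho> j) 0) {..<d}" "\<forall>j<d. form_at F (e + fps_nth (\<rho> j) 0 *s c) = 0"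
    using slice_factorization[OF assms] by metis
  define r where "r j = fps_nth (\<rho> j) 0" for j
  \<comment> \<open>The inserted 1 keeps \<open>Min\<close> meaningful when there are no two
    distinct roots.\<close>
  define \<epsilon> where "\<epsilon> = Min (insert 1 ((\<lambda>(i, j). dist (r i) (r j) / 2) ` {(i, j). i < d \<and> j < d \<and> i \<noteq> j}))"
  have fin: "finite {(i, j). i < d \<and> j < d \<and> i \<noteq> j}"
    by (rule finite_subset[of _ "{..<d} \<times> {..<d}"]) auto
  have "\<epsilon> > 0"
    unfolding \<epsilon>_def using fin \<rho>(1) by (subst Min_gr_iff) (auto simp: r_def inj_on_def)
  have \<epsilon>: "2 * \<epsilon> \<le> dist (r i) (r j)" if "i < d" "j < d" "i \<noteq> j" for i j
  proof -
    have "\<epsilon> \<le> dist (r i) (r j) / 2" unfolding \<epsilon>_def using fin that by (intro Min_le) auto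
    then show ?thesis by simp
  qed
  have "\<forall>\<^sub>F x in at 0. cmod (eval2 ?K x (r j)) < cmod (form_at F c) * \<epsilon> ^ d" if "j < d" for j
  proof -
    have "((\<lambda>x. cmod (eval2 ?K x (r j))) \<longlongrightarrow> cmod (eval2 ?K 0 (r j))) (at 0)"
      by (intro tendsto_intros poly_isCont[unfolded isCont_def])
    moreover have "eval2 ?K 0 (r j) = 0" using \<rho>(2) that unfolding eval2_chart by (simp add: r_def)
    ultimately show ?thesis
      using assms(2) \<open>\<epsilon> > 0\<close> by (intro order_tendstoD(2)) auto
  qed
  then have "\<forall>\<^sub>F x in at 0. \<forall>j\<in>{..<d}. cmod (eval2 ?K x (r j)) < cmod (form_at F c) * \<epsilon> ^ d"
    by (intro eventually_ball_finite) auto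
  then obtain \<delta> where \<delta>: "\<delta> > 0"
    "\<And>x. x \<noteq> 0 \<Longrightarrow> cmod x < \<delta> \<Longrightarrow> \<forall>j<d. cmod (eval2 ?K x (r j)) < cmod (form_at F c) * \<epsilon> ^ d"
    unfolding eventually_at by (auto simp: dist_norm)
  have "\<exists>\<zeta>. inj_on \<zeta> {..<d} \<and> (\<forall>j<d. form_at F (e + x *s w + \<zeta> j *s c) = 0)" if x: "cmod x < \<delta>" for x
  proof (cases "x = 0")
    case True
    then show ?thesis using \<rho> by (intro exI[of _ r]) (simp add: r_def[abs_def])
  next
    case False
    define q where "q = map_poly (\<lambda>p. poly p x) ?K"
    have c: "coeff q d = form_at F c" by (simp add: q_def coeff_map_poly chart_coeffs(2)[OF assms(1)])
    have deg: "degree q = d"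
    proof (rule antisym)
      show "degree q \<le> d" unfolding q_def
        using map_poly_degree_leq[of "\<lambda>p. poly p x" ?K] chart_coeffs(1)[OF assms(1), of e w c] by simp
      show "d \<le> degree q" using c assms(2) by (intro le_degree) simp
    qed
    have "\<exists>z. poly q z = 0 \<and> dist (r j) z < \<epsilon>" if "j < d" for j
      using root_near[of q "r j" \<epsilon>] \<delta>(2)[OF False x] that \<open>\<epsilon> > 0\<close> c deg by (simp add: q_def poly_map_eval)
    then obtain \<zeta> where \<zeta>: "\<forall>j<d. poly q (\<zeta> j) = 0 \<and> dist (r j) (\<zeta> j) < \<epsilon>" by metis
    have "inj_on \<zeta> {..<d}"
    proof (rule inj_onI, rule ccontr)
      fix i j assume ij: "i \<in> {..<d}" "j \<in> {..<d}" "\<zeta> i = \<zeta> j" "i \<noteq> j"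
      have "dist (r i) (r j) \<le> dist (r i) (\<zeta> i) + dist (r j) (\<zeta> i)" by (rule dist_triangle2)
      moreover have "dist (r i) (\<zeta> i) < \<epsilon>" "dist (r j) (\<zeta> i) < \<epsilon>" using \<zeta> ij by auto
      ultimately show False using \<epsilon>[of i j] ij by simp
    qed
    then show ?thesis using \<zeta> unfolding q_def poly_map_eval eval2_chart by blast
  qed
  then show ?thesis using \<delta>(1) by blast
qed

subsection \<open>Coordinates and the Cremona transformation on points\<close>

definition pt :: "complex ^ 3 \<Rightarrow> complex ^ 3 \<Rightarrow> complex ^ 3 \<Rightarrow> complex \<Rightarrow> complex \<Rightarrow> complex \<Rightarrow> complex ^ 3" where
  "pt a b c X Y Z = X *s a + Y *s b + Z *s c"

lemma pt_nth: "pt a b c X Y Z $ i = X * a $ i + Y * b $ i + Z * c $ i"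
  by (simp add: pt_def)

lemma pairing_pt: "pairing m (pt a b c X Y Z) = X * pairing m a + Y * pairing m b + Z * pairing m c"
  unfolding pairing_def sum_3 pt_nth by (simp add: algebra_simps)

lemma pt_scale: "pt a b c (k * X) (k * Y) (k * Z) = k *s pt a b c X Y Z"
  by (simp add: vec_eq_iff pt_nth algebra_simps)

text \<open>The coordinate forms are the columns of the inverse of the matrix with rows a, b, c; the
  two products with the inverse give duality and reconstruction.\<close>

lemma basis3_dual:
  assumes "basis3 a b c"
  obtains e1 e2 e3 where "\<And>v. pt a b c (pairing e1 v) (pairing e2 v) (pairing e3 v) = v"
    "\<And>X Y Z. pairing e1 (pt a b c X Y Z) = X" "\<And>X Y Z. pairing e2 (pt a b c X Y Z) = Y"
    "\<And>X Y Z. pairing e3 (pt a b c X Y Z) = Z"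
proof -
  define M where "M = (vector [a, b, c] :: complex ^ 3 ^ 3)"
  have "invertible M" using assms unfolding basis3_def M_def invertible_det_nz .
  then obtain W where W: "M ** W = mat 1" "W ** M = mat 1" unfolding invertible_def by blast
  define e where "e i = (\<chi> j. W $ j $ i)" for i
  have rows: "M $ 1 = a" "M $ 2 = b" "M $ 3 = c" by (simp_all add: M_def vector_3)
  have MW: "(\<Sum>k\<in>UNIV. M $ i $ k * W $ k $ j) = (if i = j then 1 else 0)" for i j
    using arg_cong[OF W(1), of "\<lambda>A. A $ i $ j"] by (simp add: matrix_matrix_mult_def mat_def)
  have WM: "(\<Sum>k\<in>UNIV. W $ i $ k * M $ k $ j) = (if i = j then 1 else 0)" for i j
    using arg_cong[OF W(2), of "\<lambda>A. A $ i $ j"] by (simp add: matrix_matrix_mult_def mat_def)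
  have p: "pairing (e i) (M $ j) = (if i = j then 1 else 0)" for i j
    using MW[of j i] by (simp add: pairing_def e_def mult.commute)
  have "pt a b c (pairing (e 1) v) (pairing (e 2) v) (pairing (e 3) v) $ k = v $ k" for v k
  proof -
    have "pt a b c (pairing (e 1) v) (pairing (e 2) v) (pairing (e 3) v) $ k
      = (\<Sum>j\<in>UNIV. v $ j * (\<Sum>i\<in>UNIV. W $ j $ i * M $ i $ k))"
      unfolding pt_nth rows[symmetric] pairing_def sum_3 e_def by (simp add: algebra_simps)
    also have "\<dots> = v $ k" unfolding WM by (simp add: sum.delta if_distrib cong: if_cong)
    finally show ?thesis .
  qed
  then have "pt a b c (pairing (e 1) v) (pairing (e 2) v) (pairing (e 3) v) = v" for v
    by (simp add: vec_eq_iff)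
  then show ?thesis
    using that[of "e 1" "e 2" "e 3"] p[of _ 1] p[of _ 2] p[of _ 3] unfolding pairing_pt rows by simp
qed

lemma pt_inject:
  assumes "basis3 a b c"
  shows "pt a b c X Y Z = pt a b c X' Y' Z' \<longleftrightarrow> X = X' \<and> Y = Y' \<and> Z = Z'"
  using basis3_dual[OF assms] by metis

lemma pt_cases:
  assumes "basis3 a b c" obtains X Y Z where "v = pt a b c X Y Z"
  using basis3_dual[OF assms] by metis

lemma pt_eq_0_iff:
  assumes "basis3 a b c"
  shows "pt a b c X Y Z = 0 \<longleftrightarrow> X = 0 \<and> Y = 0 \<and> Z = 0"
  using pt_inject[OF assms, of X Y Z 0 0 0] by (simp add: pt_def)

lemma basis3_change:
  assumes "basis3 a b c" "q * t - r * s \<noteq> 0"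
  shows "basis3 (q *s a + r *s b) (s *s a + t *s b) c"
proof -
  have "det (vector [q *s a + r *s b, s *s a + t *s b, c] :: complex ^ 3 ^ 3)
    = (q * t - r * s) * det (vector [a, b, c] :: complex ^ 3 ^ 3)"
    unfolding det_3 vector_3 vector_add_component vector_smult_component by algebra
  then show ?thesis using assms unfolding basis3_def by simp
qed

lemma basis3_affine: "basis3 a b c \<Longrightarrow> basis3 (pt a b c 1 Y Z) b c"
  unfolding basis3_def det_3 vector_3 pt_nth by (erule contrapos_nn) algebra

lemma basis3_rotate: "basis3 a b c \<Longrightarrow> basis3 c a b"
  unfolding basis3_def det_3 vector_3 by (erule contrapos_nn) algebra

lemma basis3_swap: "basis3 a b c \<Longrightarrow> basis3 b a c"
  unfolding basis3_def det_3 vector_3 by (erule contrapos_nn) algebra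

lemma pairing_eq_0_on_basis:
  assumes "basis3 a b c" "pairing m a = 0" "pairing m b = 0" "pairing m c = 0"
  shows "m = 0"
proof -
  have "pairing m v = 0" for v
    using assms pt_cases[OF assms(1), of v] by (metis add_0 mult_zero_right pairing_pt)
  from this[of "axis i 1" for i] have "m $ i = 0" for i
    by (simp add: pairing_def axis_def if_distrib cong: if_cong)
  then show ?thesis by (simp add: vec_eq_iff)
qed

section \<open>Membership of points in curves, lines and singular loci, independently of the
  representative\<close>

lemma ppoint_eq_iff: "ppoint v = ppoint w \<longleftrightarrow> (\<exists>k. k \<noteq> 0 \<and> w = k *s v)"
proof
  assume "ppoint v = ppoint w"
  moreover have "w \<in> ppoint w" unfolding ppoint_def by (rule CollectI, rule exI[of _ 1]) simp
  ultimately show "\<exists>k. k \<noteq> 0 \<and> w = k *s v" unfolding ppoint_def by blast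
next
  assume "\<exists>k. k \<noteq> 0 \<and> w = k *s v"
  then obtain k where k: "k \<noteq> 0" "w = k *s v" by blast
  have "x \<in> ppoint v \<longleftrightarrow> x \<in> ppoint w" for x
  proof
    assume "x \<in> ppoint v"
    then obtain j where "j \<noteq> 0" "x = j *s v" unfolding ppoint_def by blast
    then show "x \<in> ppoint w" unfolding ppoint_def using k
      by (intro CollectI exI[of _ "j / k"]) (simp add: vector_smult_assoc)
  next
    assume "x \<in> ppoint w"
    then obtain j where "j \<noteq> 0" "x = j *s w" unfolding ppoint_def by blast
    then show "x \<in> ppoint v" unfolding ppoint_def using k
      by (intro CollectI exI[of _ "j * k"]) (simp add: vector_smult_assoc)
  qed
  then show "ppoint v = ppoint w" by blast
qed

lemma ppoint_scale: "k \<noteq> 0 \<Longrightarrow> ppoint (k *s v) = ppoint v"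
  using ppoint_eq_iff[of v "k *s v"] by blast

lemma ppoint_pt_scale: "k \<noteq> 0 \<Longrightarrow> ppoint (pt a b c (k * X) (k * Y) (k * Z)) = ppoint (pt a b c X Y Z)"
  unfolding pt_scale by (rule ppoint_scale)

lemma ppoint_in_curve_points_iff:
  assumes "plane_curve d F"
  shows "ppoint v \<in> curve_points F \<longleftrightarrow> v \<noteq> 0 \<and> form_at F v = 0"
proof
  assume "ppoint v \<in> curve_points F"
  then obtain w where w: "ppoint v = ppoint w" "w \<noteq> 0" "form_at F w = 0"
    unfolding curve_points_def by blast
  then obtain k where k: "k \<noteq> 0" "w = k *s v" unfolding ppoint_eq_iff by blast
  then show "v \<noteq> 0 \<and> form_at F v = 0" using w form_at_scale[OF assms, of k v] by auto
qed (auto simp: curve_points_def)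

lemma ppoint_in_pline_iff: "ppoint v \<in> pline m \<longleftrightarrow> v \<noteq> 0 \<and> pairing m v = 0"
proof
  assume "ppoint v \<in> pline m"
  then obtain w where w: "ppoint v = ppoint w" "w \<noteq> 0" "pairing m w = 0"
    unfolding pline_def by blast
  then obtain k where k: "k \<noteq> 0" "w = k *s v" unfolding ppoint_eq_iff by blast
  have "pairing m w = k * pairing m v" unfolding k(2) pairing_def sum_distrib_left by (simp add: mult_ac)
  then show "v \<noteq> 0 \<and> pairing m v = 0" using k w by auto
qed (auto simp: pline_def)

lemma DERIV_form_at_line:
  "((\<lambda>t. form_at F (v + t *s w)) has_field_derivative pairing (gradient F v) w) (at 0)"
proof -
  have "((\<lambda>t. (v + t *s w) $ i) has_field_derivative w $ i) (at 0)" for i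
    by (auto intro!: derivative_eq_intros)
  from form_at_has_field_derivative[OF this, of F] show ?thesis by simp
qed

text \<open>F vanishes on all multiples of v, hence its derivative in the direction v is zero. This
  stands in for Euler's formula.\<close>

lemma euler_zero:
  assumes "plane_curve d F" "form_at F v = 0"
  shows "pairing (gradient F v) v = 0"
proof -
  have "form_at F (v + t *s v) = 0" for t
    using form_at_scale[OF assms(1), of "1 + t" v] assms(2) by (simp add: vector_sadd_rdistrib)
  then show ?thesis using DERIV_form_at_line[of F v v] by (simp add: DERIV_unique[OF _ DERIV_const])
qed

lemma gradient_scale_eq_0:
  assumes "plane_curve d F" "k \<noteq> 0" "gradient F v = 0"
  shows "gradient F (k *s v) = 0"
proof -
  have "pairing (gradient F (k *s v)) w = 0" for w
  proof -
    have "form_at F (k *s v + t *s w) = k ^ d * form_at F (v + t *s ((1 / k) *s w))" for t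
    proof -
      have "k *s v + t *s w = k *s (v + t *s ((1 / k) *s w))"
        using assms(2) unfolding vec_eq_iff vector_add_component vector_smult_component
        by (auto simp: field_simps)
      then show ?thesis by (simp only: form_at_scale[OF assms(1)])
    qed
    moreover have "((\<lambda>t. k ^ d * form_at F (v + t *s ((1 / k) *s w))) has_field_derivative k ^ d * 0) (at 0)"
      using DERIV_cmult[OF DERIV_form_at_line[of F v "(1 / k) *s w"], of "k ^ d"] assms(3)
      by (simp add: pairing_def)
    ultimately show ?thesis using DERIV_form_at_line[of F "k *s v" w] DERIV_unique by fastforce
  qed
  from this[of "axis i 1" for i] show ?thesis
    by (simp add: vec_eq_iff pairing_def axis_def if_distrib cong: if_cong)
qed

lemma ppoint_in_singular_points_iff:
  assumes "plane_curve d F"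
  shows "ppoint v \<in> singular_points F \<longleftrightarrow> v \<noteq> 0 \<and> form_at F v = 0 \<and> gradient F v = 0"
proof
  assume "ppoint v \<in> singular_points F"
  then obtain w where w: "ppoint w = ppoint v" "w \<noteq> 0" "form_at F w = 0" "gradient F w = 0"
    unfolding singular_points_def by auto
  then obtain k where k: "k \<noteq> 0" "v = k *s w" unfolding ppoint_eq_iff by blast
  then show "v \<noteq> 0 \<and> form_at F v = 0 \<and> gradient F v = 0"
    using w gradient_scale_eq_0[OF assms k(1) w(4)] form_at_scale[OF assms, of k w] by simp
qed (auto simp: singular_points_def)

text \<open>The line m is spanned by e and c. If the gradient vanished on c, then by
  \<open>euler_zero\<close> it would vanish on e too, hence be a multiple of m, which is tangency.
  The multiple is read off from w, where m does not vanish.\<close>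

lemma transversal_slice:
  assumes "plane_curve d F" "transversal F m" "m \<noteq> 0" "basis3 e w c"
    and "pairing m e = 0" "pairing m c = 0" "form_at F (e + z *s c) = 0"
  shows "pairing (gradient F (e + z *s c)) c \<noteq> 0"
proof
  assume g0: "pairing (gradient F (e + z *s c)) c = 0"
  define g where "g = gradient F (e + z *s c)"
  have v: "e + z *s c = pt e w c 1 0 z" by (simp add: pt_def)
  have "pairing g e = 0"
    using euler_zero[OF assms(1,7)] g0 unfolding g_def[symmetric] by (simp add: v pairing_pt)
  have mw: "pairing m w \<noteq> 0" using pairing_eq_0_on_basis[OF assms(4)] assms by blast
  have lin: "pairing (g - k *s m) x = pairing g x - k * pairing m x" for k x
    unfolding pairing_def sum_3 by (simp add: algebra_simps)
  have "g - (pairing g w / pairing m w) *s m = 0"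
    using assms(5,6) g0[folded g_def] \<open>pairing g e = 0\<close> mw
    by (intro pairing_eq_0_on_basis[OF assms(4)]) (simp_all add: lin)
  then have "\<exists>k. gradient F (e + z *s c) = k *s m" by (auto simp: g_def)
  moreover have "e + z *s c \<noteq> 0" unfolding v pt_eq_0_iff[OF assms(4)] by simp
  moreover have "pairing m (e + z *s c) = 0" using assms(5,6) by (simp add: v pairing_pt)
  ultimately show False using assms(2,7) unfolding transversal_def by blast
qed

section \<open>Binary forms as functions\<close>

definition polynomial2 :: "(complex \<Rightarrow> complex \<Rightarrow> complex) \<Rightarrow> bool" where
  "polynomial2 b \<longleftrightarrow> (\<exists>q. \<forall>x y. b x y = eval2 q x y)"

lemma polynomial2_const: "polynomial2 (\<lambda>x y. k)"
  unfolding polynomial2_def by (rule exI[of _ "[:[:k:]:]"]) simp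

lemma polynomial2_fst: "polynomial2 (\<lambda>x y. x)"
  unfolding polynomial2_def by (rule exI[of _ "[:[:0, 1:]:]"]) simp

lemma polynomial2_snd: "polynomial2 (\<lambda>x y. y)"
  unfolding polynomial2_def by (rule exI[of _ "[:0, [:1:]:]"]) simp

lemma polynomial2_add: "polynomial2 f \<Longrightarrow> polynomial2 g \<Longrightarrow> polynomial2 (\<lambda>x y. f x y + g x y)"
  unfolding polynomial2_def by (elim exE, rule_tac x = "q + qa" in exI) simp

lemma polynomial2_mult: "polynomial2 f \<Longrightarrow> polynomial2 g \<Longrightarrow> polynomial2 (\<lambda>x y. f x y * g x y)"
  unfolding polynomial2_def by (elim exE, rule_tac x = "q * qa" in exI) simp

lemma polynomial2_power: "polynomial2 f \<Longrightarrow> polynomial2 (\<lambda>x y. f x y ^ n)"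
  by (induction n) (simp_all add: polynomial2_const polynomial2_mult)

lemma polynomial2_sum: "(\<And>i. polynomial2 (f i)) \<Longrightarrow> polynomial2 (\<lambda>x y. \<Sum>i\<in>A. f i x y)"
  by (induction A rule: infinite_finite_induct) (simp_all add: polynomial2_const polynomial2_add)

lemma polynomial2_compose:
  assumes "polynomial2 b" "polynomial2 f" "polynomial2 g"
  shows "polynomial2 (\<lambda>x y. b (f x y) (g x y))"
proof -
  have 1: "polynomial2 (\<lambda>x y. poly p (f x y))" for p
    by (induction p) (simp_all add: polynomial2_const polynomial2_add polynomial2_mult assms)
  have "polynomial2 (\<lambda>x y. eval2 q (f x y) (g x y))" for q
    by (induction q) (simp_all add: polynomial2_const polynomial2_add polynomial2_mult assms 1)
  then show ?thesis using assms(1) unfolding polynomial2_def[of b] by auto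
qed

lemma polynomial2_poly:
  assumes "polynomial2 b"
  obtains r where "\<And>x. poly r x = b (poly p x) (poly q x)"
proof -
  obtain f where "\<And>x y. b x y = eval2 f x y" using assms unfolding polynomial2_def by blast
  moreover have "\<exists>r. \<forall>x. poly r x = eval2 f (poly p x) (poly q x)"
  proof (induction f)
    case (pCons g f)
    then obtain r where r: "\<And>x. poly r x = eval2 f (poly p x) (poly q x)" by blast
    show ?case by (rule exI[of _ "pcompose g p + q * r"]) (simp add: poly_pcompose r)
  qed (auto intro: exI[of _ 0])
  ultimately show ?thesis using that by auto
qed

text \<open>A form is a polynomial function with a scaling law, so products of \<open>lin\<close>,
  sums of shifted \<open>binary_form\<close>s and linear changes of the pencil coordinates remain
  forms without any handling of coefficients.\<close>

definition form2 :: "nat \<Rightarrow> (complex \<Rightarrow> complex \<Rightarrow> complex) \<Rightarrow> bool" where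
  "form2 n b \<longleftrightarrow> polynomial2 b \<and> (\<forall>k x y. b (k * x) (k * y) = k ^ n * b x y)"

lemma form2_scale: "form2 n b \<Longrightarrow> b (k * x) (k * y) = k ^ n * b x y"
  by (simp add: form2_def)

lemma form2_binary_form: "form2 n (binary_form n \<beta>)"
  unfolding form2_def binary_form_scale
  by (auto simp: binary_form_def[abs_def] intro!: polynomial2_sum polynomial2_mult polynomial2_power
      polynomial2_const polynomial2_fst polynomial2_snd)

lemma form2_lin: "form2 1 (lin l)"
  unfolding form2_def lin_def[abs_def]
  by (auto intro!: polynomial2_add polynomial2_mult polynomial2_const polynomial2_fst polynomial2_snd
      simp: algebra_simps)

lemma form2_mult: "form2 n f \<Longrightarrow> form2 m g \<Longrightarrow> form2 (n + m) (\<lambda>x y. f x y * g x y)"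
  unfolding form2_def by (auto simp: power_add intro!: polynomial2_mult)

lemma form2_add: "form2 n f \<Longrightarrow> form2 n g \<Longrightarrow> form2 n (\<lambda>x y. f x y + g x y)"
  unfolding form2_def by (auto simp: distrib_left intro!: polynomial2_add)

lemma form2_0: "form2 n (\<lambda>x y. 0)"
  unfolding form2_def by (simp add: polynomial2_const)

lemma form2_prod_lin: "form2 (length ls) (\<lambda>x y. \<Prod>l\<leftarrow>ls. lin l x y)"
proof (induction ls)
  case (Cons l ls)
  then show ?case using form2_mult[OF form2_lin Cons] by simp
qed (simp add: form2_def polynomial2_const)

lemma form2_linear_change:
  assumes "form2 n f"
  shows "form2 n (\<lambda>x y. f (q * x + s * y) (r * x + t * y))"
proof -
  have "f (q * (k * x) + s * (k * y)) (r * (k * x) + t * (k * y)) = k ^ n * f (q * x + s * y) (r * x + t * y)" for k x y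
    using form2_scale[OF assms, of k "q * x + s * y" "r * x + t * y"] by (simp add: algebra_simps)
  then show ?thesis using assms unfolding form2_def
    by (auto intro!: polynomial2_compose[of f] polynomial2_add polynomial2_mult polynomial2_const polynomial2_fst polynomial2_snd)
qed

section \<open>Elementary transformations and blow-downs on points off the special fibres\<close>

lemma elementary1_image:
  assumes "(s, t) \<noteq> (0, 0)" "(u, v) \<noteq> (0, 0)" "lin l s t \<noteq> 0"
  shows "elementary1 n l `` {hpoint n s t u v} = {hpoint (Suc n) s t (lin l s t * u) v}"
proof -
  have nz: "(lin l s t * u, v) \<noteq> (0, 0)" using assms by auto
  show ?thesis
  proof (intro equalityI subsetI)
    fix y assume "y \<in> elementary1 n l `` {hpoint n s t u v}"
    then have y: "(hpoint n s t u v, y) \<in> elementary1 n l" by simp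
    then obtain u' v' where y': "(u', v') \<noteq> (0, 0)" "y = hpoint (Suc n) s t u' v'"
      using assms(1) by (elim elementary1_imageE) blast
    have "u' * v = lin l s t * u * v'" using y unfolding y'(2) elementary1_iff[OF assms(1,2) y'(1)] .
    then obtain k where "k \<noteq> 0" "u' = k * (lin l s t * u)" "v' = k * v"
      using proportional_pairs[OF nz y'(1)] by blast
    then show "y \<in> {hpoint (Suc n) s t (lin l s t * u) v}"
      using hpoint_scale[of 1 k "Suc n" s t "lin l s t * u" v] y'(2) by simp
  next
    fix y assume "y \<in> {hpoint (Suc n) s t (lin l s t * u) v}"
    then show "y \<in> elementary1 n l `` {hpoint n s t u v}"
      using elementary1_iff[OF assms(1,2) nz, of n l] by simp
  qed
qed

lemma elementary2_image:
  assumes "(s, t) \<noteq> (0, 0)" "(u, v) \<noteq> (0, 0)" "lin l s t \<noteq> 0"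
  shows "elementary2 n l \<beta> `` {hpoint (Suc n) s t u v} =
    {hpoint n s t (u - binary_form (Suc n) \<beta> s t * v) (lin l s t * v)}"
proof -
  define w where "w = u - binary_form (Suc n) \<beta> s t * v"
  have nz: "(w, lin l s t * v) \<noteq> (0, 0)" using assms by (auto simp: w_def)
  have "elementary2 n l \<beta> `` {hpoint (Suc n) s t u v} = {hpoint n s t w (lin l s t * v)}"
  proof (intro equalityI subsetI)
    fix y assume "y \<in> elementary2 n l \<beta> `` {hpoint (Suc n) s t u v}"
    then have y: "(hpoint (Suc n) s t u v, y) \<in> elementary2 n l \<beta>" by simp
    then obtain u' v' where y': "(u', v') \<noteq> (0, 0)" "y = hpoint n s t u' v'"
      using assms(1) by (elim elementary2_imageE) blast
    have "w * v' = lin l s t * v * u'"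
      using y unfolding y'(2) elementary2_iff[OF assms(1,2) y'(1)] w_def .
    then have "u' * (lin l s t * v) = w * v'" by simp
    then obtain k where "k \<noteq> 0" "u' = k * w" "v' = k * (lin l s t * v)"
      using proportional_pairs[OF nz y'(1)] by blast
    then show "y \<in> {hpoint n s t w (lin l s t * v)}"
      using hpoint_scale[of 1 k n s t w "lin l s t * v"] y'(2) by simp
  next
    fix y assume "y \<in> {hpoint n s t w (lin l s t * v)}"
    then show "y \<in> elementary2 n l \<beta> `` {hpoint (Suc n) s t u v}"
      using elementary2_iff[OF assms(1,2) nz, of n l \<beta>] by (simp add: w_def)
  qed
  then show ?thesis unfolding w_def .
qed

lemma elementary1_chain_image:
  assumes "(s, t) \<noteq> (0, 0)" "(u, v) \<noteq> (0, 0)" "\<forall>l\<in>set ls. lin l s t \<noteq> 0"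
  shows "elementary1_chain n ls `` {hpoint n s t u v} =
    {hpoint (n + length ls) s t ((\<Prod>l\<leftarrow>ls. lin l s t) * u) v}"
  using assms(2,3)
proof (induction ls arbitrary: n u)
  case (Cons l ls)
  have "(lin l s t * u, v) \<noteq> (0, 0)" using Cons.prems by auto
  from Cons.IH[OF this] show ?case
    using Cons.prems by (simp add: relcomp_Image elementary1_image[OF assms(1)] mult_ac)
qed simp

text \<open>Composing u -> u - \<beta> v, v -> l v with the rest of the chain gives B' = \<beta> + l
  B. On the fibre l = 0 the second summand vanishes, so B' has the value of the first form there and
  the last conjunct is the condition on the first centre.\<close>

lemma elementary2_chain_image:
  assumes "elementary2_chain l n X r Z"
  shows "r \<le> n \<and> (\<exists>B. form2 n B \<and>
    (\<forall>s t u v. (s, t) \<noteq> (0, 0) \<longrightarrow> (u, v) \<noteq> (0, 0) \<longrightarrow> lin l s t \<noteq> 0 \<longrightarrow>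
       Z `` {hpoint n s t u v} = {hpoint (n - r) s t (u - B s t * v) (lin l s t ^ r * v)}) \<and>
    (r > 0 \<longrightarrow> hpoint n (snd l) (- fst l) (B (snd l) (- fst l)) 1 \<notin> X))"
  using assms
proof (induction rule: elementary2_chain.induct)
  case (1 n X)
  then show ?case by (auto intro!: exI[of _ "\<lambda>s t. 0"] form2_0)
next
  case (2 n \<beta> X r Z)
  then obtain B where B: "r \<le> n" "form2 n B"
    "\<And>s t u v. (s, t) \<noteq> (0, 0) \<Longrightarrow> (u, v) \<noteq> (0, 0) \<Longrightarrow> lin l s t \<noteq> 0 \<Longrightarrow>
       Z `` {hpoint n s t u v} = {hpoint (n - r) s t (u - B s t * v) (lin l s t ^ r * v)}"
    by blast
  define B' where "B' = (\<lambda>s t. binary_form (Suc n) \<beta> s t + lin l s t * B s t)"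
  have "form2 (Suc n) B'" unfolding B'_def
    using form2_mult[OF form2_lin B(2), of l] by (intro form2_add form2_binary_form) simp
  moreover have "(elementary2 n l \<beta> O Z) `` {hpoint (Suc n) s t u v}
      = {hpoint (Suc n - Suc r) s t (u - B' s t * v) (lin l s t ^ Suc r * v)}"
    if st: "(s, t) \<noteq> (0, 0)" "(u, v) \<noteq> (0, 0)" "lin l s t \<noteq> 0" for s t u v
  proof -
    have "(u - binary_form (Suc n) \<beta> s t * v, lin l s t * v) \<noteq> (0, 0)" using st by auto
    from B(3)[OF st(1) this st(3)] show ?thesis
      unfolding relcomp_Image elementary2_image[OF st] by (simp add: B'_def algebra_simps)
  qed
  moreover have "hpoint (Suc n) (snd l) (- fst l) (B' (snd l) (- fst l)) 1 \<notin> X"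
    using 2(1) by (simp add: centre2_def B'_def lin_def)
  ultimately show ?case using B(1) by (intro conjI exI[of _ B']) auto
qed

lemma blowdown_preimage:
  assumes "basis3 a b c" "(X, Y) \<noteq> (0, 0)"
  shows "(blowdown a b c)\<inverse> `` {ppoint (pt a b c X Y Z)} = {hpoint 1 X Y Z 1}"
proof (intro equalityI subsetI)
  fix y assume "y \<in> (blowdown a b c)\<inverse> `` {ppoint (pt a b c X Y Z)}"
  then obtain s t u v where y: "y = hpoint 1 s t u v" "(s, t) \<noteq> (0, 0)" "(u, v) \<noteq> (0, 0)"
    "ppoint (pt a b c X Y Z) = ppoint (pt a b c (s * v) (t * v) u)"
    unfolding blowdown_def pt_def by auto
  then obtain k where k: "k \<noteq> 0" "pt a b c (s * v) (t * v) u = pt a b c (k * X) (k * Y) (k * Z)"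
    unfolding ppoint_eq_iff pt_scale by blast
  then have eq: "s * v = k * X" "t * v = k * Y" "u = k * Z" unfolding pt_inject[OF assms(1)] by auto
  have v: "v \<noteq> 0" using eq k(1) assms(2) by auto
  \<comment> \<open>The factor by which (s, t) exceeds (X, Y); \<open>hpoint_scale\<close> with j
    and k normalizes v to 1.\<close>
  define j where "j = k / v"
  have j: "j \<noteq> 0" "s = j * X" "t = j * Y" "v = k * 1 / j ^ 1"
    using eq v k(1) by (simp_all add: j_def field_simps)
  have "y = hpoint 1 (j * X) (j * Y) (k * Z) (k * 1 / j ^ 1)"
    by (simp only: y(1) j(2-4) eq(3))
  then show "y \<in> {hpoint 1 X Y Z 1}" using hpoint_scale[OF j(1) k(1), of 1 X Y Z 1] by simp
next
  fix y assume y: "y \<in> {hpoint 1 X Y Z 1}"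
  have "(hpoint 1 X Y Z 1, ppoint ((X * 1) *s a + (Y * 1) *s b + Z *s c)) \<in> blowdown a b c"
    unfolding blowdown_def using assms(2) by (intro CollectI exI conjI) (rule refl, simp_all)
  then show "y \<in> (blowdown a b c)\<inverse> `` {ppoint (pt a b c X Y Z)}" using y by (simp add: pt_def)
qed

lemma blowdown_image:
  assumes "(s, t) \<noteq> (0, 0)" "(u, v) \<noteq> (0, 0)"
  shows "blowdown a b c `` {hpoint 1 s t u v} = {ppoint (pt a b c (s * v) (t * v) u)}"
proof (intro equalityI subsetI)
  fix y assume "y \<in> blowdown a b c `` {hpoint 1 s t u v}"
  then obtain s' t' u' v' where y: "y = ppoint (pt a b c (s' * v') (t' * v') u')"
    "hpoint 1 s t u v = hpoint 1 s' t' u' v'"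
    unfolding blowdown_def pt_def by auto
  from y(2) obtain k m where "k \<noteq> 0" "m \<noteq> 0" "s' = k * s" "t' = k * t" "u' = m * u" "v' = m * v / k ^ 1"
    by (rule hpoint_eqD)
  then have "s' * v' = m * (s * v)" "t' * v' = m * (t * v)" "u' = m * u" "m \<noteq> 0" by simp_all
  then show "y \<in> {ppoint (pt a b c (s * v) (t * v) u)}" unfolding y(1) by (simp add: ppoint_pt_scale)
next
  fix y assume y: "y \<in> {ppoint (pt a b c (s * v) (t * v) u)}"
  have "(hpoint 1 s t u v, ppoint ((s * v) *s a + (t * v) *s b + u *s c)) \<in> blowdown a b c"
    unfolding blowdown_def using assms by (intro CollectI exI conjI) (rule refl, simp_all)
  then show "y \<in> blowdown a b c `` {hpoint 1 s t u v}" using y by (simp add: pt_def)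
qed

subsection \<open>The de Jonquieres transformation\<close>

lemma gradient_eq_0_iff:
  assumes "plane_curve e H" "basis3 u v w" "form_at H (pt u v w 1 t z) = 0"
  shows "gradient H (pt u v w 1 t z) = 0 \<longleftrightarrow>
    pairing (gradient H (pt u v w 1 t z)) v = 0 \<and> pairing (gradient H (pt u v w 1 t z)) w = 0"
  using pairing_eq_0_on_basis[OF basis3_affine[OF assms(2)], of "gradient H (pt u v w 1 t z)" t z]
    euler_zero[OF assms(1,3)] by (auto simp: pairing_def)

lemma DERIV_form_at_pt:
  assumes "(f has_field_derivative f') (at x)" "(g has_field_derivative g') (at x)"
  shows "((\<lambda>x. form_at H (pt u v w 1 (f x) (g x))) has_field_derivative
     f' * pairing (gradient H (pt u v w 1 (f x) (g x))) v + g' * pairing (gradient H (pt u v w 1 (f x) (g x))) w) (at x)"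
proof -
  have "((\<lambda>x. pt u v w 1 (f x) (g x) $ i) has_field_derivative pt u v w 0 f' g' $ i) (at x)" for i
    unfolding pt_nth using assms by (auto intro!: derivative_eq_intros)
  from form_at_has_field_derivative[of "\<lambda>x. pt u v w 1 (f x) (g x)", OF this]
  show ?thesis unfolding pairing_pt by simp
qed

lemma infinite_norm_less: "\<delta> > 0 \<Longrightarrow> infinite {x::complex. cmod x < \<delta>}"
  using uncountable_ball[of \<delta> "0::complex"] uncountable_infinite[of "ball (0::complex) \<delta>"]
  by (simp add: ball_def dist_norm)

lemma ex_eval3_pt: "\<exists>Q. \<forall>X Y Z. eval3 Q X Y Z = form_at H (pt u v w X Y Z)"
proof -
  have "polynomial3 (\<lambda>x. form_at H (pt u v w (x $ 1) (x $ 2) (x $ 3)))"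
    unfolding form_at_eq_eval3[of H] pt_nth
    by (intro polynomial3_eval3 polynomial3_add polynomial3_mult polynomial3_const polynomial3_coord)
  then obtain Q where Q: "\<And>x. form_at H (pt u v w (x $ 1) (x $ 2) (x $ 3)) = form_at Q x"
    unfolding polynomial3_def by blast
  have "eval3 Q X Y Z = form_at H (pt u v w X Y Z)" for X Y Z
    using Q[of "vector [X, Y, Z]"] unfolding form_at_eq_eval3[of Q] by (simp add: vector_3)
  then show ?thesis by blast
qed

text \<open>
  P is the line X = 0, so its point of the pencil is (0, 1); the last assumption says that the
  first centre of the second type is off the curve.
\<close>

locale dejonquieres =
  fixes F :: "complex poly poly poly" and d N :: nat
    and a b c a1 b1 c1 :: "complex ^ 3"
    and L B :: "complex \<Rightarrow> complex \<Rightarrow> complex"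
  assumes curve: "plane_curve d F" and d_ge_2: "d \<ge> 2"
    and Fc: "form_at F c \<noteq> 0"
    and basis: "basis3 a b c" and basis1: "basis3 a1 b1 c1"
    and L_form: "form2 N L" and B_form: "form2 (Suc N) B" and N_pos: "N \<ge> 1"
    and L01: "L 0 1 \<noteq> 0"
    and centre: "form_at F (pt a b c 0 (L 0 1) (B 0 1)) \<noteq> 0"
begin

text \<open>The scalar \<gamma> allows for every generator of the ideal at once, since generators
  agree up to a constant. The degree is left open; it plays its part only through
  homogeneity.\<close>

definition transform :: "complex poly poly poly \<Rightarrow> complex \<Rightarrow> bool" where
  "transform G \<gamma> \<longleftrightarrow> \<gamma> \<noteq> 0 \<and> (\<exists>e. plane_curve e G) \<and>
     (\<forall>X Y Z. form_at G (pt a1 b1 c1 X Y Z) =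
        \<gamma> * form_at F (pt a b c (L X Y * X) (L X Y * Y) (X ^ N * Z + B X Y)))"

lemma transformD:
  "transform G \<gamma> \<Longrightarrow> form_at G (pt a1 b1 c1 X Y Z) =
        \<gamma> * form_at F (pt a b c (L X Y * X) (L X Y * Y) (X ^ N * Z + B X Y))"
  unfolding transform_def by blast

lemma form_at_pt_scale: "form_at F (pt a b c (k * X) (k * Y) (k * Z)) = k ^ d * form_at F (pt a b c X Y Z)"
  unfolding pt_scale form_at_scale[OF curve] ..

text \<open>Z = L z - B inverts the map over X = 1: all three arguments of F then contain the factor
  L, which comes out as L^d.\<close>

lemma transform_chart:
  assumes "transform G \<gamma>"
  shows "form_at G (pt a1 b1 c1 1 t (L 1 t * z - B 1 t)) = \<gamma> * L 1 t ^ d * form_at F (pt a b c 1 t z)"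
  unfolding transformD[OF assms] using form_at_pt_scale[of "L 1 t" 1 t z] by simp

lemma L0: "L 0 y = y ^ N * L 0 1" and B0: "B 0 y = y ^ Suc N * B 0 1"
  using form2_scale[OF L_form, of y 0 1] form2_scale[OF B_form, of y 0 1] by simp_all

text \<open>On X = 0 the term X^N Z disappears and L, B become powers of Y, so F is evaluated at
  multiples of the first centre. Hence (0, 0, 1) is the only point of G on this line.\<close>

lemma transform_at_infinity:
  assumes "transform G \<gamma>"
  shows "form_at G (pt a1 b1 c1 0 Y Z) = \<gamma> * (Y ^ Suc N) ^ d * form_at F (pt a b c 0 (L 0 1) (B 0 1))"
proof -
  have "form_at G (pt a1 b1 c1 0 Y Z) =
      \<gamma> * form_at F (pt a b c (Y ^ Suc N * 0) (Y ^ Suc N * L 0 1) (Y ^ Suc N * B 0 1))"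
    unfolding transformD[OF assms] L0[of Y] B0[of Y] using N_pos by (simp add: mult_ac power_0_left)
  then show ?thesis unfolding form_at_pt_scale by simp
qed

text \<open>Where L vanishes, F is evaluated on multiples of c only, so the line carries the single
  point Z = -B, counted d times.\<close>

lemma transform_at_zero_of_L:
  assumes "transform G \<gamma>" "L 1 t = 0"
  shows "form_at G (pt a1 b1 c1 1 t Z) = \<gamma> * (Z + B 1 t) ^ d * form_at F c"
proof -
  have "pt a b c 0 0 w = w *s c" for w by (simp add: pt_def)
  then have "form_at F (pt a b c 0 0 w) = w ^ d * form_at F c" for w by (simp only: form_at_scale[OF curve])
  then show ?thesis unfolding transformD[OF assms(1)] assms(2) by simp
qed

lemma ex_transform: "\<exists>G. transform G 1"
proof -
  obtain e1 e2 e3 where e: "\<And>X Y Z. pairing e1 (pt a1 b1 c1 X Y Z) = X"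
    "\<And>X Y Z. pairing e2 (pt a1 b1 c1 X Y Z) = Y" "\<And>X Y Z. pairing e3 (pt a1 b1 c1 X Y Z) = Z"
    using basis3_dual[OF basis1] by metis
  have form_polynomial3: "polynomial3 (\<lambda>v. f (pairing e1 v) (pairing e2 v))" if ff: "form2 n f" for n f
  proof -
    obtain q where "\<forall>x y. f x y = eval2 q x y" using ff unfolding form2_def polynomial2_def by blast
    then show ?thesis using polynomial3_eval2[OF polynomial3_pairing polynomial3_pairing, of q e2 e1] by simp
  qed
  note LB = form_polynomial3[OF L_form] form_polynomial3[OF B_form]
  define w where "w v = pt a b c (L (pairing e1 v) (pairing e2 v) * pairing e1 v)
    (L (pairing e1 v) (pairing e2 v) * pairing e2 v)
    (pairing e1 v ^ N * pairing e3 v + B (pairing e1 v) (pairing e2 v))" for v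
  have "polynomial3 (\<lambda>v. form_at F (w v))"
    unfolding form_at_eq_eval3 w_def pt_nth
    by (intro polynomial3_eval3 polynomial3_add polynomial3_mult polynomial3_const LB polynomial3_pairing polynomial3_power)
  then obtain G where G: "\<And>v. form_at G v = form_at F (w v)" unfolding polynomial3_def by metis
  have val: "form_at G (pt a1 b1 c1 X Y Z) =
        form_at F (pt a b c (L X Y * X) (L X Y * Y) (X ^ N * Z + B X Y))" for X Y Z
    unfolding G w_def e ..
  have "plane_curve (Suc N * d) G"
  proof (rule plane_curveI)
    show "G \<noteq> 0"
    proof
      assume "G = 0"
      \<comment> \<open>At (0, 1, 0) the new equation takes the value of F at the first
        centre.\<close>
      then have "form_at G (pt a1 b1 c1 0 1 0) = 0" unfolding form_at_eq_eval3 by simp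
      then show False unfolding val using centre N_pos by simp
    qed
    fix v
    obtain X Y Z where v: "v = pt a1 b1 c1 X Y Z" using pt_cases[OF basis1] .
    have "form_at G (2 *s v) = form_at F (pt a b c (2 ^ Suc N * (L X Y * X)) (2 ^ Suc N * (L X Y * Y))
        (2 ^ Suc N * (X ^ N * Z + B X Y)))"
      unfolding v pt_scale[symmetric] val form2_scale[OF L_form] form2_scale[OF B_form]
      by (simp add: power_mult_distrib algebra_simps)
    then show "form_at G (2 *s v) = 2 ^ (Suc N * d) * form_at G v"
      unfolding form_at_pt_scale power_mult unfolding v val .
  qed
  then show ?thesis unfolding transform_def using val by (intro exI[of _ G]) auto
qed

lemma ex_poly_L: "\<exists>p. \<forall>x. poly p x = L 1 (m + x)" and ex_poly_B: "\<exists>p. \<forall>x. poly p x = B 1 (m + x)"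
proof -
  have "\<exists>p. \<forall>x. poly p x = f 1 (m + x)" if "form2 n f" for f n
  proof -
    have "polynomial2 f" using that by (simp add: form2_def)
    then obtain p where "\<And>x. poly p x = f (poly [:1:] x) (poly [:m, 1:] x)"
      using polynomial2_poly[of f "[:1:]" "[:m, 1:]"] by blast
    then show ?thesis by (intro exI[of _ p]) simp
  qed
  then show "\<exists>p. \<forall>x. poly p x = L 1 (m + x)" "\<exists>p. \<forall>x. poly p x = B 1 (m + x)"
    using L_form B_form by blast+
qed

lemma ex_poly_L2: "\<exists>p. \<forall>x. poly p x = L x 1" and ex_poly_B2: "\<exists>p. \<forall>x. poly p x = B x 1"
proof -
  have "\<exists>p. \<forall>x. poly p x = f x 1" if "form2 n f" for f n
  proof -
    have "polynomial2 f" using that by (simp add: form2_def)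
    then obtain p where "\<And>x. poly p x = f (poly [:0, 1:] x) (poly [:1:] x)"
      using polynomial2_poly[of f "[:0, 1:]" "[:1:]"] by blast
    then show ?thesis by (intro exI[of _ p]) simp
  qed
  then show "\<exists>p. \<forall>x. poly p x = L x 1" "\<exists>p. \<forall>x. poly p x = B x 1"
    using L_form B_form by blast+
qed

text \<open>Differentiating \<open>transform_chart\<close> in z and in t gives a triangular linear
  relation between the partial derivatives of F and of G, with diagonal entries nonzero when L is.
  The remaining radial direction is covered by \<open>euler_zero\<close>.\<close>

lemma transform_singular_iff:
  assumes G: "transform G \<gamma>" and L: "L 1 t \<noteq> 0"
  shows "ppoint (pt a b c 1 t z) \<in> singular_points F \<longleftrightarrow>
    ppoint (pt a1 b1 c1 1 t (L 1 t * z - B 1 t)) \<in> singular_points G"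
proof -
  obtain e where e: "plane_curve e G" and \<gamma>: "\<gamma> \<noteq> 0" using G unfolding transform_def by blast
  obtain p where p: "\<And>x. poly p x = L 1 x" using ex_poly_L[of 0] by auto
  obtain q where q: "\<And>x. poly q x = B 1 x" using ex_poly_B[of 0] by auto
  define v where "v = pt a b c 1 t z"
  define w where "w = pt a1 b1 c1 1 t (L 1 t * z - B 1 t)"
  have nz: "v \<noteq> 0" "w \<noteq> 0" unfolding v_def w_def pt_eq_0_iff[OF basis] pt_eq_0_iff[OF basis1] by simp_all
  have zero: "form_at G w = 0 \<longleftrightarrow> form_at F v = 0"
    using transform_chart[OF G, of t z] \<gamma> L by (simp add: v_def w_def)
  have "gradient F v = 0 \<longleftrightarrow> gradient G w = 0" if F0: "form_at F v = 0"
  proof -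
    have "((\<lambda>z. \<gamma> * L 1 t ^ d * form_at F (pt a b c 1 t z)) has_field_derivative
        \<gamma> * L 1 t ^ d * (0 * pairing (gradient F v) b + 1 * pairing (gradient F v) c)) (at z)"
      unfolding v_def by (intro DERIV_cmult DERIV_form_at_pt DERIV_const DERIV_ident)
    moreover have "((\<lambda>z. form_at G (pt a1 b1 c1 1 t (L 1 t * z - B 1 t))) has_field_derivative
        0 * pairing (gradient G w) b1 + L 1 t * pairing (gradient G w) c1) (at z)"
      unfolding w_def by (intro DERIV_form_at_pt) (auto intro!: derivative_eq_intros)
    ultimately have 1: "L 1 t * pairing (gradient G w) c1 = \<gamma> * L 1 t ^ d * pairing (gradient F v) c"
      unfolding transform_chart[OF G] using DERIV_unique by fastforce
    \<comment> \<open>The factor L^d varies with t as well, but its derivative is multiplied by F(v)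
      = 0.\<close>
    have "((\<lambda>x. \<gamma> * poly p x ^ d * form_at F (pt a b c 1 x z)) has_field_derivative
        poly (pderiv (smult \<gamma> (p ^ d))) t * form_at F v + (1 * pairing (gradient F v) b + 0 * pairing (gradient F v) c)
        * (\<gamma> * poly p t ^ d)) (at t)"
      using DERIV_mult[OF poly_DERIV[of "smult \<gamma> (p ^ d)" t]
          DERIV_form_at_pt[OF DERIV_ident DERIV_const[of z], of F a b c]]
      unfolding v_def by (simp add: poly_power)
    moreover have "((\<lambda>x. form_at G (pt a1 b1 c1 1 x (poly p x * z - poly q x))) has_field_derivative
        1 * pairing (gradient G w) b1 + (poly (pderiv p) t * z - poly (pderiv q) t) * pairing (gradient G w) c1) (at t)"
      unfolding w_def p[symmetric] q[symmetric]
      by (intro DERIV_form_at_pt) (auto intro!: derivative_eq_intros)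
    moreover have "form_at G (pt a1 b1 c1 1 x (poly p x * z - poly q x)) = \<gamma> * poly p x ^ d * form_at F (pt a b c 1 x z)" for x
      unfolding p q transform_chart[OF G] ..
    ultimately have 2: "pairing (gradient G w) b1 + (poly (pderiv p) t * z - poly (pderiv q) t) * pairing (gradient G w) c1
      = pairing (gradient F v) b * (\<gamma> * L 1 t ^ d)"
      using F0 DERIV_unique p[of t] by fastforce
    have c: "pairing (gradient G w) c1 = 0 \<longleftrightarrow> pairing (gradient F v) c = 0"
      using 1 L \<gamma> by (metis mult_eq_0_iff power_not_zero)
    moreover have "pairing (gradient G w) b1 = 0 \<longleftrightarrow> pairing (gradient F v) b = 0" if "pairing (gradient F v) c = 0"
      using 2 c that L \<gamma> by (auto simp: mult_eq_0_iff)
    ultimately show ?thesis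
      using gradient_eq_0_iff[OF curve basis, of t z] gradient_eq_0_iff[OF e basis1, of t "L 1 t * z - B 1 t"] F0 zero
      unfolding v_def w_def by blast
  qed
  then show ?thesis
    unfolding ppoint_in_singular_points_iff[OF curve] ppoint_in_singular_points_iff[OF e] v_def[symmetric] w_def[symmetric]
    using nz zero by blast
qed

text \<open>The map h keeps the first coordinate and is affine in the second with slope L, so it is
  biholomorphic from the set U where L is nonzero onto the same U. The two local equations differ by
  the nowhere zero function \<gamma> L^d.\<close>

lemma transform_same_singularity:
  assumes G: "transform G \<gamma>" and Lt: "L 1 t \<noteq> 0"
  shows "same_singularity F (ppoint (pt a b c 1 t z)) G (ppoint (pt a1 b1 c1 1 t (L 1 t * z - B 1 t)))"
proof -
  obtain p where p: "\<And>x. poly p x = L 1 (t + x)" using ex_poly_L by auto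
  obtain q where q: "\<And>x. poly q x = B 1 (t + x)" using ex_poly_B by auto
  define z' where "z' = L 1 t * z - B 1 t"
  define f where "f = chart F (pt a b c 1 t z) b c"
  define g where "g = chart G (pt a1 b1 c1 1 t z') b1 c1"
  define U where "U = {w::complex \<times> complex. poly p (fst w) \<noteq> 0}"
  define h where "h w = (fst w, poly p (fst w) * (z + snd w) - poly q (fst w) - z')" for w :: "complex \<times> complex"
  define k where "k w = (fst w, (snd w + z' + poly q (fst w)) / poly p (fst w) - z)" for w :: "complex \<times> complex"
  have \<gamma>: "\<gamma> \<noteq> 0" using G unfolding transform_def by blast
  have f: "eval2 f x y = form_at F (pt a b c 1 (t + x) (z + y))" for x y
    unfolding f_def eval2_chart pt_def by (simp add: vector_sadd_rdistrib add_ac)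
  have g: "eval2 g x y = form_at G (pt a1 b1 c1 1 (t + x) (z' + y))" for x y
    unfolding g_def eval2_chart pt_def by (simp add: vector_sadd_rdistrib add_ac)
  have poly_deriv: "((\<lambda>w. poly r (fst w)) has_derivative (\<lambda>v. poly (pderiv r) (fst w) * fst v)) (at w)"
    for r :: "complex poly" and w :: "complex \<times> complex"
    using has_derivative_compose[OF has_derivative_fst[OF has_derivative_ident] poly_DERIV[of r "fst w", unfolded has_field_derivative_def]]
    by simp
  have "open U" unfolding U_def by (intro open_Collect_neq continuous_intros)
  have zero: "(0, 0) \<in> U" using Lt p[of 0] by (simp add: U_def)
  have h0: "h (0, 0) = (0, 0)" using p[of 0] q[of 0] by (simp add: h_def z'_def)
  have kh: "k (h w) = w" if "w \<in> U" for w using that by (cases w) (simp add: h_def k_def U_def)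
  have hk: "h (k w) = w" if "w \<in> U" for w using that by (cases w) (simp add: h_def k_def U_def)
  have "homeomorphism U U h k"
  proof (rule homeomorphismI)
    show "continuous_on U h" unfolding h_def by (intro continuous_intros)
    show "continuous_on U k" unfolding k_def U_def by (intro continuous_intros) auto
  qed (use kh hk in \<open>auto simp: U_def h_def k_def\<close>)
  moreover have "holomorphic2 h U"
    unfolding holomorphic2_def
  proof
    fix w assume "w \<in> U"
    define D where "D v = (fst v, poly (pderiv p) (fst w) * fst v * (z + snd w) + poly p (fst w) * snd v
        - poly (pderiv q) (fst w) * fst v)" for v :: "complex \<times> complex"
    have "(h has_derivative D) (at w)"
      unfolding h_def[abs_def] D_def[abs_def]
      by (auto intro!: derivative_eq_intros poly_deriv simp: algebra_simps)
    moreover have "\<forall>c w. D (c * fst w, c * snd w) = (c * fst (D w), c * snd (D w))"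
      by (simp add: D_def algebra_simps)
    ultimately show "\<exists>D. (h has_derivative D) (at w) \<and> (\<forall>c w. D (c * fst w, c * snd w) = (c * fst (D w), c * snd (D w)))"
      by blast
  qed
  moreover have "holomorphic2 k U"
    unfolding holomorphic2_def
  proof
    fix w assume w: "w \<in> U"
    define s where "s = snd w + z' + poly q (fst w)"
    define D where "D v = (fst v, (snd v + poly (pderiv q) (fst w) * fst v) / poly p (fst w)
        - s * (poly (pderiv p) (fst w) * fst v) / (poly p (fst w) * poly p (fst w)))" for v :: "complex \<times> complex"
    have "(k has_derivative D) (at w)"
      unfolding k_def[abs_def] D_def[abs_def] s_def
      by (rule derivative_eq_intros poly_deriv refl | use w in \<open>simp add: U_def divide_simps algebra_simps\<close>)+
    moreover have "\<forall>c w. D (c * fst w, c * snd w) = (c * fst (D w), c * snd (D w))"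
      by (simp add: D_def algebra_simps add_divide_distrib diff_divide_distrib)
    ultimately show "\<exists>D. (k has_derivative D) (at w) \<and> (\<forall>c w. D (c * fst w, c * snd w) = (c * fst (D w), c * snd (D w)))"
      by blast
  qed
  moreover have "\<forall>x y. (x, y) \<in> U \<longrightarrow>
     (ev2 (\<lambda>c. c) f x y = 0 \<longleftrightarrow> ev2 (\<lambda>c. c) g (fst (h (x, y))) (snd (h (x, y))) = 0)"
  proof (intro allI impI)
    fix x y assume "(x, y) \<in> U"
    then have nz: "L 1 (t + x) \<noteq> 0" by (simp add: U_def p)
    have "eval2 g (fst (h (x, y))) (snd (h (x, y))) = \<gamma> * L 1 (t + x) ^ d * eval2 f x y"
      unfolding f transform_chart[OF G, symmetric] g by (simp add: h_def p q)
    then show "ev2 (\<lambda>c. c) f x y = 0 \<longleftrightarrow> ev2 (\<lambda>c. c) g (fst (h (x, y))) (snd (h (x, y))) = 0"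
      unfolding ev2_eq_eval2 using nz \<gamma> by simp
  qed
  ultimately have "analytically_equivalent f g"
    unfolding analytically_equivalent_def using \<open>open U\<close> zero h0 by blast
  then show ?thesis unfolding same_singularity_def f_def g_def z'_def
    using local_equation_chart basis3_affine[OF basis] basis3_affine[OF basis1] by blast
qed

text \<open>All lines through c near the parameter m are treated together: the branches of F are z =
  \<rho>_j(x), and those of G are y = L \<rho>_j - (B - B(m)). Their differences are L (\<rho>_i -
  \<rho>_j), of order exactly n because the \<rho>_j(0) are distinct.\<close>

lemma transform_tacnode:
  assumes G: "transform G \<gamma>" and n: "n \<ge> 1"
    and l: "\<And>x. L 1 (m + x) = x ^ n * poly l x" "poly l 0 \<noteq> 0"
    and trans: "\<forall>z. form_at F (pt a b c 1 m z) = 0 \<longrightarrow> pairing (gradient F (pt a b c 1 m z)) c \<noteq> 0"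
  shows "tacnode_at d (n - 1) G (ppoint (pt a1 b1 c1 1 m (- B 1 m)))"
    "type_at G (ppoint (pt a1 b1 c1 1 m (- B 1 m))) (replicate n d)"
proof -
  obtain q where q: "\<And>x. poly q x = B 1 (m + x)" using ex_poly_B by auto
  define f where "f = chart G (pt a1 b1 c1 1 m (- B 1 m)) b1 c1"
  define K where "K = chart F (pt a b c 1 m 0) b c"
  define p where "p = monom 1 n * l"
  define r where "r = q - [:B 1 m:]"
  have \<gamma>: "\<gamma> \<noteq> 0" using G unfolding transform_def by blast
  have slice: "pt a b c 1 m 0 + z *s c = pt a b c 1 m z" for z by (simp add: pt_def)
  have Lp: "L 1 (m + x) = poly p x" for x by (simp add: l p_def poly_monom)
  have fK: "f = smult [:\<gamma>:] (homogenize d K [:p:] [:r, 1:])"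
  proof (rule eval2_eqI[OF infinite_UNIV_char_0])
    fix x y
    have "eval2 f x y = form_at G (pt a1 b1 c1 1 (m + x) (y - B 1 m))"
      unfolding f_def eval2_chart by (simp add: pt_def vector_sadd_rdistrib vector_sub_rdistrib algebra_simps)
    also have "\<dots> = \<gamma> * form_at F (pt a b c (poly p x) (poly p x * (m + x)) (y + poly r x))"
      unfolding transformD[OF G] Lp by (simp add: r_def q algebra_simps)
    also have "pt a b c (poly p x) (poly p x * (m + x)) (y + poly r x)
        = poly p x *s (pt a b c 1 m 0 + x *s b) + (y + poly r x) *s c"
      by (simp add: vec_eq_iff pt_nth algebra_simps)
    finally show "eval2 f x y = eval2 (smult [:\<gamma>:] (homogenize d K [:p:] [:r, 1:])) x y"
      by (simp add: K_def chart_homogenize[OF curve] add.commute)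
  qed
  obtain \<rho> where \<rho>: "fpsp K = smult (fps_const (form_at F c)) (\<Prod>j<d. [:- \<rho> j, 1:])"
    "inj_on (\<lambda>j. fps_nth (\<rho> j) 0) {..<d}"
    using slice_factorization[OF curve Fc, of "pt a b c 1 m 0" b] trans unfolding slice K_def by metis
  \<comment> \<open>The sign of r reflects that the chart is centred at Z = -B(m); r vanishes at 0,
    so the branches pass through the origin.\<close>
  define \<phi> where "\<phi> j = \<rho> j * fps_of_poly p - fps_of_poly r" for j
  have "fpsp f = smult (fps_const \<gamma>) (homogenize d (fpsp K) [:fps_of_poly p:] [:fps_of_poly r, 1:])"
    unfolding fK fpsp_smult fpsp_homogenize by (simp add: fps_of_poly_const)
  also have "\<dots> = [:fps_const (\<gamma> * form_at F c):] * (\<Prod>j<d. [:- \<phi> j, 1:])"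
    unfolding \<rho>(1) homogenize_prod \<phi>_def by (simp flip: fps_const_mult)
  finally have gg: "graph_germ d (fps_const (\<gamma> * form_at F c)) \<phi> f"
    unfolding graph_germ_def using \<gamma> Fc by simp
  have coeff: "fps_nth (\<phi> j) i = (if i < n then 0 else poly l 0 * fps_nth (\<rho> j) 0) - coeff r i"
    if "i \<le> n" for i j
  proof -
    have "\<phi> j = fps_X ^ n * (\<rho> j * fps_of_poly l) - fps_of_poly r"
      unfolding \<phi>_def p_def fps_of_poly_mult fps_of_poly_monom' by (simp only: mult_ac)
    then show ?thesis using that by (simp add: fps_X_power_mult_nth poly_0_coeff_0 mult.commute)
  qed
  have "coeff r 0 = 0" using q[of 0] by (simp add: r_def poly_0_coeff_0)
  then have 0: "\<forall>j<d. fps_nth (\<phi> j) 0 = 0" using coeff[of 0] n by simp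
  have agree: "\<forall>i<d. \<forall>j<d. \<forall>k\<le>n - 1. fps_nth (\<phi> i) k = fps_nth (\<phi> j) k"
    using n by (intro allI impI) (subst (1 2) coeff, auto)
  have differ: "inj_on (\<lambda>j. fps_nth (\<phi> j) (Suc (n - 1))) {..<d}"
    using \<rho>(2) l(2) n by (simp add: inj_on_def coeff)
  have eq: "local_equation G (ppoint (pt a1 b1 c1 1 m (- B 1 m))) f"
    unfolding f_def by (intro local_equation_chart basis3_affine basis1)
  show "tacnode_at d (n - 1) G (ppoint (pt a1 b1 c1 1 m (- B 1 m)))"
    unfolding tacnode_at_def using eq graph_germ_tacnode[OF gg 0 agree differ] by blast
  show "type_at G (ppoint (pt a1 b1 c1 1 m (- B 1 m))) (replicate n d)"
    unfolding type_at_def using eq graph_germ_has_type[OF gg d_ge_2 0 agree differ] n by auto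
qed

text \<open>In the direction \<open>None\<close>, (X, Y, Z) = (x y, y, 1), every argument of F
  contains y^N, which gives the multiplicity d N. What remains splits into factors x^N + y w_j with
  w_j a unit, that is into graphs y = -x^N / w_j; these agree below order N and differ at order
  N.\<close>

lemma transform_blow_down:
  assumes G: "transform G \<gamma>"
    and trans: "\<forall>z. form_at F (pt a b c 0 1 z) = 0 \<longrightarrow> pairing (gradient F (pt a b c 0 1 z)) c \<noteq> 0"
  shows "blow_down_of_tacnode_at d (N - 1) G (ppoint c1)"
    "type_at G (ppoint c1) (d * N # replicate N d)"
proof -
  obtain p where p: "\<And>x. poly p x = L x 1" using ex_poly_L2 by auto
  obtain q where q: "\<And>x. poly q x = B x 1" using ex_poly_B2 by auto
  define f where "f = chart G c1 a1 b1"
  \<comment> \<open>Here x is the pencil coordinate X / Y, so that x = 0 is the line P and its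
    transversality provides the branches.\<close>
  define K where "K = chart F b a c"
  define g where "g = smult [:\<gamma>:] (homogenize d K [:0, p:] [:monom 1 N, q:])"
  have \<gamma>: "\<gamma> \<noteq> 0" using G unfolding transform_def by blast
  have slice: "b + z *s c = pt a b c 0 1 z" for z by (simp add: pt_def)
  have g: "eval2 g x y = \<gamma> * form_at F (pt a b c (y * poly p x * x) (y * poly p x) (x ^ N + y * poly q x))" for x y
  proof -
    have "pt a b c (y * poly p x * x) (y * poly p x) (x ^ N + y * poly q x)
        = (y * poly p x) *s (b + x *s a) + (x ^ N + y * poly q x) *s c"
      by (simp add: vec_eq_iff pt_nth algebra_simps)
    then show ?thesis by (simp add: g_def K_def chart_homogenize[OF curve] poly_monom)
  qed
  define e where "e = ev2 (\<lambda>a. [:[:a:]:]) f [:0, [:0, 1:]:] [:0, 1:]"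
  have e: "e = [:0, 1:] ^ (d * N) * g"
  proof (rule eval2_eqI[OF infinite_UNIV_char_0])
    fix x y
    have "eval2 e x y = form_at G (pt a1 b1 c1 (y * x) (y * 1) 1)"
      unfolding e_def eval2_ev2 f_def eval2_chart pt_def by (simp add: algebra_simps)
    also have "\<dots> = \<gamma> * form_at F (pt a b c (y ^ N * (y * poly p x * x)) (y ^ N * (y * poly p x)) (y ^ N * (x ^ N + y * poly q x)))"
      unfolding transformD[OF G] form2_scale[OF L_form] form2_scale[OF B_form] p q
      by (simp add: power_mult_distrib algebra_simps)
    also have "\<dots> = y ^ (d * N) * eval2 g x y"
      unfolding form_at_pt_scale g by (simp add: power_mult[symmetric] mult.commute)
    finally show "eval2 e x y = eval2 ([:0, 1:] ^ (d * N) * g) x y"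
      by (simp add: poly_power)
  qed
  have coeff_e: "coeff (coeff e k) i = (if k < d * N then 0 else coeff (coeff g (k - d * N)) i)" for k i
  proof -
    have "[:0, 1:] ^ (d * N) = (monom 1 (d * N) :: complex poly poly)" by (simp add: monom_altdef)
    then show ?thesis unfolding e by (simp add: coeff_monom_mult)
  qed
  have coeff_f: "coeff (coeff f j) i = coeff (coeff e (i + j)) i" for i j
    unfolding e_def coeff_blow_up_None by simp
  \<comment> \<open>The intersection with the exceptional line y = 0; read back through
    \<open>coeff_f\<close>, it says that the degree-(d N) part of f is a multiple of x^(d
    N).\<close>
  have g0: "coeff g 0 = monom (\<gamma> * form_at F c) (d * N)"
  proof (rule poly_eq_on_infinite[OF infinite_UNIV_char_0])
    fix x
    have "poly (coeff g 0) x = eval2 g x 0" by (simp add: poly_0_coeff_0)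
    also have "\<dots> = \<gamma> * (x ^ N) ^ d * form_at F c"
      unfolding g using form_at_pt_scale[of "x ^ N" 0 0 1] by (simp add: pt_def)
    finally show "poly (coeff g 0) x = poly (monom (\<gamma> * form_at F c) (d * N)) x"
      by (simp add: poly_monom power_mult[symmetric] mult.commute)
  qed
  have fm: "coeff (coeff f 0) (d * N) \<noteq> 0" using \<gamma> Fc by (simp add: coeff_f coeff_e g0)
  have mult: "mult_at_0 f = d * N"
    by (rule mult_at_0_eqI[OF _ fm]) (simp_all add: coeff_f coeff_e)
  have None: "proper_germ f None = g"
    by (rule proper_germ_None) (simp only: mult e[unfolded e_def])
  have Some: "coeff (coeff (proper_germ f (Some k)) 0) 0 \<noteq> 0" for k
  proof -
    have "coeff (coeff f j) (d * N - j) = 0" if "0 < j" "j \<le> d * N" for j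
      using that by (simp add: coeff_f coeff_e g0)
    then show ?thesis using fm coeff_proper_germ_Some_0[of f k] unfolding mult by simp
  qed
  obtain \<rho> where \<rho>: "fpsp K = smult (fps_const (form_at F c)) (\<Prod>j<d. [:- \<rho> j, 1:])"
    "inj_on (\<lambda>j. fps_nth (\<rho> j) 0) {..<d}" "\<forall>j<d. form_at F (pt a b c 0 1 (fps_nth (\<rho> j) 0)) = 0"
    using slice_factorization[OF curve Fc, of b a] trans unfolding slice K_def by metis
  define w where "w j = fps_of_poly q - \<rho> j * fps_of_poly p" for j
  define u where "u = fps_const (\<gamma> * form_at F c) * (\<Prod>j<d. w j)"
  define \<phi> where "\<phi> j = - (fps_X ^ N * inverse (w j))" for j
  have w0: "fps_nth (w j) 0 = B 0 1 - fps_nth (\<rho> j) 0 * L 0 1" for j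
    using p[of 0] q[of 0] by (simp add: w_def poly_0_coeff_0)
  \<comment> \<open>A zero would put the first centre on the curve, at the intersection point of F
    and P with coordinate \<rho>_j(0).\<close>
  have w_nz: "fps_nth (w j) 0 \<noteq> 0" if "j < d" for j
  proof
    assume "fps_nth (w j) 0 = 0"
    then have "pt a b c 0 (L 0 1) (B 0 1) = pt a b c (L 0 1 * 0) (L 0 1 * 1) (L 0 1 * fps_nth (\<rho> j) 0)"
      by (simp add: w0 mult.commute)
    then have "form_at F (pt a b c 0 (L 0 1) (B 0 1)) = L 0 1 ^ d * form_at F (pt a b c 0 1 (fps_nth (\<rho> j) 0))"
      by (simp only: form_at_pt_scale)
    then show False using centre \<rho>(3) that by simp
  qed
  have "fpsp g = smult (fps_const \<gamma>) (homogenize d (fpsp K) [:0, fps_of_poly p:] [:fps_X ^ N, fps_of_poly q:])"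
    unfolding g_def fpsp_smult fpsp_homogenize by (simp add: fps_of_poly_const fps_of_poly_monom')
  also have "\<dots> = smult (fps_const (\<gamma> * form_at F c)) (\<Prod>j<d. [:fps_X ^ N, w j:])"
    unfolding \<rho>(1) homogenize_prod w_def by (simp flip: fps_const_mult)
  also have "(\<Prod>j<d. [:fps_X ^ N, w j:]) = (\<Prod>j<d. [:w j:] * [:- \<phi> j, 1:])"
  proof (intro prod.cong refl)
    fix j assume "j \<in> {..<d}"
    then have "w j * inverse (w j) = 1" using w_nz by (intro inverse_mult_eq_1') simp
    moreover have "w j * (fps_X ^ N * inverse (w j)) = fps_X ^ N * (w j * inverse (w j))" by (simp only: mult_ac)
    ultimately have "w j * (fps_X ^ N * inverse (w j)) = fps_X ^ N" by (simp only: mult_1_right)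
    moreover have "[:w j:] * [:- \<phi> j, 1:] = [:w j * (fps_X ^ N * inverse (w j)), w j:]" by (simp add: \<phi>_def)
    ultimately show "[:fps_X ^ N, w j:] = [:w j:] * [:- \<phi> j, 1:]" by (simp only:)
  qed
  also have "\<dots> = [:\<Prod>j<d. w j:] * (\<Prod>j<d. [:- \<phi> j, 1:])"
  proof -
    have "(\<Prod>j<k. [:w j:]) = [:\<Prod>j<k. w j:]" for k by (induction k) (simp_all add: one_pCons)
    then show ?thesis unfolding prod.distrib by simp
  qed
  finally have "fpsp g = [:u:] * (\<Prod>j<d. [:- \<phi> j, 1:])" by (simp add: u_def)
  moreover have "fps_nth u 0 \<noteq> 0"
  proof -
    have "fps_nth (\<Prod>j<k. w j) 0 = (\<Prod>j<k. fps_nth (w j) 0)" for k by (induction k) simp_all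
    then show ?thesis using w_nz \<gamma> Fc by (simp add: u_def)
  qed
  ultimately have gg: "graph_germ d u \<phi> g" by (simp add: graph_germ_def)
  have coeff: "fps_nth (\<phi> j) i = (if i < N then 0 else - inverse (fps_nth (w j) 0))" if "i \<le> N" for i j
    using that unfolding \<phi>_def by (simp add: fps_X_power_mult_nth)
  have 0: "\<forall>j<d. fps_nth (\<phi> j) 0 = 0" using N_pos by (simp add: coeff)
  have agree: "\<forall>i<d. \<forall>j<d. \<forall>k\<le>N - 1. fps_nth (\<phi> i) k = fps_nth (\<phi> j) k"
    using N_pos by (auto simp: coeff)
  have differ: "inj_on (\<lambda>j. fps_nth (\<phi> j) (Suc (N - 1))) {..<d}"
  proof (rule inj_onI)
    fix i j assume ij: "i \<in> {..<d}" "j \<in> {..<d}" "fps_nth (\<phi> i) (Suc (N - 1)) = fps_nth (\<phi> j) (Suc (N - 1))"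
    then have "fps_nth (w i) 0 = fps_nth (w j) 0" using N_pos by (simp add: coeff)
    then have "fps_nth (\<rho> i) 0 = fps_nth (\<rho> j) 0" using L01 by (simp add: w0)
    then show "i = j" using inj_onD[OF \<rho>(2)] ij by blast
  qed
  have eq: "local_equation G (ppoint c1) f"
    unfolding f_def by (rule local_equation_chart[OF basis3_rotate[OF basis1]])
  have f_nz: "f \<noteq> 0" using fm by auto
  have "blow_down_of_tacnode d (N - 1) f"
    unfolding blow_down_of_tacnode_def
  proof (intro conjI exI[of _ None] allI impI f_nz)
    show "tacnode d (N - 1) (proper_germ f None)"
      unfolding None by (rule graph_germ_tacnode[OF gg 0 agree differ])
    fix e' :: "complex option" assume "e' \<noteq> None"
    then show "coeff (coeff (proper_germ f e') 0) 0 \<noteq> 0" using Some by blast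
  qed
  then show "blow_down_of_tacnode_at d (N - 1) G (ppoint c1)"
    unfolding blow_down_of_tacnode_at_def using eq by blast
  have N_eq: "replicate N d = d # replicate (N - 1) d" using N_pos by (cases N) auto
  have type: "has_type g (replicate N d)"
    using graph_germ_has_type[OF gg d_ge_2 0 agree differ] N_pos by simp
  have "mult_at_0 g = d" using graph_germ_mult(1)[OF gg 0] .
  then have sing: "singular_at_0 g" using d_ge_2 by (simp add: singular_at_0_def)
  have "has_type f (d * N # replicate N d)"
    unfolding N_eq has_type.simps
  proof (intro conjI f_nz mult exI[of _ None] allI impI)
    show "d * N > 1" using d_ge_2 N_pos by (metis One_nat_def Suc_1 Suc_le_lessD le_square mult_le_mono nat_mult_1_right order.strict_trans2)
    show "singular_at_0 (proper_germ f None)" unfolding None by (rule sing)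
    show "has_type (proper_germ f None) (d # replicate (N - 1) d)" unfolding None using type N_eq by simp
    fix e' :: "complex option" assume "e' \<noteq> None"
    then show "\<not> singular_at_0 (proper_germ f e')" using Some not_singular_if_unit by blast
  qed
  then show "type_at G (ppoint c1) (d * N # replicate N d)"
    unfolding type_at_def using eq by blast
qed

text \<open>One transversal line of the pencil, with parameter m, suffices: d distinct roots persist
  for all parameters near m. Outside the zeros of L they are points of the image, so the
  pseudo-remainder, of degree below d in Z, has too many roots over an infinite set and
  vanishes.\<close>

lemma transform_dvd:
  assumes G: "transform G \<gamma>" and H: "plane_curve k H"
    and trans: "\<forall>z. form_at F (pt a b c 1 m z) = 0 \<longrightarrow> pairing (gradient F (pt a b c 1 m z)) c \<noteq> 0"
    and fin: "finite {t. L 1 t = 0}"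
    and H0: "\<And>t z. L 1 t \<noteq> 0 \<Longrightarrow> form_at F (pt a b c 1 t z) = 0 \<Longrightarrow> form_at H (pt a1 b1 c1 1 t (L 1 t * z - B 1 t)) = 0"
  shows "G dvd H"
proof -
  have \<gamma>: "\<gamma> \<noteq> 0" using G unfolding transform_def by blast
  obtain e where e: "plane_curve e G" using G unfolding transform_def by blast
  obtain g where g: "\<And>X Y Z. eval3 g X Y Z = form_at G (pt a1 b1 c1 X Y Z)" using ex_eval3_pt by metis
  obtain h where h: "\<And>X Y Z. eval3 h X Y Z = form_at H (pt a1 b1 c1 X Y Z)" using ex_eval3_pt by metis
  have gr: "degree (map_poly (\<lambda>f. eval2 f X Y) g) \<le> d"
    "coeff (map_poly (\<lambda>f. eval2 f X Y) g) d = \<gamma> * form_at F c * X ^ (N * d)" for X Y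
  proof -
    \<comment> \<open>The reversal in Z of the equation of G for fixed X, Y; its value at 0 is
      \<gamma> F(X^N c), the source of the coefficient \<gamma> F(c) X^(N d) of Z^d.\<close>
    define r where "r = smult \<gamma> (map_poly (\<lambda>p. poly p 0) (chart F (X ^ N *s c) 0 (pt a b c (L X Y * X) (L X Y * Y) (B X Y))))"
    have r: "poly r s = \<gamma> * form_at F (X ^ N *s c + s *s pt a b c (L X Y * X) (L X Y * Y) (B X Y))" for s
      unfolding r_def poly_smult poly_map_eval eval2_chart by simp
    have ev: "poly (map_poly (\<lambda>f. eval2 f X Y) g) Z = eval3 g X Y Z" for Z
      by (induction g) (simp_all add: map_poly_pCons)
    have "poly (map_poly (\<lambda>f. eval2 f X Y) g) Z = Z ^ d * poly r (1 / Z)" if "Z \<noteq> 0" for Z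
    proof -
      have "pt a b c (L X Y * X) (L X Y * Y) (X ^ N * Z + B X Y) =
          Z *s (X ^ N *s c + (1 / Z) *s pt a b c (L X Y * X) (L X Y * Y) (B X Y))"
        using that unfolding vec_eq_iff vector_add_component vector_smult_component pt_nth
        by (auto simp: field_simps)
      then show ?thesis
        unfolding ev g transformD[OF G] r by (simp only: form_at_scale[OF curve] mult.left_commute)
    qed
    from poly_reverse[OF this] show "degree (map_poly (\<lambda>f. eval2 f X Y) g) \<le> d"
      "coeff (map_poly (\<lambda>f. eval2 f X Y) g) d = \<gamma> * form_at F c * X ^ (N * d)"
      using r[of 0] by (auto simp: form_at_scale[OF curve] power_mult)
  qed
  define \<kappa> where "\<kappa> = \<gamma> * form_at F c"
  have \<kappa>: "\<kappa> \<noteq> 0" using \<gamma> Fc by (simp add: \<kappa>_def)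
  have gd: "coeff g d = [:monom \<kappa> (N * d):]"
    by (rule eval2_eqI[OF infinite_UNIV_char_0])
       (use gr(2) in \<open>simp add: coeff_map_poly poly_monom \<kappa>_def\<close>)
  have deg: "degree g = d"
  proof (rule antisym)
    show "d \<le> degree g" using \<kappa> by (intro le_degree) (simp add: gd)
    have "coeff g j = 0" if "j > d" for j
    proof (rule eval2_eqI[OF infinite_UNIV_char_0])
      fix X Y show "eval2 (coeff g j) X Y = eval2 0 X Y"
        using coeff_eq_0[OF le_less_trans[OF gr(1) that], of Y X] by (simp add: coeff_map_poly)
    qed
    then show "degree g \<le> d" by (intro degree_le) simp
  qed
  have "g \<noteq> 0" using \<kappa> gd by auto
  obtain q r where qr: "pseudo_divmod h g = (q, r)" by (cases "pseudo_divmod h g")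
  define M where "M = Suc (degree h) - d"
  have div: "smult ([:monom \<kappa> (N * d):] ^ M) h = g * q + r" and r: "r = 0 \<or> degree r < d"
    using pseudo_divmod[OF \<open>g \<noteq> 0\<close> qr] by (simp_all add: deg gd M_def)
  obtain \<delta> where \<delta>: "\<delta> > 0"
    "\<And>x. cmod x < \<delta> \<Longrightarrow> \<exists>\<zeta>. inj_on \<zeta> {..<d} \<and> (\<forall>j<d. form_at F (pt a b c 1 (m + x) (\<zeta> j)) = 0)"
  proof -
    have "pt a b c 1 m 0 + z *s c = pt a b c 1 m z" "pt a b c 1 m 0 + x *s b + z *s c = pt a b c 1 (m + x) z" for x z
      by (simp_all add: pt_def algebra_simps)
    then show ?thesis using distinct_roots_nearby[OF curve Fc, of "pt a b c 1 m 0" b] trans that by auto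
  qed
  define A where "A = (\<lambda>x. m + x) ` {x. cmod x < \<delta>} - {t. L 1 t = 0}"
  have A: "infinite A"
    unfolding A_def using fin infinite_norm_less[OF \<delta>(1)]
    by (intro Diff_infinite_finite) (auto simp: finite_image_iff inj_on_def)
  \<comment> \<open>The roots are known at (1, t) only; homogeneity of G and H carries them to all
    multiples (s, s t). The remainder itself is not known to be homogeneous.\<close>
  have r0: "eval2 (coeff r j) s (s * t) = 0" if st: "s \<noteq> 0" "t \<in> A" for s t j
  proof -
    obtain \<zeta> where \<zeta>: "inj_on \<zeta> {..<d}" "\<forall>j<d. form_at F (pt a b c 1 t (\<zeta> j)) = 0"
      using st(2) \<delta>(2) unfolding A_def by auto
    have Lt: "L 1 t \<noteq> 0" using st(2) by (simp add: A_def)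
    define \<eta> where "\<eta> j = s * (L 1 t * \<zeta> j - B 1 t)" for j
    define R where "R = map_poly (\<lambda>f. eval2 f s (s * t)) r"
    have R: "poly R Z = eval3 r s (s * t) Z" for Z
      unfolding R_def by (induction r) (simp_all add: map_poly_pCons)
    have pt: "pt a1 b1 c1 s (s * t) (\<eta> j) = s *s pt a1 b1 c1 1 t (L 1 t * \<zeta> j - B 1 t)" for j
      unfolding \<eta>_def pt_scale[symmetric] by simp
    have "poly R (\<eta> j) = 0" if "j < d" for j
    proof -
      have "eval3 h s (s * t) (\<eta> j) = 0" "eval3 g s (s * t) (\<eta> j) = 0"
        unfolding g h pt form_at_scale[OF e] form_at_scale[OF H]
        using H0[OF Lt] transform_chart[OF G] \<zeta>(2) that by simp_all
      moreover have "eval3 (smult ([:monom \<kappa> (N * d):] ^ M) h) s (s * t) (\<eta> j) = eval3 (g * q + r) s (s * t) (\<eta> j)"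
        unfolding div ..
      ultimately show ?thesis unfolding R by simp
    qed
    then have roots: "\<eta> ` {..<d} \<subseteq> {z. poly R z = 0}" by auto
    have inj: "inj_on \<eta> {..<d}" using \<zeta>(1) st(1) Lt by (simp add: inj_on_def \<eta>_def)
    have "R = 0"
    proof (rule ccontr)
      assume nz: "R \<noteq> 0"
      then have "r \<noteq> 0" by (auto simp: R_def)
      then have "degree R < d"
        using r map_poly_degree_leq[of "\<lambda>f. eval2 f s (s * t)" r] by (simp add: R_def)
      moreover have "card (\<eta> ` {..<d}) \<le> card {z. poly R z = 0}"
        using roots nz by (intro card_mono poly_roots_finite)
      ultimately show False using card_poly_roots_bound[OF nz] inj by (simp add: card_image)
    qed
    then have "coeff R j = 0" by simp
    then show ?thesis by (simp add: R_def coeff_map_poly)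
  qed
  have "coeff r j = 0" for j
  proof (rule eval2_eqI)
    show "infinite (- {0::complex})" using infinite_UNIV_char_0 by (simp add: Compl_eq_Diff_UNIV)
    fix x y :: complex assume "x \<in> - {0}"
    then have x: "x \<noteq> 0" by simp
    have "map_poly (\<lambda>p. poly p x) (coeff r j) = 0"
    proof (rule poly_eq_on_infinite)
      show "infinite ((\<lambda>t. x * t) ` A)" using A x by (subst finite_image_iff) (auto simp: inj_on_def)
    qed (use r0[OF x] in \<open>auto simp: poly_map_eval\<close>)
    then have "poly (map_poly (\<lambda>p. poly p x) (coeff r j)) y = 0" by simp
    then show "eval2 (coeff r j) x y = eval2 0 x y" unfolding poly_map_eval by simp
  qed
  then have "r = 0" by (simp add: poly_eq_iff)
  define P where "P = ([:[:[:0, 1:]:]:] :: complex poly poly poly)"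
  have "prime_elem P"
    unfolding P_def prime_elem_const_poly_iff by (rule prime_elem_linear_field_poly) simp
  have lead: "smult ([:monom \<kappa> (N * d):] ^ M) x = [:[:[:\<kappa> ^ M:]:]:] * P ^ (N * d * M) * x" for x
  proof (rule eval3_eqI[OF infinite_UNIV_char_0])
    fix X Y Z
    show "eval3 (smult ([:monom \<kappa> (N * d):] ^ M) x) X Y Z = eval3 ([:[:[:\<kappa> ^ M:]:]:] * P ^ (N * d * M) * x) X Y Z"
      by (simp add: P_def poly_power poly_monom power_mult_distrib power_mult)
  qed
  have "\<not> P dvd g"
  proof
    assume "P dvd g"
    then obtain g' where "g = P * g'" by (auto simp: dvd_def)
    then have "eval3 g 0 1 0 = 0" by (simp add: P_def)
    then show False unfolding g transform_at_infinity[OF G] using \<gamma> centre by simp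
  qed
  have gq: "[:[:[:\<kappa> ^ M:]:]:] * P ^ (N * d * M) * h = g * q"
    using div \<open>r = 0\<close> unfolding lead by simp
  then have "g * q = P ^ (N * d * M) * ([:[:[:\<kappa> ^ M:]:]:] * h)" by (simp only: mult_ac)
  then have "P ^ (N * d * M) dvd g * q" by (rule dvdI)
  \<comment> \<open>The exponents 1 and N d M exceed the given power by one in total, so a prime P
    must divide g or the full power must divide q.\<close>
  then have "P ^ 1 dvd g \<or> P ^ (N * d * M) dvd q"
    by (rule prime_elem_power_dvd_cases) (simp_all add: \<open>prime_elem P\<close>)
  then obtain q' where q': "q = P ^ (N * d * M) * q'" using \<open>\<not> P dvd g\<close> by (auto simp: dvd_def)
  have P_nz: "P ^ (N * d * M) \<noteq> 0" by (simp add: P_def)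
  have "P ^ (N * d * M) * ([:[:[:\<kappa> ^ M:]:]:] * h) = P ^ (N * d * M) * (g * q')"
    using gq unfolding q' by (simp only: mult_ac)
  then have "[:[:[:\<kappa> ^ M:]:]:] * h = g * q'" unfolding mult_left_cancel[OF P_nz] .
  then have "eval3 ([:[:[:\<kappa> ^ M:]:]:] * h) X Y Z = eval3 (g * q') X Y Z" for X Y Z by (simp only:)
  then have val: "\<kappa> ^ M * eval3 h X Y Z = eval3 g X Y Z * eval3 q' X Y Z" for X Y Z by simp
  obtain e1 e2 e3 where dual: "\<And>v. pt a1 b1 c1 (pairing e1 v) (pairing e2 v) (pairing e3 v) = v"
    using basis3_dual[OF basis1] by metis
  \<comment> \<open>The quotient lives in the coordinates of the basis a1, b1, c1; composing with
    the dual forms brings it back to the original ones.\<close>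
  have "polynomial3 (\<lambda>v. inverse (\<kappa> ^ M) * eval3 q' (pairing e1 v) (pairing e2 v) (pairing e3 v))"
    by (intro polynomial3_mult polynomial3_const polynomial3_eval3 polynomial3_pairing)
  then obtain Q where Q: "\<And>v. inverse (\<kappa> ^ M) * eval3 q' (pairing e1 v) (pairing e2 v) (pairing e3 v) = form_at Q v"
    unfolding polynomial3_def by blast
  have "H = G * Q"
  proof (rule eval3_eqI[OF infinite_UNIV_char_0])
    fix x y z
    define v where "v = (vector [x, y, z] :: complex ^ 3)"
    have "\<kappa> ^ M * form_at H v = form_at G v * eval3 q' (pairing e1 v) (pairing e2 v) (pairing e3 v)"
      using val[where X = "pairing e1 v" and Y = "pairing e2 v" and Z = "pairing e3 v"] unfolding g h dual .
    then have "form_at H v = form_at G v * form_at Q v"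
      using \<kappa> unfolding Q[symmetric] by (simp add: field_simps)
    then show "eval3 H x y z = eval3 (G * Q) x y z"
      unfolding form_at_eq_eval3 v_def by (simp add: vector_3)
  qed
  then show ?thesis by simp
qed

end

subsection \<open>Generators of the ideal and the singular points\<close>

lemma local_equation_chartE:
  assumes "local_equation F p f"
  obtains v a b where "p = ppoint v" "basis3 v a b" "f = chart F v a b"
  using assms unfolding local_equation_def chart_def by blast

text \<open>Multiplicity above 1 removes the constant and both linear terms, hence two directional
  derivatives; the third direction is that of \<open>euler_zero\<close>.\<close>

lemma singular_if_type_at:
  assumes "plane_curve d F" "type_at F p (t # ts)"
  shows "p \<in> singular_points F"
proof -
  obtain f where f: "local_equation F p f" "has_type f (t # ts)" using assms(2) unfolding type_at_def by blast
  have "mult_at_0 f > 1" using f(2) by (cases ts) auto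
  obtain v a b where v: "p = ppoint v" "basis3 v a b" "f = chart F v a b"
    using f(1) by (rule local_equation_chartE)
  have coeffs: "coeff (coeff f 0) 0 = 0" "coeff (coeff f 0) 1 = 0" "coeff (coeff f 1) 0 = 0"
    using \<open>mult_at_0 f > 1\<close> coeff_below_mult by auto
  have val: "eval2 f x y = form_at F (v + x *s a + y *s b)" for x y unfolding v(3) eval2_chart ..
  have "form_at F v = eval2 f 0 0" unfolding val by simp
  then have F0: "form_at F v = 0" using coeffs(1) by (simp add: poly_0_coeff_0)
  have "form_at F (v + x *s a) = poly (coeff f 0) x" for x
    using val[where x = x and y = 0] by (simp add: poly_0_coeff_0)
  then have "((\<lambda>x. poly (coeff f 0) x) has_field_derivative pairing (gradient F v) a) (at 0)"
    using DERIV_form_at_line[of F v a] by (simp only:)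
  then have "pairing (gradient F v) a = poly (pderiv (coeff f 0)) 0"
    by (rule DERIV_unique[OF _ poly_DERIV])
  then have 1: "pairing (gradient F v) a = 0" using coeffs(2) by (simp add: poly_0_coeff_0 coeff_pderiv)
  have "form_at F (v + y *s b) = poly (map_poly (\<lambda>p. poly p 0) f) y" for y
    using val[where x = 0 and y = y] unfolding poly_map_eval by simp
  then have "((\<lambda>y. poly (map_poly (\<lambda>p. poly p 0) f) y) has_field_derivative pairing (gradient F v) b) (at 0)"
    using DERIV_form_at_line[of F v b] by (simp only:)
  then have "pairing (gradient F v) b = poly (pderiv (map_poly (\<lambda>p. poly p 0) f)) 0"
    by (rule DERIV_unique[OF _ poly_DERIV])
  then have 2: "pairing (gradient F v) b = 0"
    using coeffs(3) by (simp add: poly_0_coeff_0 coeff_pderiv coeff_map_poly)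
  have "gradient F v = 0"
    using pairing_eq_0_on_basis[OF v(2) euler_zero[OF assms(1) F0] 1 2] .
  moreover have "v \<noteq> 0" using pt_eq_0_iff[OF v(2), of 1 0 0] by (simp add: pt_def)
  ultimately show ?thesis unfolding v(1) ppoint_in_singular_points_iff[OF assms(1)] using F0 by blast
qed

lemma ppoint_cases:
  assumes "basis3 a b c" "v \<noteq> 0"
  obtains (finite) t z where "ppoint v = ppoint (pt a b c 1 t z)"
  | (infinity) Y Z where "v = pt a b c 0 Y Z" "(Y, Z) \<noteq> (0, 0)"
proof -
  obtain X Y Z where v: "v = pt a b c X Y Z" using pt_cases[OF assms(1)] .
  show ?thesis
  proof (cases "X = 0")
    case True
    then have "(Y, Z) \<noteq> (0, 0)" using v assms(2) by (auto simp: pt_def)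
    then show ?thesis using infinity v True by blast
  next
    case False
    then have "ppoint (pt a b c (X * 1) (X * (Y / X)) (X * (Z / X))) = ppoint (pt a b c 1 (Y / X) (Z / X))"
      by (rule ppoint_pt_scale)
    then show ?thesis using finite[of "Y / X" "Z / X"] v False by simp
  qed
qed

lemma ppoint_affine_eq_iff:
  assumes "basis3 a b c"
  shows "ppoint (pt a b c 1 t z) = ppoint (pt a b c 1 t' z') \<longleftrightarrow> t = t' \<and> z = z'"
  unfolding ppoint_eq_iff pt_scale[symmetric] pt_inject[OF assms] by auto

lemma ppoint_affine_neq_infinity:
  assumes "basis3 a b c" shows "ppoint (pt a b c 1 t z) \<noteq> ppoint (pt a b c 0 Y Z)"
  unfolding ppoint_eq_iff pt_scale[symmetric] pt_inject[OF assms] by auto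

text \<open>The outcome of the normal form: \<open>ms\<close> are the parameters t of the lines Q_i
  over X = 1, and \<open>Ls\<close> is the union of all lines with P as the part X = 0. The relation
  T is prescribed only off \<open>Ls\<close>, where it is a map.\<close>

locale cremona = dejonquieres +
  fixes ms :: "complex list" and ns :: "nat list" and k :: complex
    and Ls :: "(complex ^ 3) set set" and T :: "((complex ^ 3) set \<times> (complex ^ 3) set) set"
  assumes length_ms: "length ms = length ns" and distinct_ms: "distinct ms"
    and ns_nonempty: "ns \<noteq> []" and ns_pos: "\<forall>n\<in>set ns. n \<ge> 1" and N_eq: "N = sum_list ns"
    and k_nz: "k \<noteq> 0" and L_eq: "\<And>t. L 1 t = k * (\<Prod>i<length ns. (t - ms ! i) ^ (ns ! i))"
    and trans: "\<And>i z. i < length ns \<Longrightarrow> form_at F (pt a b c 1 (ms ! i) z) = 0 \<Longrightarrow>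
      pairing (gradient F (pt a b c 1 (ms ! i) z)) c \<noteq> 0"
    and trans_inf: "\<And>z. form_at F (pt a b c 0 1 z) = 0 \<Longrightarrow> pairing (gradient F (pt a b c 0 1 z)) c \<noteq> 0"
    and Ls_affine: "\<And>t z. ppoint (pt a b c 1 t z) \<in> Ls \<longleftrightarrow> L 1 t = 0"
    and Ls_inf: "\<And>Y Z. (Y, Z) \<noteq> (0, 0) \<Longrightarrow> ppoint (pt a b c 0 Y Z) \<in> Ls"
    and singular_off_lines: "singular_points F \<inter> Ls = {}"
    and T_affine: "\<And>t z. L 1 t \<noteq> 0 \<Longrightarrow>
      T `` {ppoint (pt a b c 1 t z)} = {ppoint (pt a1 b1 c1 1 t (L 1 t * z - B 1 t))}"
begin

lemma L_eq_0_iff: "L 1 t = 0 \<longleftrightarrow> t \<in> set ms"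
proof -
  have "L 1 t = 0 \<longleftrightarrow> (\<exists>i<length ns. t = ms ! i)"
  proof
    assume "L 1 t = 0"
    then show "\<exists>i<length ns. t = ms ! i" unfolding L_eq using k_nz by (auto simp: prod_zero_iff)
  next
    assume "\<exists>i<length ns. t = ms ! i"
    then obtain i where i: "i < length ns" "t = ms ! i" by blast
    then have "ns ! i \<ge> 1" using ns_pos nth_mem by blast
    then have "(t - ms ! i) ^ (ns ! i) = 0" using i by simp
    then show "L 1 t = 0" unfolding L_eq using i by (auto intro!: prod_zero)
  qed
  then show ?thesis by (auto simp: in_set_conv_nth length_ms)
qed

lemma finite_L: "finite {t. L 1 t = 0}"
  unfolding L_eq_0_iff by simp

definition image_off_lines :: "(complex ^ 3) set set" where
  "image_off_lines = T `` (curve_points F - Ls)"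

lemma image_off_lines_eq: "image_off_lines = {ppoint (pt a1 b1 c1 1 t (L 1 t * z - B 1 t)) | t z.
  L 1 t \<noteq> 0 \<and> form_at F (pt a b c 1 t z) = 0}"
proof -
  have "curve_points F - Ls = {ppoint (pt a b c 1 t z) | t z. L 1 t \<noteq> 0 \<and> form_at F (pt a b c 1 t z) = 0}"
  proof (intro equalityI subsetI)
    fix p assume p: "p \<in> curve_points F - Ls"
    then obtain v where v: "p = ppoint v" "v \<noteq> 0" unfolding curve_points_def by blast
    from basis v(2) show "p \<in> {ppoint (pt a b c 1 t z) | t z. L 1 t \<noteq> 0 \<and> form_at F (pt a b c 1 t z) = 0}"
    proof (cases rule: ppoint_cases)
      case (finite t z)
      then show ?thesis using p v Ls_affine[of t z] ppoint_in_curve_points_iff[OF curve, of "pt a b c 1 t z"] by auto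
    next
      case (infinity Y Z)
      then show ?thesis using p v Ls_inf by blast
    qed
  next
    fix p assume "p \<in> {ppoint (pt a b c 1 t z) | t z. L 1 t \<noteq> 0 \<and> form_at F (pt a b c 1 t z) = 0}"
    then obtain t z where "p = ppoint (pt a b c 1 t z)" "L 1 t \<noteq> 0" "form_at F (pt a b c 1 t z) = 0" by blast
    then show "p \<in> curve_points F - Ls"
      using Ls_affine[of t z] ppoint_in_curve_points_iff[OF curve, of "pt a b c 1 t z"] pt_eq_0_iff[OF basis, of 1 t z] by auto
  qed
  then have "image_off_lines = (\<Union>p\<in>{ppoint (pt a b c 1 t z) | t z. L 1 t \<noteq> 0 \<and> form_at F (pt a b c 1 t z) = 0}. T `` {p})"
    unfolding image_off_lines_def by auto
  then show ?thesis using T_affine by fastforce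
qed

lemma image_off_lines_subset_iff:
  assumes "plane_curve e H"
  shows "image_off_lines \<subseteq> curve_points H \<longleftrightarrow> (\<forall>t z. L 1 t \<noteq> 0 \<longrightarrow> form_at F (pt a b c 1 t z) = 0 \<longrightarrow>
    form_at H (pt a1 b1 c1 1 t (L 1 t * z - B 1 t)) = 0)"
proof -
  have "ppoint (pt a1 b1 c1 1 t z) \<in> curve_points H \<longleftrightarrow> form_at H (pt a1 b1 c1 1 t z) = 0" for t z
    unfolding ppoint_in_curve_points_iff[OF assms] pt_eq_0_iff[OF basis1] by simp
  then have "form_at H (pt a1 b1 c1 1 t z) = 0 \<longleftrightarrow> ppoint (pt a1 b1 c1 1 t z) \<in> curve_points H" for t z
    by blast
  then show ?thesis unfolding image_off_lines_eq by blast
qed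

lemma transform_generates:
  assumes "transform G \<gamma>" "plane_curve e H" "image_off_lines \<subseteq> curve_points H"
  shows "G dvd H"
proof (rule transform_dvd[OF assms(1,2) _ finite_L])
  show "\<forall>z. form_at F (pt a b c 1 (ms ! 0) z) = 0 \<longrightarrow> pairing (gradient F (pt a b c 1 (ms ! 0) z)) c \<noteq> 0"
    using trans[of 0] ns_nonempty by simp
  show "form_at H (pt a1 b1 c1 1 t (L 1 t * z - B 1 t)) = 0" if "L 1 t \<noteq> 0" "form_at F (pt a b c 1 t z) = 0" for t z
    using assms(3) that unfolding image_off_lines_subset_iff[OF assms(2)] by blast
qed

lemma image_off_lines_subset_transform:
  assumes "transform G \<gamma>" shows "image_off_lines \<subseteq> curve_points G"
proof -
  obtain e where "plane_curve e G" using assms unfolding transform_def by blast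
  from image_off_lines_subset_iff[OF this] show ?thesis using transform_chart[OF assms] by simp
qed

text \<open>This is \<open>proper_transform\<close> for the set \<open>Ls\<close>; transversality is
  what will make it coincide with \<open>transform\<close> up to the scalar.\<close>

definition ideal_generator :: "complex poly poly poly \<Rightarrow> bool" where
  "ideal_generator G \<longleftrightarrow> (\<exists>e. plane_curve e G) \<and> image_off_lines \<subseteq> curve_points G \<and>
     (\<forall>e H. plane_curve e H \<and> image_off_lines \<subseteq> curve_points H \<longrightarrow> G dvd H)"

lemma ex_ideal_generator: "\<exists>G. ideal_generator G"
proof -
  obtain G where G: "transform G 1" using ex_transform by blast
  moreover obtain e where "plane_curve e G" using G unfolding transform_def by blast
  ultimately have "ideal_generator G" unfolding ideal_generator_def using image_off_lines_subset_transform transform_generates by blast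
  then show ?thesis ..
qed

text \<open>Generators of the ideal differ by a unit, that is by a constant.\<close>

lemma transform_if_ideal_generator:
  assumes "ideal_generator G" shows "\<exists>\<gamma>. transform G \<gamma>"
proof -
  obtain G0 where G0: "transform G0 1" using ex_transform by blast
  obtain e0 where e0: "plane_curve e0 G0" using G0 unfolding transform_def by blast
  obtain e where e: "plane_curve e G" using assms unfolding ideal_generator_def by blast
  have "G dvd G0" using assms e0 image_off_lines_subset_transform[OF G0] unfolding ideal_generator_def by blast
  then obtain u where u: "G0 = G * u" by (rule dvdE)
  have "G0 dvd G" using transform_generates[OF G0 e] assms unfolding ideal_generator_def by blast
  then obtain w where w: "G = G0 * w" by (rule dvdE)
  have "G0 \<noteq> 0" using e0 unfolding plane_curve_def by blast
  have "G0 * 1 = G0 * (w * u)" using u w by (simp only: mult.assoc mult_1_right)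
  then have "1 = w * u" unfolding mult_left_cancel[OF \<open>G0 \<noteq> 0\<close>] .
  then have "w dvd 1" by (rule dvdI)
  then obtain w1 where w1: "w = [:w1:]" "w1 dvd 1" unfolding is_unit_poly_iff by blast
  then obtain w2 where w2: "w1 = [:w2:]" "w2 dvd 1" unfolding is_unit_poly_iff by blast
  then obtain \<gamma> where "w2 = [:\<gamma>:]" "\<gamma> dvd 1" unfolding is_unit_poly_iff by blast
  then have \<gamma>: "w = [:[:[:\<gamma>:]:]:]" "\<gamma> \<noteq> 0" using w1 w2 by auto
  have "form_at G v = \<gamma> * form_at G0 v" for v
    unfolding w \<gamma> form_at_eq_eval3 by simp
  then have "transform G \<gamma>"
    using transformD[OF G0] \<gamma> e unfolding transform_def by auto
  then show ?thesis ..
qed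

text \<open>The points of G are sorted by the pencil: X = 0 contributes S, each zero of L one point
  of \<open>Rs\<close>, and off these lines the points of G correspond to those of F under an
  explicit bijection preserving singularities.\<close>

theorem transform_singularities:
  assumes G: "transform G \<gamma>"
  shows "\<exists>Rs S \<tau>.
         length Rs = length ns \<and> distinct (S # Rs) \<and>
         set (S # Rs) \<subseteq> singular_points G \<and>
         bij_betw \<tau> (singular_points F) (singular_points G - set (S # Rs)) \<and>
         (\<forall>p\<in>singular_points F. T `` {p} = {\<tau> p} \<and> same_singularity F p G (\<tau> p)) \<and>
         (\<forall>i<length ns. tacnode_at d (ns ! i - 1) G (Rs ! i) \<and>
            type_at G (Rs ! i) (replicate (ns ! i) d)) \<and>
         blow_down_of_tacnode_at d (sum_list ns - 1) G S \<and>
         type_at G S (d * sum_list ns # replicate (sum_list ns) d)"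
proof -
  obtain e where e: "plane_curve e G" and \<gamma>: "\<gamma> \<noteq> 0" using G unfolding transform_def by blast
  define R where "R m = ppoint (pt a1 b1 c1 1 m (- B 1 m))" for m
  define Rs where "Rs = map R ms"
  define S where "S = ppoint c1"
  \<comment> \<open>T is a relation; its image of a point off the lines is a singleton, and all
    singular points of F are off the lines.\<close>
  define \<tau> where "\<tau> p = the_elem (T `` {p})" for p
  have S: "S = ppoint (pt a1 b1 c1 0 0 1)" by (simp add: S_def pt_def)
  have len: "length Rs = length ns" by (simp add: Rs_def length_ms)
  have dist: "distinct (S # Rs)"
    using distinct_ms ppoint_affine_neq_infinity[OF basis1]
    by (auto simp: Rs_def R_def S distinct_map inj_on_def ppoint_affine_eq_iff[OF basis1]) (metis)
  have tac: "tacnode_at d (ns ! i - 1) G (Rs ! i) \<and> type_at G (Rs ! i) (replicate (ns ! i) d)" if i: "i < length ns" for i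
  proof -
    \<comment> \<open>L at the i-th parameter without its own factor; the other parameters differ,
      so it is nonzero at 0.\<close>
    define l where "l = smult k (\<Prod>j\<in>{..<length ns} - {i}. [:ms ! i - ms ! j, 1:] ^ (ns ! j))"
    have "L 1 (ms ! i + x) = x ^ (ns ! i) * poly l x" for x
      unfolding L_eq l_def using i
      by (subst prod.remove[of _ i]) (simp_all add: poly_prod poly_power algebra_simps)
    moreover have "poly l 0 \<noteq> 0"
      using k_nz i distinct_ms length_ms by (auto simp: l_def poly_prod poly_power nth_eq_iff_index_eq)
    moreover have "ns ! i \<ge> 1" using ns_pos i by simp
    ultimately show ?thesis
      using transform_tacnode[OF G, of "ns ! i" "ms ! i" l] trans[OF i] i by (simp add: Rs_def R_def length_ms)
  qed
  have bd: "blow_down_of_tacnode_at d (sum_list ns - 1) G S" "type_at G S (d * sum_list ns # replicate (sum_list ns) d)"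
    using transform_blow_down[OF G] trans_inf unfolding S_def N_eq by blast+
  have "S \<in> singular_points G" using singular_if_type_at[OF e bd(2)] .
  moreover have "Rs ! i \<in> singular_points G" if i: "i < length ns" for i
  proof -
    have "replicate (ns ! i) d = d # replicate (ns ! i - 1) d"
      using ns_pos i by (metis Suc_diff_1 less_eq_Suc_le nth_mem One_nat_def replicate_Suc)
    then show ?thesis using tac[OF i] singular_if_type_at[OF e] by metis
  qed
  ultimately have sub: "set (S # Rs) \<subseteq> singular_points G"
    using len by (auto simp: in_set_conv_nth)
  have sing_F: "\<exists>t z. p = ppoint (pt a b c 1 t z) \<and> L 1 t \<noteq> 0" if p: "p \<in> singular_points F" for p
  proof -
    obtain v where v: "p = ppoint v" "v \<noteq> 0" using p unfolding singular_points_def by blast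
    have "p \<notin> Ls" using p singular_off_lines by blast
    from basis v(2) show ?thesis
    proof (cases rule: ppoint_cases)
      case (finite t z)
      then show ?thesis using \<open>p \<notin> Ls\<close> v Ls_affine[of t z] by auto
    next
      case (infinity Y Z)
      then show ?thesis using \<open>p \<notin> Ls\<close> v Ls_inf by blast
    qed
  qed
  have \<tau>: "\<tau> (ppoint (pt a b c 1 t z)) = ppoint (pt a1 b1 c1 1 t (L 1 t * z - B 1 t))" if "L 1 t \<noteq> 0" for t z
    unfolding \<tau>_def T_affine[OF that] by simp
  have "T `` {p} = {\<tau> p} \<and> same_singularity F p G (\<tau> p)" if p: "p \<in> singular_points F" for p
  proof -
    obtain t z where tz: "p = ppoint (pt a b c 1 t z)" "L 1 t \<noteq> 0" using sing_F[OF p] by blast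
    show ?thesis unfolding tz(1) \<tau>[OF tz(2)] using T_affine[OF tz(2)] transform_same_singularity[OF G tz(2)] by simp
  qed
  moreover have "bij_betw \<tau> (singular_points F) (singular_points G - set (S # Rs))"
  proof (rule bij_betwI')
    fix p p' assume p: "p \<in> singular_points F" "p' \<in> singular_points F"
    obtain t z where tz: "p = ppoint (pt a b c 1 t z)" "L 1 t \<noteq> 0" using sing_F[OF p(1)] by blast
    obtain t' z' where tz': "p' = ppoint (pt a b c 1 t' z')" "L 1 t' \<noteq> 0" using sing_F[OF p(2)] by blast
    show "\<tau> p = \<tau> p' \<longleftrightarrow> p = p'"
      unfolding tz(1) tz'(1) \<tau>[OF tz(2)] \<tau>[OF tz'(2)] ppoint_affine_eq_iff[OF basis] ppoint_affine_eq_iff[OF basis1]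
      using tz(2) by auto
  next
    fix p assume p: "p \<in> singular_points F"
    obtain t z where tz: "p = ppoint (pt a b c 1 t z)" "L 1 t \<noteq> 0" using sing_F[OF p] by blast
    have "\<tau> p \<in> singular_points G"
      using p transform_singular_iff[OF G tz(2), of z] unfolding tz(1) \<tau>[OF tz(2)] by blast
    moreover have "\<tau> p \<noteq> S" unfolding tz(1) \<tau>[OF tz(2)] S by (rule ppoint_affine_neq_infinity[OF basis1])
    moreover have "\<tau> p \<notin> set Rs"
      using tz(2) unfolding tz(1) \<tau>[OF tz(2)] Rs_def R_def L_eq_0_iff
      by (auto simp: ppoint_affine_eq_iff[OF basis1])
    ultimately show "\<tau> p \<in> singular_points G - set (S # Rs)" by simp
  next
    fix q assume q: "q \<in> singular_points G - set (S # Rs)"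
    then obtain v where v: "q = ppoint v" "v \<noteq> 0" "form_at G v = 0" unfolding singular_points_def by blast
    from basis1 v(2) show "\<exists>p\<in>singular_points F. q = \<tau> p"
    proof (cases rule: ppoint_cases)
      case (infinity Y Z)
      have "Y = 0" using v(3) \<gamma> centre unfolding infinity(1) transform_at_infinity[OF G] by auto
      then have "q = ppoint (pt a1 b1 c1 (Z * 0) (Z * 0) (Z * 1))" "Z \<noteq> 0" using v(1) infinity by simp_all
      then have "q = S" unfolding S using ppoint_pt_scale by metis
      then show ?thesis using q by simp
    next
      case (finite t z)
      have z0: "form_at G (pt a1 b1 c1 1 t z) = 0"
        using q ppoint_in_singular_points_iff[OF e, of "pt a1 b1 c1 1 t z"] unfolding v(1) finite by simp
      show ?thesis
      proof (cases "L 1 t = 0")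
        case True
        then have "z = - B 1 t"
          using z0 \<gamma> Fc unfolding transform_at_zero_of_L[OF G True] by (simp add: eq_neg_iff_add_eq_0)
        then have "q \<in> set Rs" using True unfolding v(1) finite L_eq_0_iff Rs_def R_def by simp
        then show ?thesis using q by simp
      next
        case False
        define z1 where "z1 = (z + B 1 t) / L 1 t"
        have z: "L 1 t * z1 - B 1 t = z" using False by (simp add: z1_def)
        have "ppoint (pt a b c 1 t z1) \<in> singular_points F"
          unfolding transform_singular_iff[OF G False] z using q v(1) finite by simp
        moreover have "q = \<tau> (ppoint (pt a b c 1 t z1))" unfolding \<tau>[OF False] z v(1) finite ..
        ultimately show ?thesis by blast
      qed
    qed
  qed
  ultimately show ?thesis
    using len dist sub tac bd by (intro exI[of _ Rs] exI[of _ S] exI[of _ \<tau>]) blast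
qed

end

subsection \<open>Normal form of the Cremona transformation\<close>

text \<open>A form vanishing on v and w is determined by its value on u, so both lines are spanned
  by v and w.\<close>

lemma pline_eq_if_common_points:
  assumes "basis3 u v w" "m \<noteq> 0" "m' \<noteq> 0"
    and "pairing m v = 0" "pairing m w = 0" "pairing m' v = 0" "pairing m' w = 0"
  shows "pline m = pline m'"
proof -
  have mu: "pairing m u \<noteq> 0" "pairing m' u \<noteq> 0" using pairing_eq_0_on_basis[OF assms(1)] assms by blast+
  have "pairing m x = 0 \<longleftrightarrow> pairing m' x = 0" for x
  proof -
    obtain X Y Z where "x = pt u v w X Y Z" using pt_cases[OF assms(1)] .
    then show ?thesis using mu assms by (simp add: pairing_pt)
  qed
  then show ?thesis unfolding pline_def by simp
qed

lemma prod_list_replicate_blocks: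
  fixes f :: "'b \<Rightarrow> 'a::comm_monoid_mult"
  assumes "length ls = length ns"
  shows "(\<Prod>l\<leftarrow>concat (map2 replicate ns ls). f l) = (\<Prod>i<length ns. f (ls ! i) ^ (ns ! i))"
  using assms[symmetric]
proof (induction ns ls rule: list_induct2)
  case (Cons n ns l ls)
  have "(\<Prod>l\<leftarrow>replicate n l. f l) = f l ^ n" by (induction n) simp_all
  then show ?case using Cons by (simp add: prod.lessThan_Suc_shift del: prod.lessThan_Suc)
qed simp

lemma length_replicate_blocks:
  "length ls = length ns \<Longrightarrow> length (concat (map2 replicate ns ls)) = sum_list ns"
  by (induction ls ns rule: list_induct2) simp_all

lemma cremona_image:
  assumes "basis3 a b c" "(s, t) \<noteq> (0, 0)" "\<forall>l\<in>set ls. lin l s t \<noteq> 0"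
  shows "((blowdown a b c)\<inverse> O elementary1_chain 1 ls) `` {ppoint (pt a b c s t z)} =
    {hpoint (1 + length ls) s t ((\<Prod>l\<leftarrow>ls. lin l s t) * z) 1}"
  using elementary1_chain_image[OF assms(2) _ assms(3), of z 1]
  unfolding relcomp_Image blowdown_preimage[OF assms(1,2)] by simp

text \<open>The pencil coordinates are changed by the same matrix on both planes, which keeps the
  map on the pencil the identity. L is the product of the fibre forms, each Q_i repeated n_i times,
  and B the accumulated form of the second chain, both in the new coordinates.\<close>

theorem cremona_normal_form:
  assumes curve: "plane_curve d F" and d: "d \<ge> 2"
    and ns: "ns \<noteq> []" "\<forall>n\<in>set ns. n \<ge> 1" and len: "length Qs = length ns"
    and config: "line_configuration F c Qs P" and T: "is_cremona_T F c Qs P ns T"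
  shows "\<exists>a b a1 b1 c1 L B ms k. cremona F d (sum_list ns) a b c a1 b1 c1 L B ms ns k
    (\<Union> (pline ` set (P # Qs))) T"
proof -
  define N where "N = sum_list ns"
  obtain a0 b0 a1 b1 c1 U Z where basis0: "basis3 a0 b0 c" and basis1: "basis3 a1 b1 c1"
    and U: "U = (blowdown a0 b0 c)\<inverse> O elementary1_chain 1 (concat (map2 replicate ns (map (line_fibre a0 b0) Qs)))"
    and Z: "elementary2_chain (line_fibre a0 b0 P) (N + 1) (U `` curve_points F) N Z"
    and T_eq: "T = U O Z O blowdown a1 b1 c1"
    using T unfolding is_cremona_T_def N_def by blast
  define lp where "lp = line_fibre a0 b0 P"
  define lls where "lls = concat (map2 replicate ns (map (line_fibre a0 b0) Qs))"
  define L0 where "L0 s t = (\<Prod>l\<leftarrow>lls. lin l s t)" for s t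
  have len_lls: "length lls = N"
    unfolding lls_def N_def using length_replicate_blocks[of "map (line_fibre a0 b0) Qs" ns] len by simp
  have N1: "N \<ge> 1"
  proof -
    obtain n ns' where "ns = n # ns'" using ns(1) by (cases ns) auto
    then show ?thesis using ns(2) by (simp add: N_def)
  qed
  have Fc: "form_at F c \<noteq> 0" using config unfolding line_configuration_def by blast
  have mem: "m \<noteq> 0 \<and> pairing m c = 0 \<and> transversal F m" if "m \<in> set (P # Qs)" for m
    using config that unfolding line_configuration_def by blast
  have P: "P \<noteq> 0" "pairing P c = 0" "transversal F P" using mem[of P] by simp_all
  have Q: "Qs ! i \<noteq> 0" "pairing (Qs ! i) c = 0" "transversal F (Qs ! i)" if "i < length ns" for i
    using mem[of "Qs ! i"] that len by simp_all
  have dist: "distinct (map pline (P # Qs))" using config unfolding line_configuration_def by blast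
  obtain B0 where B0: "form2 (N + 1) B0"
    "\<And>s t u v. (s, t) \<noteq> (0, 0) \<Longrightarrow> (u, v) \<noteq> (0, 0) \<Longrightarrow> lin lp s t \<noteq> 0 \<Longrightarrow>
       Z `` {hpoint (N + 1) s t u v} = {hpoint 1 s t (u - B0 s t * v) (lin lp s t ^ N * v)}"
    "hpoint (N + 1) (snd lp) (- fst lp) (B0 (snd lp) (- fst lp)) 1 \<notin> U `` curve_points F"
    using elementary2_chain_image[OF Z] N1 unfolding lp_def by auto
  have lp: "lp = (pairing P a0, pairing P b0)" by (simp add: lp_def line_fibre_def)
  have "lp \<noteq> (0, 0)" using pairing_eq_0_on_basis[OF basis0] P(1,2) unfolding lp by auto
  \<comment> \<open>(q, r) has value 1 under the form of P and (\<open>s0\<close>,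
    \<open>t0\<close>) value 0, so that in the new coordinates this form is X.\<close>
  then obtain q r where qr: "fst lp * q + snd lp * r = 1"
  proof (cases "fst lp = 0")
    case True
    then show ?thesis using that[of 0 "1 / snd lp"] \<open>lp \<noteq> (0, 0)\<close> by (auto simp: prod_eq_iff)
  next
    case False
    then show ?thesis using that[of "1 / fst lp" 0] by simp
  qed
  define s0 where "s0 = snd lp"
  define t0 where "t0 = - fst lp"
  have det: "q * t0 - r * s0 \<noteq> 0"
  proof -
    have "q * t0 - r * s0 = - (fst lp * q + snd lp * r)" by (simp add: s0_def t0_def algebra_simps)
    then show ?thesis using qr by simp
  qed
  \<comment> \<open>In the new basis of the pencil the form of P is X.\<close>
  define a b where "a = q *s a0 + r *s b0" and "b = s0 *s a0 + t0 *s b0"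
  define a' b' where "a' = q *s a1 + r *s b1" and "b' = s0 *s a1 + t0 *s b1"
  have basis: "basis3 a b c" unfolding a_def b_def by (rule basis3_change[OF basis0 det])
  have basis': "basis3 a' b' c1" unfolding a'_def b'_def by (rule basis3_change[OF basis1 det])
  have pt0: "pt a b c X Y W = pt a0 b0 c (q * X + s0 * Y) (r * X + t0 * Y) W" for X Y W
    by (simp add: vec_eq_iff pt_nth a_def b_def algebra_simps)
  have pt1: "pt a' b' c1 X Y W = pt a1 b1 c1 (q * X + s0 * Y) (r * X + t0 * Y) W" for X Y W
    by (simp add: vec_eq_iff pt_nth a'_def b'_def algebra_simps)
  have lin: "lin (line_fibre a0 b0 m) (q * X + s0 * Y) (r * X + t0 * Y) = X * pairing m a + Y * pairing m b" for m X Y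
    unfolding lin_def line_fibre_def a_def b_def pairing_def sum_3 by (simp add: algebra_simps)
  have Pb: "pairing P b = 0" unfolding b_def pairing_def sum_3
    using lp by (simp add: s0_def t0_def pairing_def sum_3 algebra_simps)
  have Pa: "pairing P a = 1"
    using lin[of P 1 0] qr by (simp add: lin_def lp_def[symmetric] mult.commute)
  define L where "L X Y = L0 (q * X + s0 * Y) (r * X + t0 * Y)" for X Y
  define B where "B X Y = B0 (q * X + s0 * Y) (r * X + t0 * Y)" for X Y
  define \<mu> where "\<mu> i = pairing (Qs ! i) b" for i
  \<comment> \<open>The zero of the form of Q_i in t = Y / X. The denominator is nonzero since
    otherwise Q_i would contain b and c and be P.\<close>
  define ms where "ms = map (\<lambda>m. - pairing m a / pairing m b) Qs"
  have ms: "ms ! i = - pairing (Qs ! i) a / \<mu> i" if "i < length ns" for i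
    using that len by (simp add: ms_def \<mu>_def)
  have \<mu>: "\<mu> i \<noteq> 0" if i: "i < length ns" for i
  proof
    assume "\<mu> i = 0"
    then have "pline P = pline (Qs ! i)"
      using pline_eq_if_common_points[OF basis P(1) Q(1)[OF i] Pb P(2) _ Q(2)[OF i]] by (simp add: \<mu>_def)
    moreover have "Qs ! i \<in> set Qs" using i len by simp
    ultimately show False using dist by auto
  qed
  have lin_Q: "pairing (Qs ! i) a + t * \<mu> i = \<mu> i * (t - ms ! i)" if "i < length ns" for i t
    using \<mu>[OF that] ms[OF that] by (simp add: field_simps)
  have L_prod: "L X Y = (\<Prod>i<length ns. (X * pairing (Qs ! i) a + Y * \<mu> i) ^ (ns ! i))" for X Y
    unfolding L_def L0_def lls_def using len
    by (subst prod_list_replicate_blocks) (auto simp: lin \<mu>_def intro!: prod.cong)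
  define k where "k = (\<Prod>i<length ns. \<mu> i ^ (ns ! i))"
  have k: "k \<noteq> 0" using \<mu> by (simp add: k_def)
  have L01: "L 0 1 = k" unfolding L_prod k_def by simp
  have L1: "L 1 t = k * (\<Prod>i<length ns. (t - ms ! i) ^ (ns ! i))" for t
    unfolding L_prod k_def prod.distrib[symmetric] power_mult_distrib[symmetric]
    by (intro prod.cong refl) (simp add: lin_Q)
  have slice: "pt a b c 1 t 0 + z *s c = pt a b c 1 t z" "b + z *s c = pt a b c 0 1 z" for t z
    by (simp_all add: pt_def)
  have root: "pairing (Qs ! i) (pt a b c 1 (ms ! i) z) = 0" if "i < length ns" for i z
    unfolding pairing_pt using lin_Q[OF that, of "ms ! i"] Q(2)[OF that] by (simp add: \<mu>_def)
  have U_image: "U `` {ppoint (pt a0 b0 c s t z)} = {hpoint (N + 1) s t (L0 s t * z) 1}"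
    if "(s, t) \<noteq> (0, 0)" "L0 s t \<noteq> 0" for s t z
  proof -
    have "\<forall>l\<in>set lls. lin l s t \<noteq> 0" using that(2) by (force simp: L0_def prod_list_zero_iff)
    from cremona_image[OF basis0 that(1) this, of z] show ?thesis
      unfolding U lls_def[symmetric] L0_def len_lls by (simp only: add.commute)
  qed
  have st: "(q * X + s0 * Y, r * X + t0 * Y) \<noteq> (0, 0)" if "(X, Y) \<noteq> (0, 0)" for X Y
    using pt_eq_0_iff[OF basis, of X Y 0] pt_eq_0_iff[OF basis0, of "q * X + s0 * Y" "r * X + t0 * Y" 0] that
    unfolding pt0 by auto
  have on_lines: "ppoint v \<in> \<Union> (pline ` set (P # Qs)) \<longleftrightarrow>
      v \<noteq> 0 \<and> (pairing P v = 0 \<or> (\<exists>i<length ns. pairing (Qs ! i) v = 0))" for v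
  proof -
    have "(\<exists>m\<in>set Qs. pairing m v = 0) \<longleftrightarrow> (\<exists>i<length ns. pairing (Qs ! i) v = 0)"
      unfolding len[symmetric] by (metis in_set_conv_nth)
    then show ?thesis by (auto simp: ppoint_in_pline_iff)
  qed
  have "cremona F d N a b c a' b' c1 L B ms ns k (\<Union> (pline ` set (P # Qs))) T"
  proof unfold_locales
    show "plane_curve d F" "d \<ge> 2" "form_at F c \<noteq> 0" "basis3 a b c" "basis3 a' b' c1" "N \<ge> 1"
      "ns \<noteq> []" "\<forall>n\<in>set ns. n \<ge> 1" "N = sum_list ns" "k \<noteq> 0" "L 0 1 \<noteq> 0"
      by (fact curve d Fc basis basis' N1 ns N_def k k[folded L01])+
    show "form2 N L"
      using form2_linear_change[OF form2_prod_lin[of lls]] unfolding L_def L0_def len_lls .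
    show "form2 (Suc N) B"
      using form2_linear_change[OF B0(1)] unfolding B_def by simp
    show "form_at F (pt a b c 0 (L 0 1) (B 0 1)) \<noteq> 0"
    proof
      assume F0: "form_at F (pt a b c 0 (L 0 1) (B 0 1)) = 0"
      \<comment> \<open>A zero of F here is the point with third coordinate B / k on P. The first
        chain multiplies this coordinate by L = k, nonzero on P, and so sends the point to the first
        centre, which is off the curve.\<close>
      have "pt a b c 0 (L 0 1) (B 0 1) = k *s pt a b c 0 1 (B 0 1 / k)"
        using k L01 unfolding pt_scale[symmetric] by simp
      then have "form_at F (pt a b c 0 1 (B 0 1 / k)) = 0"
        using F0 k by (simp add: form_at_scale[OF curve])
      then have "ppoint (pt a0 b0 c s0 t0 (B 0 1 / k)) \<in> curve_points F"
        unfolding ppoint_in_curve_points_iff[OF curve] using pt_eq_0_iff[OF basis, of 0 1]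
        unfolding pt0 by simp
      moreover have "U `` {ppoint (pt a0 b0 c s0 t0 (B 0 1 / k))} = {hpoint (N + 1) s0 t0 (B0 s0 t0) 1}"
      proof -
        have "L0 s0 t0 = k" using L01 by (simp add: L_def)
        then show ?thesis using U_image[of s0 t0 "B 0 1 / k"] st[of 0 1] k by (simp add: B_def)
      qed
      ultimately have "hpoint (N + 1) s0 t0 (B0 s0 t0) 1 \<in> U `` curve_points F" by blast
      then show False using B0(3) by (simp add: s0_def t0_def)
    qed
    show "length ms = length ns" using len by (simp add: ms_def)
    show "distinct ms"
      unfolding distinct_conv_nth
    proof (intro allI impI notI)
      fix i j assume ij: "i < length ms" "j < length ms" "i \<noteq> j" "ms ! i = ms ! j"
      then have i: "i < length ns" "j < length ns" using len by (simp_all add: ms_def)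
      \<comment> \<open>Equal parameters would give two lines through the same two points, this one
        and c.\<close>
      have "basis3 b (pt a b c 1 (ms ! i) 0) c" by (rule basis3_swap[OF basis3_affine[OF basis]])
      then have "pline (Qs ! i) = pline (Qs ! j)"
        using pline_eq_if_common_points[OF _ Q(1)[OF i(1)] Q(1)[OF i(2)] root[OF i(1), of 0] Q(2)[OF i(1)] _ Q(2)[OF i(2)]]
          root[OF i(2), of 0] ij(4) by simp
      moreover have "distinct (map pline Qs)" using dist by simp
      ultimately show False using nth_eq_iff_index_eq[of "map pline Qs" i j] i ij(3) len by simp
    qed
    show "L 1 t = k * (\<Prod>i<length ns. (t - ms ! i) ^ (ns ! i))" for t by (rule L1)
    show "pairing (gradient F (pt a b c 1 (ms ! i) z)) c \<noteq> 0"
      if "i < length ns" "form_at F (pt a b c 1 (ms ! i) z) = 0" for i z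
      using transversal_slice[OF curve Q(3,1)[OF that(1)] basis3_affine[OF basis]
          root[OF that(1), of 0] Q(2)[OF that(1)], where z = z] that(2)
      unfolding slice by blast
    show "pairing (gradient F (pt a b c 0 1 z)) c \<noteq> 0" if "form_at F (pt a b c 0 1 z) = 0" for z
      using transversal_slice[OF curve P(3,1) basis3_swap[OF basis] Pb P(2)] that unfolding slice by blast
    show "ppoint (pt a b c 1 t z) \<in> \<Union> (pline ` set (P # Qs)) \<longleftrightarrow> L 1 t = 0" for t z
    proof -
      have "L 1 t = 0 \<longleftrightarrow> (\<exists>i<length ns. pairing (Qs ! i) a + t * \<mu> i = 0)"
      proof
        assume "L 1 t = 0"
        then show "\<exists>i<length ns. pairing (Qs ! i) a + t * \<mu> i = 0" unfolding L_prod by (auto simp: prod_zero_iff)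
      next
        assume "\<exists>i<length ns. pairing (Qs ! i) a + t * \<mu> i = 0"
        then obtain i where i: "i < length ns" "pairing (Qs ! i) a + t * \<mu> i = 0" by blast
        then have "ns ! i \<ge> 1" using ns(2) nth_mem by blast
        then have "(1 * pairing (Qs ! i) a + t * \<mu> i) ^ (ns ! i) = 0" using i(2) by simp
        then show "L 1 t = 0" unfolding L_prod using i(1) by (intro prod_zero) blast+
      qed
      moreover have "pairing (Qs ! i) (pt a b c 1 t z) = pairing (Qs ! i) a + t * \<mu> i" if "i < length ns" for i
        unfolding pairing_pt Q(2)[OF that] by (simp add: \<mu>_def)
      moreover have "pairing P (pt a b c 1 t z) = 1" unfolding pairing_pt Pa Pb P(2) by simp
      ultimately show ?thesis unfolding on_lines pt_eq_0_iff[OF basis] by auto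
    qed
    show "ppoint (pt a b c 0 Y W) \<in> \<Union> (pline ` set (P # Qs))" if "(Y, W) \<noteq> (0, 0)" for Y W
      unfolding on_lines pt_eq_0_iff[OF basis] pairing_pt Pb P(2) using that by auto
    show "singular_points F \<inter> \<Union> (pline ` set (P # Qs)) = {}"
    proof (rule equals0I)
      fix p assume p: "p \<in> singular_points F \<inter> \<Union> (pline ` set (P # Qs))"
      then obtain v where v: "p = ppoint v" "v \<noteq> 0" "form_at F v = 0" "gradient F v = 0"
        unfolding singular_points_def by blast
      obtain m where m: "m \<in> set (P # Qs)" "p \<in> pline m" using p by blast
      then have "pairing m v = 0" unfolding v(1) ppoint_in_pline_iff by blast
      moreover have "gradient F v = 0 *s m" using v(4) by simp
      ultimately show False using mem[OF m(1)] v(2,3) unfolding transversal_def by blast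
    qed
    show "T `` {ppoint (pt a b c 1 t z)} = {ppoint (pt a' b' c1 1 t (L 1 t * z - B 1 t))}" if Lt: "L 1 t \<noteq> 0" for t z
    proof -
      define s where "s = q * 1 + s0 * t"
      define s' where "s' = r * 1 + t0 * t"
      have nz: "(s, s') \<noteq> (0, 0)" using st[of 1 t] unfolding s_def s'_def by simp
      have Ls: "L0 s s' = L 1 t" "B0 s s' = B 1 t" by (simp_all add: L_def B_def s_def s'_def)
      have lp1: "lin lp s s' = 1" unfolding lp_def s_def s'_def lin Pa Pb by simp
      have "T `` {ppoint (pt a b c 1 t z)} = blowdown a1 b1 c1 `` (Z `` (U `` {ppoint (pt a0 b0 c s s' z)}))"
        unfolding T_eq relcomp_Image pt0 s_def s'_def ..
      also have "\<dots> = blowdown a1 b1 c1 `` (Z `` {hpoint (N + 1) s s' (L 1 t * z) 1})"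
        using U_image[OF nz] Lt unfolding Ls by simp
      also have "\<dots> = blowdown a1 b1 c1 `` {hpoint 1 s s' (L 1 t * z - B 1 t) 1}"
        using B0(2)[OF nz, of "L 1 t * z" 1] unfolding lp1 Ls by simp
      also have "\<dots> = {ppoint (pt a1 b1 c1 (s * 1) (s' * 1) (L 1 t * z - B 1 t))}"
        by (rule blowdown_image[OF nz]) simp
      also have "pt a1 b1 c1 (s * 1) (s' * 1) (L 1 t * z - B 1 t) = pt a' b' c1 1 t (L 1 t * z - B 1 t)"
        unfolding pt1 s_def s'_def by simp
      finally show ?thesis .
    qed
  qed
  then show ?thesis unfolding N_def by blast
qed

text \<open>Existence of a proper transform is stated separately, so that the claim about every G
  has content. The bound d >= 2 matches \<open>has_type\<close>, whose entries must exceed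
  1.\<close>

theorem proposition5p2:
  fixes F :: "complex poly poly poly" and d :: nat
    and ns :: "nat list" and Qs :: "(complex ^ 3) list" and P o' :: "complex ^ 3"
    and T :: "((complex ^ 3) set \<times> (complex ^ 3) set) set"
  assumes "plane_curve d F" and "d \<ge> 2"
    and "ns \<noteq> []" and "\<forall>n\<in>set ns. n \<ge> 1"
    and "length Qs = length ns"
    and "line_configuration F o' Qs P"
    and "is_cremona_T F o' Qs P ns T"
  shows "(\<exists>G. proper_transform T (P # Qs) F G) \<and>
    (\<forall>G. proper_transform T (P # Qs) F G \<longrightarrow>
      (\<exists>Rs S \<tau>.
         length Rs = length ns \<and> distinct (S # Rs) \<and>
         set (S # Rs) \<subseteq> singular_points G \<and>
         bij_betw \<tau> (singular_points F) (singular_points G - set (S # Rs)) \<and>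
         (\<forall>p\<in>singular_points F. T `` {p} = {\<tau> p} \<and> same_singularity F p G (\<tau> p)) \<and>
         (\<forall>i<length ns. tacnode_at d (ns ! i - 1) G (Rs ! i) \<and>
            type_at G (Rs ! i) (replicate (ns ! i) d)) \<and>
         blow_down_of_tacnode_at d (sum_list ns - 1) G S \<and>
         type_at G S (d * sum_list ns # replicate (sum_list ns) d)))"
proof -
  obtain a b a1 b1 c1 L B ms k where
    "cremona F d (sum_list ns) a b o' a1 b1 c1 L B ms ns k (\<Union> (pline ` set (P # Qs))) T"
    using cremona_normal_form[OF assms] by blast
  then interpret cremona F d "sum_list ns" a b o' a1 b1 c1 L B ms ns k "\<Union> (pline ` set (P # Qs))" T .
  have "proper_transform T (P # Qs) F G \<longleftrightarrow> ideal_generator G" for G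
    unfolding proper_transform_def ideal_generator_def image_off_lines_def Let_def ..
  then show ?thesis using ex_ideal_generator transform_if_ideal_generator transform_singularities by metis
qed

end
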